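(* Let $c$ be a speed function. For all $q\in\mathbb R$ and all $(x,y)$ in the interior of $\mathcal W$, $$\lim_{n\to\infty}n^{-1}T^{n,\lfloor nq\rfloor}(\lfloor nx\rfloor,\lfloor ny\rfloor)=\Gamma^q(x,y)\quad\text{a.s.}$$
   Context: A speed function is a function $c:\mathbb R\to(0,\infty)$ that is lower semicontinuous, such that at every $x$ the one-sided limits $c(x\pm)$ exist and $c(x)=\min\{c(x-),c(x+)\}$, and which has only finitely many discontinuities in every compact set. Wedge: $\mathcal W=\{(x,y)\in\mathbb R^2:y\ge0,\ x\ge -y\}$; $\gamma(x,y)=(\sqrt{x+y}+\sqrt y)^2$ on $\mathcal W$. $\mathcal H(x,y)$ is the set of continuous piecewise $C^1$ paths $\mathbf x=(x_1,x_2):[0,1]\to\mathcal W$ with $\mathbf x(0)=(0,0)$, $\mathbf x(1)=(x,y)$ and $\mathbf x'(s)\in\mathcal W$ wherever defined. For $q\in\mathbb R$, $\Gamma^q(x,y)=\sup_{\mathbf x\in\mathcal H(x,y)}\int_0^1\frac{\gamma(\mathbf x'(s))}{c(x_1(s)-q)}ds$. Lattice wedge: $\mathcal L=\{(i,j)\in\mathbb Z^2: j\ge1,\ i\ge -j+1\}$ with boundary $\partial\mathcal L=\{(i,0):i\ge0\}\cup\{(i,-i):i<0\}$. For each $n$, $\{\tau^n_{i,j}:(i,j)\in\mathcal L\}$ are i.i.d. exponential with mean $1$. For $\ell\in\mathbb Z$, weights $\omega^{n,\ell}_{i,j}=c((i-\ell)/n)^{-1}$. $\Pi(u,v)$ is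 the set of lattice paths $(0,1)=(i_0,j_0),\dots,(i_p,j_p)=(u,v)$ with steps $(i_k,j_k)-(i_{k-1},j_{k-1})\in\{(1,0),(0,1),(-1,1)\}$. The wedge last-passage time is $T^{n,\ell}(u,v)=\max_{\pi\in\Pi(u,v)}\sum_{(i,j)\in\pi}\omega^{n,\ell}_{i,j}\tau^n_{i,j}$ for $(u,v)\in\mathcal L$, and $T^{n,\ell}=0$ on $\partial\mathcal L$. *)

theory Defs
  imports "HOL-Probability.Probability"
begin

definition lsc_at :: "(real \<Rightarrow> real) \<Rightarrow> real \<Rightarrow> bool" where
  "lsc_at c x \<longleftrightarrow> (\<forall>a. a < c x \<longrightarrow> (\<forall>\<^sub>F y in at x. a < c y))"

definition speed_function :: "(real \<Rightarrow> real) \<Rightarrow> bool" where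
  "speed_function c \<longleftrightarrow>
     (\<forall>x. 0 < c x) \<and>
     (\<forall>x. lsc_at c x) \<and>
     (\<forall>x. (\<exists>l. (c \<longlongrightarrow> l) (at_left x)) \<and> (\<exists>r. (c \<longlongrightarrow> r) (at_right x))) \<and>
     (\<forall>x. c x = min (Lim (at_left x) c) (Lim (at_right x) c)) \<and>
     (\<forall>K. compact K \<longrightarrow> finite {x\<in>K. \<not> isCont c x})"

definition wedge :: "(real \<times> real) set" where
  "wedge = {(x, y). 0 \<le> y \<and> - y \<le> x}"

definition gamma :: "real \<times> real \<Rightarrow> real" where
  "gamma p = (sqrt (fst p + snd p) + sqrt (snd p))\<^sup>2"

definition admissible_paths :: "real \<times> real \<Rightarrow> (real \<Rightarrow> real \<times> real) set" where
  "admissible_paths p = {g. g piecewise_C1_differentiable_on {0..1}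
      \<and> (\<forall>s\<in>{0..1}. g s \<in> wedge) \<and> g 0 = (0, 0) \<and> g 1 = p
      \<and> (\<forall>s\<in>{0..1}. \<forall>v. (g has_vector_derivative v) (at s) \<longrightarrow> v \<in> wedge)}"

definition Gamma :: "(real \<Rightarrow> real) \<Rightarrow> real \<Rightarrow> real \<times> real \<Rightarrow> real" where
  "Gamma c q p = Sup ((\<lambda>g. integral {0..1}
        (\<lambda>s. gamma (vector_derivative g (at s)) / c (fst (g s) - q))) ` admissible_paths p)"

definition lattice_wedge :: "(int \<times> int) set" where
  "lattice_wedge = {(i, j). 1 \<le> j \<and> - j + 1 \<le> i}"

definition lattice_steps :: "(int \<times> int) set" where
  "lattice_steps = {(1, 0), (0, 1), (-1, 1)}"

definition lattice_paths :: "int \<times> int \<Rightarrow> (int \<times> int) list set" where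
  "lattice_paths p = {\<pi>. \<pi> \<noteq> [] \<and> hd \<pi> = (0, 1) \<and> last \<pi> = p \<and>
      (\<forall>k. Suc k < length \<pi> \<longrightarrow>
         (fst (\<pi> ! Suc k) - fst (\<pi> ! k), snd (\<pi> ! Suc k) - snd (\<pi> ! k)) \<in> lattice_steps)}"

definition lpp :: "(real \<Rightarrow> real) \<Rightarrow> nat \<Rightarrow> int \<Rightarrow> (int \<times> int \<Rightarrow> real) \<Rightarrow> int \<times> int \<Rightarrow> real" where
  "lpp c n l tau p = (if p \<in> lattice_wedge then
      Max ((\<lambda>\<pi>. sum_list (map (\<lambda>(i, j). tau (i, j) / c (real_of_int (i - l) / real n)) \<pi>))
             ` lattice_paths p)
    else 0)"

end

(* In the coordinates u = x + y, v = y the model is exponential last passage percolation on the quadrant,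
   with weights depending on u - v; the diagonal steps never help.

   Homogeneous case: give the axes exponential weights of rates al and 1 - al.  By Burke's property the
   increments along the far sides of a rectangle are again independent exponentials of these rates, so the
   stationary passage time concentrates around m / al + k / (1 - al).  Minimising over al bounds the passage
   time from above by (sqrt m + sqrt k)^2; conversely, at the minimising al a maximal stationary path must
   leave the axes near the corner, which gives the same bound from below.  Both errors are exponentially
   unlikely, uniformly over all rectangles, so almost surely every large rectangle obeys the law.

   Inhomogeneous case: Gamma, the upper limit and the lower limit are all compared with sums of
   gamma(increment) / (infimum of the speed nearby) over chains of points of small mesh.  Such a sum can
   be realised, up to a small error, by rectangles on which c is nearly constant: the only obstruction is
   a stretch of the chain running along a discontinuity of c, which is replaced by a run parallel to it on
   the side with the smaller speed.  This is where c(x) = min(c(x-), c(x+)) enters. *)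

theory Submission
  imports Defs "HOL-Real_Asymp.Real_Asymp"
begin

section \<open>Burke's property\<close>

text \<open>Only independence inside each array is assumed; arrays for different \<open>n\<close>
  may be coupled in any way. Almost sure convergence therefore has to come from summable tails and
  the Borel-Cantelli lemma. Exponential tails leave room for a union over all of the order of
  \<open>n^4\<close> rectangles of size of order \<open>n\<close>, and from there on everything is
  deterministic, on one event that serves all speeds and all end points.

  The obstacle in the deterministic part is that at a jump of \<open>c\<close> the infimum and the
  supremum of the speed over a small rectangle are not comparable. So two one-sided quantities are
  kept apart. Sums over chains with the infimum of the speed in a window dominate every path
  integral and every lattice path. The relation \<open>attains\<close>, which bounds the speed on a
  rectangle from above, yields values that path integrals and lattice paths can both realise. The
  two sides meet in \<open>chain_value_attained\<close>. \<open>Gamma\<close> is used as a supremum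
  throughout: no maximiser is constructed and no regularity of nearly optimal paths enters.\<close>

abbreviation expm :: "real \<Rightarrow> real measure" where
  "expm r \<equiv> density lborel (\<lambda>x. ennreal (exponential_density r x))"

text \<open>\<open>x\<close> and \<open>y\<close> are the increments of the passage time below and
  to the left of a cell of weight \<open>w\<close>; the first two components are the increments
  above it and to its right. With the minimum as a third component the map is an involution on
  triples, which makes an exact change of variables possible.\<close>

definition bmap :: "real \<Rightarrow> real \<Rightarrow> real \<Rightarrow> real \<times> real \<times> real" where
  "bmap x y w = (w + max 0 (x - y), w + max 0 (y - x), min x y)"

lemma bmap_measurable [measurable]:
  "(\<lambda>p. bmap (fst p) (fst (snd p)) (snd (snd p))) \<in> borel_measurable borel"
  unfolding bmap_def borel_prod [symmetric] by measurable

lemma nn_integral_expm: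
  assumes [measurable]: "g \<in> borel_measurable borel"
  shows "(\<integral>\<^sup>+x. g x \<partial>expm r) = (\<integral>\<^sup>+x. ennreal (exponential_density r x) * g x \<partial>lborel)"
  by (simp add: nn_integral_density)

lemma measurable_indicator_less [measurable]:
  fixes f g :: "'b \<Rightarrow> real"
  assumes [measurable]: "f \<in> borel_measurable N" "g \<in> borel_measurable N"
  shows "(\<lambda>t. indicator {f t<..} (g t) :: ennreal) \<in> borel_measurable N"
    and "(\<lambda>t. indicator {..f t} (g t) :: ennreal) \<in> borel_measurable N"
proof -
  have "(\<lambda>t. if f t < g t then 1 else 0 :: ennreal) \<in> borel_measurable N"
    "(\<lambda>t. if g t \<le> f t then 1 else 0 :: ennreal) \<in> borel_measurable N"
    by measurable
  then show "(\<lambda>t. indicator {f t<..} (g t) :: ennreal) \<in> borel_measurable N"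
    "(\<lambda>t. indicator {..f t} (g t) :: ennreal) \<in> borel_measurable N"
    by (simp_all add: indicator_def of_bool_def)
qed

lemma nn_integral_translate:
  fixes t :: real
  assumes [measurable]: "g \<in> borel_measurable borel"
  shows "(\<integral>\<^sup>+x. g x \<partial>lborel) = (\<integral>\<^sup>+x. g (x + t) \<partial>lborel)"
  using nn_integral_real_affine[OF assms, of 1 t] by (simp add: add.commute)

lemma measurable_triple:
  fixes F :: "real \<times> real \<times> real \<Rightarrow> 'b::topological_space"
  assumes "F \<in> borel_measurable borel"
    and "f \<in> borel_measurable N" "g \<in> borel_measurable N" "h \<in> borel_measurable N"
  shows "(\<lambda>x. F (f x, g x, h x)) \<in> borel_measurable N"
  by (rule measurable_compose[OF _ assms(1)]) (use assms in \<open>simp add: borel_prod[symmetric]\<close>)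

lemma nn_integral_expm3:
  assumes F: "F \<in> borel_measurable borel"
  shows "(\<integral>\<^sup>+w. \<integral>\<^sup>+y. \<integral>\<^sup>+x. F (x, y, w) \<partial>expm p \<partial>expm q \<partial>expm r) =
    (\<integral>\<^sup>+w. \<integral>\<^sup>+y. \<integral>\<^sup>+x. ennreal (exponential_density r w) * (ennreal (exponential_density q y) *
       (ennreal (exponential_density p x) * F (x, y, w))) \<partial>lborel \<partial>lborel \<partial>lborel)"
proof -
  note [measurable] = measurable_triple[OF F]
  show ?thesis
    by (simp add: nn_integral_expm nn_integral_cmult)
qed

lemma nn_integral_swap12:
  fixes h :: "real \<Rightarrow> real \<Rightarrow> ennreal"
  assumes "(\<lambda>(x, y). h x y) \<in> borel_measurable (lborel \<Otimes>\<^sub>M lborel)"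
  shows "(\<integral>\<^sup>+x. \<integral>\<^sup>+y. h x y \<partial>lborel \<partial>lborel) = (\<integral>\<^sup>+y. \<integral>\<^sup>+x. h x y \<partial>lborel \<partial>lborel)"
  using lborel_pair.Fubini'[of h] assms by simp

lemma nn_integral_add3:
  fixes G H :: "real \<Rightarrow> real \<Rightarrow> real \<Rightarrow> ennreal"
  assumes "(\<lambda>p. G (fst p) (fst (snd p)) (snd (snd p))) \<in> borel_measurable (borel \<Otimes>\<^sub>M borel \<Otimes>\<^sub>M borel)"
    and "(\<lambda>p. H (fst p) (fst (snd p)) (snd (snd p))) \<in> borel_measurable (borel \<Otimes>\<^sub>M borel \<Otimes>\<^sub>M borel)"
  shows "(\<integral>\<^sup>+w. \<integral>\<^sup>+y. \<integral>\<^sup>+x. G x y w + H x y w \<partial>lborel \<partial>lborel \<partial>lborel) =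
    (\<integral>\<^sup>+w. \<integral>\<^sup>+y. \<integral>\<^sup>+x. G x y w \<partial>lborel \<partial>lborel \<partial>lborel) +
    (\<integral>\<^sup>+w. \<integral>\<^sup>+y. \<integral>\<^sup>+x. H x y w \<partial>lborel \<partial>lborel \<partial>lborel)"
proof -
  have G: "(\<lambda>t. G (f t) (g t) (h t)) \<in> borel_measurable N"
    if "f \<in> borel_measurable N" "g \<in> borel_measurable N" "h \<in> borel_measurable N" for f g h and N :: "'z measure"
    using measurable_compose[OF _ assms(1), of "\<lambda>t. (f t, g t, h t)" N] that by simp
  have H: "(\<lambda>t. H (f t) (g t) (h t)) \<in> borel_measurable N"
    if "f \<in> borel_measurable N" "g \<in> borel_measurable N" "h \<in> borel_measurable N" for f g h and N :: "'z measure"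
    using measurable_compose[OF _ assms(2), of "\<lambda>t. (f t, g t, h t)" N] that by simp
  note [measurable] = G H
  show ?thesis by (simp add: nn_integral_add)
qed

text \<open>The map sends each of the regions \<open>x > y\<close> and \<open>x \<le> y\<close> to
  itself and is linear there, with determinant of modulus 1. The exponent
  \<open>\<alpha> * x + \<beta> * y + w\<close> of the joint density is invariant on both because
  \<open>\<alpha> + \<beta> = 1\<close>.\<close>

theorem burke_triple:
  assumes ab: "\<alpha> > 0" "\<beta> > 0" "\<alpha> + \<beta> = 1"
    and F: "F \<in> borel_measurable borel"
  shows "(\<integral>\<^sup>+w. \<integral>\<^sup>+y. \<integral>\<^sup>+x. F (bmap x y w) \<partial>expm \<alpha> \<partial>expm \<beta> \<partial>expm 1) =
         (\<integral>\<^sup>+w. \<integral>\<^sup>+y. \<integral>\<^sup>+x. F (x, y, w) \<partial>expm \<alpha> \<partial>expm \<beta> \<partial>expm 1)"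
proof -
  note FM = measurable_triple[OF F]
  note [measurable] = FM
  let ?a = "\<lambda>x. ennreal (exponential_density \<alpha> x)"
  let ?b = "\<lambda>x. ennreal (exponential_density \<beta> x)"
  let ?e = "\<lambda>x. ennreal (exponential_density 1 x)"
  have Fb: "(\<lambda>t. F (bmap (fst t) (fst (snd t)) (snd (snd t)))) \<in> borel_measurable borel"
    by (rule measurable_compose[OF bmap_measurable F])
  have split1: "F (bmap x y w) = F (w + (x - y), w, y) * indicator {y<..} x + F (w, w + (y - x), x) * indicator {..y} x" for x y w
    by (auto simp: bmap_def indicator_def max_def min_def)
  have split2: "F (x, y, w) = F (x, y, w) * indicator {y<..} x + F (x, y, w) * indicator {..y} x" for x y w
    by (auto simp: indicator_def)
  have "(\<integral>\<^sup>+w. \<integral>\<^sup>+y. \<integral>\<^sup>+x. F (bmap x y w) \<partial>expm \<alpha> \<partial>expm \<beta> \<partial>expm 1)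
    = (\<integral>\<^sup>+w. \<integral>\<^sup>+y. \<integral>\<^sup>+x. ?e w * (?b y * (?a x * F (bmap x y w))) \<partial>lborel \<partial>lborel \<partial>lborel)"
    using nn_integral_expm3[OF Fb] by simp
  also have "\<dots> = (\<integral>\<^sup>+w. \<integral>\<^sup>+y. \<integral>\<^sup>+x. ?e w * (?b y * (?a x * (F (w + (x - y), w, y) * indicator {y<..} x))) \<partial>lborel \<partial>lborel \<partial>lborel)
     + (\<integral>\<^sup>+w. \<integral>\<^sup>+y. \<integral>\<^sup>+x. ?e w * (?b y * (?a x * (F (w, w + (y - x), x) * indicator {..y} x))) \<partial>lborel \<partial>lborel \<partial>lborel)"
    (is "_ = ?A + ?B")
    unfolding split1 distrib_left by (rule nn_integral_add3) measurable
  \<comment> \<open>Translating \<open>x\<close> by \<open>y - w\<close> turns the first argument of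
    \<open>F\<close> into \<open>x\<close>. The density is unchanged up to an exchange of the roles
    of \<open>w\<close> and \<open>y\<close>, which the swap of integrals that follows
    undoes.\<close>
  also have "?A = (\<integral>\<^sup>+w. \<integral>\<^sup>+y. \<integral>\<^sup>+x. ?e y * (?b w * (?a x * (F (x, w, y) * indicator {w<..} x))) \<partial>lborel \<partial>lborel \<partial>lborel)"
  proof (rule nn_integral_cong, rule nn_integral_cong)
    fix w y :: real
    have "(\<integral>\<^sup>+x. ?e w * (?b y * (?a x * (F (w + (x - y), w, y) * indicator {y<..} x))) \<partial>lborel)
      = (\<integral>\<^sup>+x. ?e w * (?b y * (?a (x + (y - w)) * (F (w + (x + (y - w) - y), w, y) * indicator {y<..} (x + (y - w))))) \<partial>lborel)"
      by (rule nn_integral_translate) measurable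
    also have "\<dots> = (\<integral>\<^sup>+x. ?e y * (?b w * (?a x * (F (x, w, y) * indicator {w<..} x))) \<partial>lborel)"
    proof (intro nn_integral_cong)
      fix x :: real
      have be: "\<beta> = 1 - \<alpha>" using ab by simp
      have "x > w \<Longrightarrow> exponential_density 1 w * (exponential_density \<beta> y * exponential_density \<alpha> (x + (y - w)))
         = exponential_density 1 y * (exponential_density \<beta> w * exponential_density \<alpha> x)"
        using ab by (auto simp: exponential_density_def mult_exp_exp be algebra_simps)
      then have "x > w \<Longrightarrow> ?e w * (?b y * ?a (x + (y - w))) = ?e y * (?b w * ?a x)"
        using ab by (simp add: ennreal_mult[symmetric] exponential_density_nonneg)
      then show "?e w * (?b y * (?a (x + (y - w)) * (F (w + (x + (y - w) - y), w, y) * indicator {y<..} (x + (y - w)))))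
         = ?e y * (?b w * (?a x * (F (x, w, y) * indicator {w<..} x)))"
        by (auto simp: indicator_def mult.assoc[symmetric])
    qed
    finally show "(\<integral>\<^sup>+x. ?e w * (?b y * (?a x * (F (w + (x - y), w, y) * indicator {y<..} x))) \<partial>lborel) = \<dots>" .
  qed
  also have "\<dots> = (\<integral>\<^sup>+w. \<integral>\<^sup>+y. \<integral>\<^sup>+x. ?e w * (?b y * (?a x * (F (x, y, w) * indicator {y<..} x))) \<partial>lborel \<partial>lborel \<partial>lborel)"
    by (rule nn_integral_swap12) measurable
  also have "?B = (\<integral>\<^sup>+w. \<integral>\<^sup>+x. \<integral>\<^sup>+y. ?e w * (?b y * (?a x * (F (w, w + (y - x), x) * indicator {..y} x))) \<partial>lborel \<partial>lborel \<partial>lborel)"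
    by (rule nn_integral_cong, rule nn_integral_swap12) measurable
  also have "\<dots> = (\<integral>\<^sup>+w. \<integral>\<^sup>+x. \<integral>\<^sup>+y. ?e x * (?b y * (?a w * (F (w, y, x) * indicator {..y} w))) \<partial>lborel \<partial>lborel \<partial>lborel)"
  proof (rule nn_integral_cong, rule nn_integral_cong)
    fix w x :: real
    have "(\<integral>\<^sup>+y. ?e w * (?b y * (?a x * (F (w, w + (y - x), x) * indicator {..y} x))) \<partial>lborel)
      = (\<integral>\<^sup>+y. ?e w * (?b (y + (x - w)) * (?a x * (F (w, w + (y + (x - w) - x), x) * indicator {..y + (x - w)} x))) \<partial>lborel)"
      by (rule nn_integral_translate) measurable
    also have "\<dots> = (\<integral>\<^sup>+y. ?e x * (?b y * (?a w * (F (w, y, x) * indicator {..y} w))) \<partial>lborel)"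
    proof (intro nn_integral_cong)
      fix y :: real
      have be: "\<alpha> = 1 - \<beta>" using ab by simp
      have "w \<le> y \<Longrightarrow> exponential_density 1 w * (exponential_density \<beta> (y + (x - w)) * exponential_density \<alpha> x)
         = exponential_density 1 x * (exponential_density \<beta> y * exponential_density \<alpha> w)"
        using ab by (auto simp: exponential_density_def mult_exp_exp be algebra_simps)
      then have "w \<le> y \<Longrightarrow> ?e w * (?b (y + (x - w)) * ?a x) = ?e x * (?b y * ?a w)"
        using ab by (simp add: ennreal_mult[symmetric] exponential_density_nonneg)
      then show "?e w * (?b (y + (x - w)) * (?a x * (F (w, w + (y + (x - w) - x), x) * indicator {..y + (x - w)} x)))
        = ?e x * (?b y * (?a w * (F (w, y, x) * indicator {..y} w)))"
        by (auto simp: indicator_def mult.assoc[symmetric])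
    qed
    finally show "(\<integral>\<^sup>+y. ?e w * (?b y * (?a x * (F (w, w + (y - x), x) * indicator {..y} x))) \<partial>lborel) = \<dots>" .
  qed
  also have "\<dots> = (\<integral>\<^sup>+x. \<integral>\<^sup>+w. \<integral>\<^sup>+y. ?e x * (?b y * (?a w * (F (w, y, x) * indicator {..y} w))) \<partial>lborel \<partial>lborel \<partial>lborel)"
    by (rule nn_integral_swap12) measurable
  also have "\<dots> = (\<integral>\<^sup>+w. \<integral>\<^sup>+y. \<integral>\<^sup>+x. ?e w * (?b y * (?a x * (F (x, y, w) * indicator {..y} x))) \<partial>lborel \<partial>lborel \<partial>lborel)"
    by (rule nn_integral_cong, rule nn_integral_swap12) measurable
  also have "(\<integral>\<^sup>+w. \<integral>\<^sup>+y. \<integral>\<^sup>+x. ?e w * (?b y * (?a x * (F (x, y, w) * indicator {y<..} x))) \<partial>lborel \<partial>lborel \<partial>lborel) + \<dots>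
     = (\<integral>\<^sup>+w. \<integral>\<^sup>+y. \<integral>\<^sup>+x. ?e w * (?b y * (?a x * (F (x, y, w) * indicator {y<..} x + F (x, y, w) * indicator {..y} x))) \<partial>lborel \<partial>lborel \<partial>lborel)"
    unfolding distrib_left by (rule nn_integral_add3[symmetric]) measurable
  also have "\<dots> = (\<integral>\<^sup>+w. \<integral>\<^sup>+y. \<integral>\<^sup>+x. ?e w * (?b y * (?a x * F (x, y, w))) \<partial>lborel \<partial>lborel \<partial>lborel)"
    by (simp only: split2[symmetric])
  finally show ?thesis using nn_integral_expm3[OF F] by simp
qed

text \<open>One corner flip: \<open>k1\<close> and \<open>k2\<close> hold the increments below and to the left of a cell, \<open>k3\<close> its
  weight.  Keeping the minimum in \<open>k3\<close> makes the flip a measure preserving map of the configuration space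
  to itself, so that flips can be composed.\<close>
definition burke_move :: "'i \<Rightarrow> 'i \<Rightarrow> 'i \<Rightarrow> ('i \<Rightarrow> real) \<Rightarrow> 'i \<Rightarrow> real" where
  "burke_move k1 k2 k3 z = z(k3 := min (z k1) (z k2),
     k2 := z k3 + max 0 (z k2 - z k1), k1 := z k3 + max 0 (z k1 - z k2))"

text \<open>By Fubini the coordinates \<open>k1\<close>, \<open>k2\<close>, \<open>k3\<close> can be
  integrated innermost with all others frozen. On them the move acts as \<open>bmap\<close>, so
  \<open>burke_triple\<close> applies to each section of the event.\<close>

lemma distr_burke_move:
  assumes S: "finite S" "k1 \<in> S" "k2 \<in> S" "k3 \<in> S" "k1 \<noteq> k2" "k1 \<noteq> k3" "k2 \<noteq> k3"
    and ab: "\<alpha> > 0" "\<beta> > 0" "\<alpha> + \<beta> = 1"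
    and r: "\<And>i. r i > 0" "r k1 = \<alpha>" "r k2 = \<beta>" "r k3 = 1"
  defines "P \<equiv> PiM S (\<lambda>i. expm (r i))"
  shows "burke_move k1 k2 k3 \<in> P \<rightarrow>\<^sub>M P" "distr P P (burke_move k1 k2 k3) = P"
proof -
  interpret product_prob_space "\<lambda>i. expm (r i)" S
    by (intro product_prob_spaceI prob_space_exponential_density r)
  define S' where "S' = S - {k1, k2, k3}"
  have S': "S = insert k1 (insert k2 (insert k3 S'))" "finite S'" "k3 \<notin> S'" "k2 \<notin> insert k3 S'"
    "k1 \<notin> insert k2 (insert k3 S')"
    using S by (auto simp: S'_def)
  have sets_P [measurable_cong]: "sets P = sets (PiM S (\<lambda>_. borel))"
    unfolding P_def by (intro sets_PiM_cong) auto
  have space_P: "space P = (\<Pi>\<^sub>E i\<in>S. UNIV)"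
    unfolding P_def by (simp add: space_PiM)
  have m: "burke_move k1 k2 k3 \<in> P \<rightarrow>\<^sub>M P"
  proof -
    have "(\<lambda>z. \<lambda>i\<in>S. if i = k1 then z k3 + max 0 (z k1 - z k2) else
        if i = k2 then z k3 + max 0 (z k2 - z k1) else if i = k3 then min (z k1) (z k2) else z i)
       \<in> PiM S (\<lambda>_. borel) \<rightarrow>\<^sub>M PiM S (\<lambda>_. borel :: real measure)"
      using S by measurable
    moreover have "burke_move k1 k2 k3 z = (\<lambda>i\<in>S. if i = k1 then z k3 + max 0 (z k1 - z k2) else
        if i = k2 then z k3 + max 0 (z k2 - z k1) else if i = k3 then min (z k1) (z k2) else z i)" if "z \<in> space P" for z
    proof
      fix i
      show "burke_move k1 k2 k3 z i = (\<lambda>i\<in>S. if i = k1 then z k3 + max 0 (z k1 - z k2) else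
        if i = k2 then z k3 + max 0 (z k2 - z k1) else if i = k3 then min (z k1) (z k2) else z i) i"
        using that S unfolding space_P by (cases "i \<in> S") (auto simp: burke_move_def PiE_def extensional_def)
    qed
    ultimately show ?thesis
      by (subst measurable_cong_sets[OF sets_P sets_P]) (subst measurable_cong, auto simp: space_P space_PiM)
  qed
  show "burke_move k1 k2 k3 \<in> P \<rightarrow>\<^sub>M P" by (rule m)
  have nn: "(\<integral>\<^sup>+z. f z \<partial>P) = (\<integral>\<^sup>+x. \<integral>\<^sup>+w. \<integral>\<^sup>+y. \<integral>\<^sup>+v. f (x(k3 := w, k2 := y, k1 := v)) \<partial>expm \<alpha> \<partial>expm \<beta> \<partial>expm 1 \<partial>PiM S' (\<lambda>i. expm (r i)))"
    if f [measurable]: "f \<in> borel_measurable P" for f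
  proof -
    have 1: "f \<in> borel_measurable (Pi\<^sub>M (insert k1 (insert k2 (insert k3 S'))) (\<lambda>i. expm (r i)))"
      using f unfolding P_def S'(1) .
    have u1: "(\<lambda>x. \<integral>\<^sup>+ v. f (x(k1 := v)) \<partial>expm (r k1)) \<in> borel_measurable (Pi\<^sub>M (insert k2 (insert k3 S')) (\<lambda>i. expm (r i)))"
      using 1 by measurable
    have u2: "(\<lambda>x. \<integral>\<^sup>+ y. \<integral>\<^sup>+ v. f ((x(k2 := y))(k1 := v)) \<partial>expm (r k1) \<partial>expm (r k2)) \<in> borel_measurable (Pi\<^sub>M (insert k3 S') (\<lambda>i. expm (r i)))"
      using u1 by measurable
    show ?thesis
      unfolding P_def S'(1)
      apply (subst product_nn_integral_insert[OF _ _ 1])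
      using S' apply (simp, simp)
      apply (subst product_nn_integral_insert[OF _ _ u1])
      using S' apply (simp, simp)
      apply (subst product_nn_integral_insert[OF _ _ u2])
      using S' by (simp_all add: r)
  qed
  show "distr P P (burke_move k1 k2 k3) = P"
  proof (rule measure_eqI)
    fix A assume "A \<in> sets (distr P P (burke_move k1 k2 k3))"
    then have A [measurable]: "A \<in> sets P" by simp
    have "emeasure (distr P P (burke_move k1 k2 k3)) A = (\<integral>\<^sup>+z. indicator A z \<partial>distr P P (burke_move k1 k2 k3))"
      using A by simp
    also have "\<dots> = (\<integral>\<^sup>+z. indicator A (burke_move k1 k2 k3 z) \<partial>P)"
      using m by (subst nn_integral_distr) auto
    also have "\<dots> = (\<integral>\<^sup>+x. \<integral>\<^sup>+w. \<integral>\<^sup>+y. \<integral>\<^sup>+v. indicator A (burke_move k1 k2 k3 (x(k3 := w, k2 := y, k1 := v))) \<partial>expm \<alpha> \<partial>expm \<beta> \<partial>expm 1 \<partial>PiM S' (\<lambda>i. expm (r i)))"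
      by (rule nn) (use m in measurable)
    also have "\<dots> = (\<integral>\<^sup>+x. \<integral>\<^sup>+w. \<integral>\<^sup>+y. \<integral>\<^sup>+v. indicator A (x(k3 := w, k2 := y, k1 := v)) \<partial>expm \<alpha> \<partial>expm \<beta> \<partial>expm 1 \<partial>PiM S' (\<lambda>i. expm (r i)))"
    proof (rule nn_integral_cong)
      fix x assume x: "x \<in> space (PiM S' (\<lambda>i. expm (r i)))"
      define F :: "real \<times> real \<times> real \<Rightarrow> ennreal" where "F = (\<lambda>(a, b, c). indicator A (x(k3 := c, k2 := b, k1 := a)))"
      have xm: "(\<lambda>(a, b, c). x(k3 := c, k2 := b, k1 := a)) \<in> (borel \<Otimes>\<^sub>M borel \<Otimes>\<^sub>M borel) \<rightarrow>\<^sub>M PiM S (\<lambda>_. borel :: real measure)"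
      proof -
        have "(\<lambda>(a, b, c). \<lambda>i\<in>S. if i = k1 then a else if i = k2 then b else if i = k3 then c else x i)
          \<in> (borel \<Otimes>\<^sub>M borel \<Otimes>\<^sub>M borel) \<rightarrow>\<^sub>M PiM S (\<lambda>_. borel :: real measure)"
          by measurable
        moreover have "(\<lambda>(a, b, c). \<lambda>i\<in>S. if i = k1 then a else if i = k2 then b else if i = k3 then c else x i)
           = (\<lambda>(a, b, c). x(k3 := c, k2 := b, k1 := a))"
        proof -
          have x0: "x i = undefined" if "i \<notin> S'" for i
            using x that by (auto simp: space_PiM PiE_def extensional_def)
          have "(\<lambda>i\<in>S. if i = k1 then a else if i = k2 then b else if i = k3 then c else x i) i
            = (x(k3 := c, k2 := b, k1 := a)) i" for a b c i
            using S x0[of i] S'_def by (cases "i \<in> S") auto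
          then show ?thesis by (simp add: fun_eq_iff)
        qed
        ultimately show ?thesis by (simp only:)
      qed
      have F: "F \<in> borel_measurable borel"
      proof -
        have "(\<lambda>t. indicator A ((\<lambda>(a, b, c). x(k3 := c, k2 := b, k1 := a)) t) :: ennreal) \<in> borel_measurable (borel \<Otimes>\<^sub>M borel \<Otimes>\<^sub>M borel)"
          by (rule measurable_compose[OF xm borel_measurable_indicator]) (use A sets_P in simp)
        moreover have "F = (\<lambda>t. indicator A ((\<lambda>(a, b, c). x(k3 := c, k2 := b, k1 := a)) t))"
          by (auto simp: F_def fun_eq_iff)
        ultimately show ?thesis by (simp add: borel_prod)
      qed
      have "F (bmap v y w) = indicator A (burke_move k1 k2 k3 (x(k3 := w, k2 := y, k1 := v)))" for v y w
      proof -
        have "burke_move k1 k2 k3 (x(k3 := w, k2 := y, k1 := v)) = x(k3 := min v y, k2 := w + max 0 (y - v), k1 := w + max 0 (v - y))"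
          using S by (auto simp: burke_move_def fun_eq_iff)
        then show ?thesis by (simp add: F_def bmap_def)
      qed
      then show "(\<integral>\<^sup>+w. \<integral>\<^sup>+y. \<integral>\<^sup>+v. indicator A (burke_move k1 k2 k3 (x(k3 := w, k2 := y, k1 := v))) \<partial>expm \<alpha> \<partial>expm \<beta> \<partial>expm 1)
        = (\<integral>\<^sup>+w. \<integral>\<^sup>+y. \<integral>\<^sup>+v. indicator A (x(k3 := w, k2 := y, k1 := v)) \<partial>expm \<alpha> \<partial>expm \<beta> \<partial>expm 1)"
        using burke_triple[OF ab F] by (simp add: F_def)
    qed
    also have "\<dots> = (\<integral>\<^sup>+z. indicator A z \<partial>P)"
      by (rule nn[symmetric]) measurable
    finally show "emeasure (distr P P (burke_move k1 k2 k3)) A = emeasure P A" by simp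
  qed simp
qed

section \<open>Last passage recursions and the stationary rectangle\<close>

fun lp :: "(nat \<Rightarrow> nat \<Rightarrow> real) \<Rightarrow> nat \<Rightarrow> nat \<Rightarrow> real" where
  "lp w 0 k = 0"
| "lp w (Suc m) 0 = 0"
| "lp w (Suc m) (Suc k) = w m k + max (lp w m (Suc k)) (lp w (Suc m) k)"

text \<open>The weights of the stationary model sit at \<open>(i, j)\<close> with \<open>i, j \<ge> 1\<close>, and those on the axes are the
  boundary increments; the weight at \<open>(0, 0)\<close> is not used.\<close>
fun stat_lp :: "(nat \<times> nat \<Rightarrow> real) \<Rightarrow> nat \<Rightarrow> nat \<Rightarrow> real" where
  "stat_lp z 0 0 = 0"
| "stat_lp z (Suc i) 0 = stat_lp z i 0 + z (Suc i, 0)"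
| "stat_lp z 0 (Suc j) = stat_lp z 0 j + z (0, Suc j)"
| "stat_lp z (Suc i) (Suc j) = z (Suc i, Suc j) + max (stat_lp z i (Suc j)) (stat_lp z (Suc i) j)"

text \<open>During a sweep the slot \<open>(Suc i, 0)\<close> holds the horizontal increment from
  column \<open>i\<close> to \<open>Suc i\<close> at the current height. The slot
  \<open>(0, j)\<close> holds the vertical increment of row \<open>j\<close>, which is carried to
  the right by one column with each flip.\<close>

primrec sweep_row :: "nat \<Rightarrow> nat \<Rightarrow> (nat \<times> nat \<Rightarrow> real) \<Rightarrow> nat \<times> nat \<Rightarrow> real" where
  "sweep_row 0 j z = z"
| "sweep_row (Suc i) j z = burke_move (Suc i, 0) (0, j) (Suc i, j) (sweep_row i j z)"

primrec sweep :: "nat \<Rightarrow> nat \<Rightarrow> (nat \<times> nat \<Rightarrow> real) \<Rightarrow> nat \<times> nat \<Rightarrow> real" where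
  "sweep m 0 z = z"
| "sweep m (Suc j) z = sweep_row m (Suc j) (sweep m j z)"

text \<open>After \<open>n\<close> flips the profile is lifted by one row over the first
  \<open>n\<close> columns and unchanged beyond them. The clauses on untouched slots carry the
  induction: the next flip reads an increment at the old height and an original weight.\<close>

lemma sweep_row_increments:
  assumes "\<And>i. i < m \<Longrightarrow> y (Suc i, 0) = stat_lp z (Suc i) j - stat_lp z i j"
    and "y (0, Suc j) = stat_lp z 0 (Suc j) - stat_lp z 0 j"
    and "\<And>i. i < m \<Longrightarrow> y (Suc i, Suc j) = z (Suc i, Suc j)"
    and "n \<le> m"
  shows "(\<forall>i<n. sweep_row n (Suc j) y (Suc i, 0) = stat_lp z (Suc i) (Suc j) - stat_lp z i (Suc j)) \<and>
    (\<forall>i. n \<le> i \<longrightarrow> sweep_row n (Suc j) y (Suc i, 0) = y (Suc i, 0)) \<and>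
    sweep_row n (Suc j) y (0, Suc j) = stat_lp z n (Suc j) - stat_lp z n j \<and>
    (\<forall>p. snd p \<noteq> 0 \<and> snd p \<noteq> Suc j \<longrightarrow> sweep_row n (Suc j) y p = y p) \<and>
    (\<forall>i. n \<le> i \<longrightarrow> sweep_row n (Suc j) y (Suc i, Suc j) = y (Suc i, Suc j))"
  using assms(4)
proof (induction n)
  case 0
  then show ?case using assms by simp
next
  case (Suc n)
  then have IH: "(\<forall>i<n. sweep_row n (Suc j) y (Suc i, 0) = stat_lp z (Suc i) (Suc j) - stat_lp z i (Suc j))"
    "(\<forall>i. n \<le> i \<longrightarrow> sweep_row n (Suc j) y (Suc i, 0) = y (Suc i, 0))"
    "sweep_row n (Suc j) y (0, Suc j) = stat_lp z n (Suc j) - stat_lp z n j"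
    "(\<forall>p. snd p \<noteq> 0 \<and> snd p \<noteq> Suc j \<longrightarrow> sweep_row n (Suc j) y p = y p)"
    "(\<forall>i. n \<le> i \<longrightarrow> sweep_row n (Suc j) y (Suc i, Suc j) = y (Suc i, Suc j))"
    by auto
  have "n < m" using Suc by simp
  then have vals: "sweep_row n (Suc j) y (Suc n, 0) = stat_lp z (Suc n) j - stat_lp z n j"
    "sweep_row n (Suc j) y (Suc n, Suc j) = z (Suc n, Suc j)"
    using IH(2,5) assms(1,3) by auto
  show ?case
    using IH vals by (auto simp: burke_move_def less_Suc_eq max_def)
qed

lemma sweep_increments:
  "(\<forall>i<m. sweep m j z (Suc i, 0) = stat_lp z (Suc i) j - stat_lp z i j) \<and>
   (\<forall>j'<j. sweep m j z (0, Suc j') = stat_lp z m (Suc j') - stat_lp z m j') \<and>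
   (\<forall>p. snd p > j \<longrightarrow> sweep m j z p = z p)"
proof (induction j)
  case 0
  then show ?case by simp
next
  case (Suc j)
  have "(\<forall>i<m. sweep_row m (Suc j) (sweep m j z) (Suc i, 0) = stat_lp z (Suc i) (Suc j) - stat_lp z i (Suc j)) \<and>
    (\<forall>i. m \<le> i \<longrightarrow> sweep_row m (Suc j) (sweep m j z) (Suc i, 0) = sweep m j z (Suc i, 0)) \<and>
    sweep_row m (Suc j) (sweep m j z) (0, Suc j) = stat_lp z m (Suc j) - stat_lp z m j \<and>
    (\<forall>p. snd p \<noteq> 0 \<and> snd p \<noteq> Suc j \<longrightarrow> sweep_row m (Suc j) (sweep m j z) p = sweep m j z p) \<and>
    (\<forall>i. m \<le> i \<longrightarrow> sweep_row m (Suc j) (sweep m j z) (Suc i, Suc j) = sweep m j z (Suc i, Suc j))"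
    by (rule sweep_row_increments[where m = m]) (use Suc in auto)
  moreover have "sweep_row m (Suc j) (sweep m j z) (0, Suc j') = sweep m j z (0, Suc j')" if "j' < j" for j'
    using calculation that by (metis nat.inject nat.simps(3) nat_neq_iff snd_conv)
  ultimately show ?case using Suc by (auto simp: less_Suc_eq)
qed

lemma stat_lp_boundary:
  "stat_lp z m 0 = (\<Sum>i<m. z (Suc i, 0))" "stat_lp z 0 k = (\<Sum>j<k. z (0, Suc j))"
  by (induction m) (auto, induction k, auto)

text \<open>The passage time is read off along the bottom axis and then up the right side. The two
  sums are dependent, but each is a sum of independent exponentials, and a union bound over two
  deviations asks for no more.\<close>

lemma stat_lp_eq_sums:
  "stat_lp z m k = (\<Sum>i<m. z (Suc i, 0)) + (\<Sum>j<k. sweep m k z (0, Suc j))"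
proof -
  have "(\<Sum>j<k. sweep m k z (0, Suc j)) = (\<Sum>j<k. stat_lp z m (Suc j) - stat_lp z m j)"
    using sweep_increments[of m k z] by (intro sum.cong) auto
  also have "\<dots> = stat_lp z m k - stat_lp z m 0"
    by (rule sum_lessThan_telescope)
  finally show ?thesis by (simp add: stat_lp_boundary)
qed

definition stat_rate :: "real \<Rightarrow> nat \<times> nat \<Rightarrow> real" where
  "stat_rate \<alpha> p = (if snd p = 0 then \<alpha> else if fst p = 0 then 1 - \<alpha> else 1)"

definition stat_space :: "real \<Rightarrow> nat \<Rightarrow> nat \<Rightarrow> (nat \<times> nat \<Rightarrow> real) measure" where
  "stat_space \<alpha> m k = PiM ({..m} \<times> {..k}) (\<lambda>p. expm (stat_rate \<alpha> p))"

lemma sweep_preserves: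
  assumes "0 < \<alpha>" "\<alpha> < 1"
  shows "sweep m k \<in> stat_space \<alpha> m k \<rightarrow>\<^sub>M stat_space \<alpha> m k
     \<and> distr (stat_space \<alpha> m k) (stat_space \<alpha> m k) (sweep m k) = stat_space \<alpha> m k"
proof -
  let ?P = "stat_space \<alpha> m k"
  define pres where "pres f \<longleftrightarrow> f \<in> ?P \<rightarrow>\<^sub>M ?P \<and> distr ?P ?P f = ?P" for f
  have comp: "pres (\<lambda>z. f (g z))" if "pres f" "pres g" for f g
    using that distr_distr[of f ?P ?P g ?P] unfolding pres_def by (auto simp: comp_def)
  have move: "pres (burke_move (Suc i, 0) (0, Suc j) (Suc i, Suc j))" if "i < m" "j < k" for i j
    unfolding pres_def stat_space_def
    by (rule conjI; rule distr_burke_move[where \<alpha> = \<alpha> and \<beta> = "1 - \<alpha>"])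
      (use assms that in \<open>auto simp: stat_rate_def\<close>)
  have row: "pres (sweep_row i (Suc j))" if "i \<le> m" "j < k" for i j
    using that(1)
  proof (induction i)
    case 0
    then show ?case by (simp add: pres_def)
  next
    case (Suc i)
    then show ?case using comp[OF move[of i j], of "sweep_row i (Suc j)"] that by simp
  qed
  have "pres (sweep m j)" if "j \<le> k" for j
    using that
  proof (induction j)
    case 0
    then show ?case by (simp add: pres_def)
  next
    case (Suc j)
    then show ?case using comp[OF row[of m j], of "sweep m j"] by simp
  qed
  then show ?thesis by (simp add: pres_def)
qed

section \<open>Exponential moments and Chernoff bounds\<close>

lemma nn_integral_exp_expm:
  assumes "t < r" "0 < r"
  shows "(\<integral>\<^sup>+x. ennreal (exp (t * x)) \<partial>expm r) = ennreal (r / (r - t))"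
proof -
  interpret prob_space "expm (r - t)" by (rule prob_space_exponential_density) (use assms in simp)
  have "(\<integral>\<^sup>+x. ennreal (exp (t * x)) \<partial>expm r)
    = (\<integral>\<^sup>+x. ennreal (exponential_density r x) * ennreal (exp (t * x)) \<partial>lborel)"
    by (rule nn_integral_expm) measurable
  \<comment> \<open>Exponential tilting: the tilted density is \<open>r / (r - t)\<close> times the
    density of rate \<open>r - t\<close>, which has mass one.\<close>
  also have "\<dots> = (\<integral>\<^sup>+x. ennreal (r / (r - t)) * (ennreal (exponential_density (r - t) x) * 1) \<partial>lborel)"
  proof (intro nn_integral_cong)
    fix x
    have "exponential_density r x * exp (t * x) = r / (r - t) * exponential_density (r - t) x"
    proof -
      have "r * exp (- x * r) * exp (t * x) = r * exp (- x * (r - t))"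
        by (simp add: mult_exp_exp algebra_simps)
      also have "\<dots> = r / (r - t) * ((r - t) * exp (- x * (r - t)))" using assms by simp
      finally show ?thesis by (simp add: exponential_density_def)
    qed
    then show "ennreal (exponential_density r x) * ennreal (exp (t * x)) = ennreal (r / (r - t)) * (ennreal (exponential_density (r - t) x) * 1)"
      using assms by (simp add: ennreal_mult[symmetric] exponential_density_nonneg)
  qed
  also have "\<dots> = ennreal (r / (r - t)) * (\<integral>\<^sup>+x. 1 \<partial>expm (r - t))"
    by (subst nn_integral_expm) (auto simp: nn_integral_cmult)
  also have "\<dots> = ennreal (r / (r - t))"
    using emeasure_space_1 by simp
  finally show ?thesis .
qed

lemma neg_ln_one_minus_le:
  fixes y :: real
  assumes "\<bar>y\<bar> \<le> 1 / 2"
  shows "- ln (1 - y) \<le> y + 2 * y\<^sup>2"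
proof (cases "y \<ge> 0")
  case True
  then show ?thesis using ln_one_minus_pos_lower_bound[of y] assms by simp
next
  case False
  then have "- y - y\<^sup>2 \<le> ln (1 - y)" using ln_one_plus_pos_lower_bound[of "-y"] assms by simp
  then show ?thesis using zero_le_power2[of y] by linarith
qed

text \<open>The factor \<open>\<rho>\<close> normalises the summands to mean one, so the bound is
  free of the rate. Since \<open>y\<close> may have either sign, both tails are covered. Coordinates
  outside \<open>F\<close> integrate to one.\<close>

lemma nn_integral_exp_sum_le:
  fixes S :: "'i set" and y :: real
  assumes S: "finite S" "F \<subseteq> S" and r: "\<And>i. r i > 0" "\<And>i. i \<in> F \<Longrightarrow> r i = \<rho>" "\<rho> > 0"
    and y: "\<bar>y\<bar> \<le> 1 / 2"
  shows "(\<integral>\<^sup>+z. ennreal (exp (y * (\<rho> * (\<Sum>i\<in>F. z i) - real (card F)))) \<partial>PiM S (\<lambda>i. expm (r i))) \<le> ennreal (exp (card F * (2 * y\<^sup>2)))"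
proof -
  interpret product_prob_space "\<lambda>i. expm (r i)" S
    by (intro product_prob_spaceI prob_space_exponential_density r)
  have F: "finite F" using S finite_subset by auto
  define h where "h i x = (if i \<in> F then ennreal (exp (y * \<rho> * x)) * ennreal (exp (- y)) else 1)" for i :: 'i and x :: real
  have eq: "ennreal (exp (y * (\<rho> * (\<Sum>i\<in>F. z i) - real (card F)))) = (\<Prod>i\<in>S. h i (z i))" for z
  proof -
    have "(\<Prod>i\<in>S. h i (z i)) = (\<Prod>i\<in>F. h i (z i))"
      using S F by (intro prod.mono_neutral_right) (auto simp: h_def)
    also have "\<dots> = (\<Prod>i\<in>F. ennreal (exp (y * (\<rho> * z i - 1))))"
      by (intro prod.cong) (auto simp: h_def ennreal_mult[symmetric] mult_exp_exp algebra_simps)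
    also have "\<dots> = ennreal (exp (\<Sum>i\<in>F. y * (\<rho> * z i - 1)))"
      by (simp add: prod_ennreal exp_sum F)
    also have "(\<Sum>i\<in>F. y * (\<rho> * z i - 1)) = y * (\<rho> * (\<Sum>i\<in>F. z i) - real (card F))"
      by (simp add: sum_distrib_left[symmetric] sum_subtractf)
    finally show ?thesis by simp
  qed
  have yr: "y * \<rho> < \<rho>" using y r by (auto simp: abs_le_iff)
  have "(\<integral>\<^sup>+z. (\<Prod>i\<in>S. h i (z i)) \<partial>PiM S (\<lambda>i. expm (r i))) = (\<Prod>i\<in>S. \<integral>\<^sup>+x. h i x \<partial>expm (r i))"
    using S by (intro product_nn_integral_prod) (auto simp: h_def)
  also have "\<dots> = (\<Prod>i\<in>F. \<integral>\<^sup>+x. h i x \<partial>expm (r i))"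
    using S F prob_space_exponential_density[OF r(1), THEN prob_space.emeasure_space_1]
    by (intro prod.mono_neutral_right) (auto simp: h_def)
  also have "\<dots> = (\<Prod>i\<in>F. ennreal (exp (- ln (1 - y) - y)))"
  proof (intro prod.cong refl)
    fix i assume i: "i \<in> F"
    have "(\<integral>\<^sup>+x. h i x \<partial>expm (r i)) = (\<integral>\<^sup>+x. ennreal (exp (y * \<rho> * x)) \<partial>expm \<rho>) * ennreal (exp (- y))"
      using i r by (simp add: h_def nn_integral_multc)
    also have "\<dots> = ennreal (\<rho> / (\<rho> - y * \<rho>)) * ennreal (exp (- y))"
      by (subst nn_integral_exp_expm) (use r yr in auto)
    also have "\<rho> / (\<rho> - y * \<rho>) = 1 / (1 - y)"
      using r yr by (simp add: field_simps)
    also have "\<dots> = exp (- ln (1 - y))"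
      using y by (simp add: exp_minus exp_ln abs_le_iff inverse_eq_divide)
    finally show "(\<integral>\<^sup>+x. h i x \<partial>expm (r i)) = ennreal (exp (- ln (1 - y) - y))"
      by (simp add: ennreal_mult[symmetric] mult_exp_exp)
  qed
  also have "\<dots> = ennreal (exp (card F * (- ln (1 - y) - y)))"
    by (simp add: ennreal_power exp_of_nat_mult[symmetric])
  also have "\<dots> \<le> ennreal (exp (card F * (2 * y\<^sup>2)))"
    using neg_ln_one_minus_le[OF y] by (intro ennreal_leI) (auto intro!: mult_left_mono)
  finally show ?thesis by (simp add: eq)
qed

text \<open>The point is uniformity: \<open>\<kappa>\<close> depends on \<open>K\<close>,
  \<open>r0\<close> and \<open>\<epsilon>\<close> only. Later there is a union over exit points and
  rectangles, and the rate changes with the shape of the rectangle.\<close>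

lemma exponential_sum_concentration:
  fixes K r0 \<epsilon> :: real
  assumes "K > 0" "r0 > 0" "\<epsilon> > 0"
  obtains \<kappa> where "\<kappa> > 0"
    "\<And>(S :: (nat \<times> nat) set) F r \<rho> n. finite S \<Longrightarrow> F \<subseteq> S \<Longrightarrow> (\<And>i. r i > 0) \<Longrightarrow> (\<And>i. i \<in> F \<Longrightarrow> r i = \<rho>)
      \<Longrightarrow> r0 \<le> \<rho> \<Longrightarrow> real (card F) \<le> K * real n \<Longrightarrow>
      measure (PiM S (\<lambda>i. expm (r i))) {z\<in>space (PiM S (\<lambda>i. expm (r i))). (\<Sum>i\<in>F. z i) \<ge> card F / \<rho> + \<epsilon> * n} \<le> exp (- \<kappa> * n)
    \<and> measure (PiM S (\<lambda>i. expm (r i))) {z\<in>space (PiM S (\<lambda>i. expm (r i))). (\<Sum>i\<in>F. z i) \<le> card F / \<rho> - \<epsilon> * n} \<le> exp (- \<kappa> * n)"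
proof -
  \<comment> \<open>The Chernoff parameter. The cap \<open>1/2\<close> is the range of the logarithm
    bound; the other term makes the quadratic cost \<open>2 * K * x^2\<close> at most half of the
    linear gain \<open>r0 * \<epsilon> * x\<close>.\<close>
  define x where "x = min (1/2) (r0 * \<epsilon> / (4 * K))"
  have x: "0 < x" "x \<le> 1/2" "2 * K * x \<le> r0 * \<epsilon> / 2"
    using assms by (auto simp: x_def min_def field_simps)
  \<comment> \<open>The choice \<open>y = x\<close> will give the upper tail and
    \<open>y = - x\<close> the lower one.\<close>
  have main: "measure (PiM S (\<lambda>i. expm (r i))) {z\<in>space (PiM S (\<lambda>i. expm (r i))). y * ((\<Sum>i\<in>F. z i) - card F / \<rho>) \<ge> x * (\<epsilon> * n)} \<le> exp (- (x * r0 * \<epsilon> / 2) * n)"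
    if h: "finite S" "F \<subseteq> S" "\<And>i. r i > 0" "\<And>i. i \<in> F \<Longrightarrow> r i = \<rho>" "r0 \<le> \<rho>" "real (card F) \<le> K * real n" "\<bar>y\<bar> = x"
    for S :: "(nat \<times> nat) set" and F r \<rho> n y
  proof -
    let ?P = "PiM S (\<lambda>i. expm (r i))"
    let ?A = "{z\<in>space ?P. y * ((\<Sum>i\<in>F. z i) - card F / \<rho>) \<ge> x * (\<epsilon> * n)}"
    interpret P: prob_space ?P by (intro prob_space_PiM prob_space_exponential_density h)
    have rho: "\<rho> > 0" using assms h by linarith
    have [measurable]: "(\<lambda>z. \<Sum>i\<in>F. z i) \<in> borel_measurable ?P"
      using h(2) by (intro borel_measurable_sum) auto
    have A: "?A \<in> sets ?P" by measurable
    let ?c = "exp (- (x * \<rho> * \<epsilon> * n))"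
    have "emeasure ?P ?A = (\<integral>\<^sup>+z. indicator ?A z \<partial>?P)" using A by simp
    also have "\<dots> \<le> (\<integral>\<^sup>+z. ennreal ?c * ennreal (exp (y * (\<rho> * (\<Sum>i\<in>F. z i) - real (card F)))) \<partial>?P)"
    proof (intro nn_integral_mono)
      fix z assume "z \<in> space ?P"
      have "1 \<le> exp (- (x * \<rho> * \<epsilon> * n)) * exp (y * (\<rho> * (\<Sum>i\<in>F. z i) - real (card F)))" if "z \<in> ?A"
      proof -
        have "\<rho> * (x * (\<epsilon> * n)) \<le> \<rho> * (y * ((\<Sum>i\<in>F. z i) - card F / \<rho>))"
          using that rho by (intro mult_left_mono) auto
        also have "\<dots> = y * (\<rho> * (\<Sum>i\<in>F. z i) - card F)"
          using rho by (simp add: field_simps)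
        finally show ?thesis by (simp add: mult_exp_exp algebra_simps)
      qed
      then show "indicator ?A z \<le> ennreal ?c * ennreal (exp (y * (\<rho> * (\<Sum>i\<in>F. z i) - real (card F))))"
        by (auto simp: indicator_def ennreal_mult[symmetric])
    qed
    also have "\<dots> = ennreal ?c * (\<integral>\<^sup>+z. ennreal (exp (y * (\<rho> * (\<Sum>i\<in>F. z i) - real (card F)))) \<partial>?P)"
      by (rule nn_integral_cmult) measurable
    also have "\<dots> \<le> ennreal ?c * ennreal (exp (card F * (2 * y\<^sup>2)))"
      by (intro mult_left_mono nn_integral_exp_sum_le) (use h rho x in auto)
    also have "\<dots> = ennreal (exp (card F * (2 * x\<^sup>2) - x * \<rho> * \<epsilon> * n))"
      using h(7) by (simp add: ennreal_mult[symmetric] mult_exp_exp) (metis power2_abs)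
    also have "\<dots> \<le> ennreal (exp (- (x * r0 * \<epsilon> / 2) * n))"
    proof (intro ennreal_leI, simp)
      have "card F * (2 * x\<^sup>2) \<le> K * n * (2 * x\<^sup>2)" using h(6) by (intro mult_right_mono) auto
      also have "\<dots> = (2 * K * x) * (x * n)" by (simp add: power2_eq_square)
      also have "\<dots> \<le> r0 * \<epsilon> / 2 * (x * n)" using x by (intro mult_right_mono) auto
      finally have "card F * (2 * x\<^sup>2) \<le> r0 * \<epsilon> / 2 * (x * n)" .
      moreover have "r0 * (x * \<epsilon> * n) \<le> \<rho> * (x * \<epsilon> * n)"
        using h(5) x assms by (intro mult_right_mono) auto
      ultimately show "card F * (2 * x\<^sup>2) - x * \<rho> * \<epsilon> * n \<le> - (x * r0 * \<epsilon> * n / 2)"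
        by (simp add: algebra_simps)
    qed
    finally show ?thesis by (simp add: P.emeasure_eq_measure)
  qed
  show ?thesis
  proof (rule that[of "x * r0 * \<epsilon> / 2"])
    show "x * r0 * \<epsilon> / 2 > 0" using x assms by simp
  next
    fix S :: "(nat \<times> nat) set" and F r \<rho> n
    assume h: "finite S" "F \<subseteq> S" "\<And>i. r i > 0" "\<And>i. i \<in> F \<Longrightarrow> r i = \<rho>" "r0 \<le> \<rho>" "real (card F) \<le> K * real n"
    have "x * (\<epsilon> * n) \<le> x * (s - card F / \<rho>) \<longleftrightarrow> s \<ge> card F / \<rho> + \<epsilon> * n"
      "x * (\<epsilon> * n) \<le> (- x) * (s - card F / \<rho>) \<longleftrightarrow> s \<le> card F / \<rho> - \<epsilon> * n" for s
      using x(1) mult_le_cancel_left_pos[of x "\<epsilon> * n" "s - card F / \<rho>"] mult_le_cancel_left_pos[of x "\<epsilon> * n" "card F / \<rho> - s"]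
      by (auto simp: algebra_simps)
    then show "measure (PiM S (\<lambda>i. expm (r i))) {z\<in>space (PiM S (\<lambda>i. expm (r i))). (\<Sum>i\<in>F. z i) \<ge> card F / \<rho> + \<epsilon> * n} \<le> exp (- (x * r0 * \<epsilon> / 2) * n)
    \<and> measure (PiM S (\<lambda>i. expm (r i))) {z\<in>space (PiM S (\<lambda>i. expm (r i))). (\<Sum>i\<in>F. z i) \<le> card F / \<rho> - \<epsilon> * n} \<le> exp (- (x * r0 * \<epsilon> / 2) * n)"
      using main[OF h, where y = x] main[OF h, where y = "- x"] x by simp
  qed
qed

section \<open>The shape function and deterministic last passage estimates\<close>

text \<open>The limit shape of mean one exponential last passage in a rectangle with sides
  \<open>a\<close> and \<open>b\<close>; it is \<open>gamma\<close> in the coordinates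
  \<open>a = x + y\<close>, \<open>b = y\<close>.\<close>

definition gm :: "real \<Rightarrow> real \<Rightarrow> real" where
  "gm a b = (sqrt a + sqrt b)\<^sup>2"

lemma gm_expand: "a \<ge> 0 \<Longrightarrow> b \<ge> 0 \<Longrightarrow> gm a b = a + b + 2 * sqrt (a * b)"
  by (simp add: gm_def power2_sum real_sqrt_mult)

lemma gm_nonneg [simp]: "0 \<le> gm a b"
  by (simp add: gm_def)

lemma gm_commute: "gm a b = gm b a"
  by (simp add: gm_def add.commute)

lemma gm_scale: "c \<ge> 0 \<Longrightarrow> gm (c * a) (c * b) = c * gm a b"
  by (simp add: gm_def real_sqrt_mult distrib_left[symmetric] power_mult_distrib)

lemma gm_mono: "0 \<le> a \<Longrightarrow> 0 \<le> b \<Longrightarrow> a \<le> a' \<Longrightarrow> b \<le> b' \<Longrightarrow> gm a b \<le> gm a' b'"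
  unfolding gm_def by (intro power_mono add_mono) auto

lemma gm_le: "0 \<le> a \<Longrightarrow> 0 \<le> b \<Longrightarrow> gm a b \<le> 2 * (a + b)"
  using sum_squares_bound[of "sqrt a" "sqrt b"] by (simp add: gm_def power2_sum)

text \<open>After expansion this is the Cauchy-Schwarz inequality for the square roots. It is the
  reason why merging consecutive increments of a chain never lowers its value at constant
  speed.\<close>

lemma gm_superadd:
  assumes "0 \<le> a" "0 \<le> b" "0 \<le> a'" "0 \<le> b'"
  shows "gm a b + gm a' b' \<le> gm (a + a') (b + b')"
proof -
  have "(sqrt (a * b) + sqrt (a' * b'))\<^sup>2 \<le> (a + a') * (b + b')"
  proof -
    have "2 * sqrt (a * b) * sqrt (a' * b') = 2 * (sqrt (a * b') * sqrt (a' * b))"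
      by (simp add: real_sqrt_mult)
    also have "\<dots> \<le> (sqrt (a * b'))\<^sup>2 + (sqrt (a' * b))\<^sup>2"
      using sum_squares_bound[of "sqrt (a * b')" "sqrt (a' * b)"] by simp
    also have "\<dots> = a * b' + a' * b" using assms by simp
    finally show ?thesis using assms by (simp add: power2_sum algebra_simps)
  qed
  then have "sqrt (a * b) + sqrt (a' * b') \<le> sqrt ((a + a') * (b + b'))"
    by (rule real_le_rsqrt)
  then show ?thesis using assms by (simp add: gm_expand)
qed

text \<open>Near the axes \<open>gm\<close> is only Hoelder continuous of order one half, whence the
  square root.\<close>

lemma gm_add_le:
  assumes "0 \<le> a" "0 \<le> b" "0 \<le> h"
  shows "gm (a + h) (b + h) \<le> gm a b + 2 * h + 2 * sqrt (h * (a + b + h))"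
proof -
  have "(a + h) * (b + h) = a * b + h * (a + b + h)" by (simp add: algebra_simps)
  then have "sqrt ((a + h) * (b + h)) \<le> sqrt (a * b) + sqrt (h * (a + b + h))"
    using assms by (simp add: sqrt_add_le_add_sqrt)
  then show ?thesis using assms by (simp add: gm_expand)
qed

text \<open>The right-hand side is the mean passage time of the stationary model with parameter
  \<open>\<alpha>\<close>. The inequality is the arithmetic-geometric one with relative weight
  \<open>(1 - \<alpha>) / \<alpha>\<close>.\<close>

lemma gm_tangent:
  assumes "0 \<le> a" "0 \<le> b" "0 < \<alpha>" "\<alpha> < 1"
  shows "gm a b \<le> a / \<alpha> + b / (1 - \<alpha>)"
proof -
  define r where "r = (1 - \<alpha>) / \<alpha>"
  have r: "r > 0" using assms by (simp add: r_def)
  have "2 * sqrt (a * b) = 2 * sqrt (a * r) * sqrt (b / r)"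
    using r by (simp add: real_sqrt_mult real_sqrt_divide)
  also have "\<dots> \<le> (sqrt (a * r))\<^sup>2 + (sqrt (b / r))\<^sup>2" by (rule sum_squares_bound)
  also have "\<dots> = a * r + b / r" using assms r by simp
  finally have "gm a b \<le> a * (1 + r) + b * (1 + 1 / r)"
    using assms by (simp add: gm_expand algebra_simps)
  also have "1 + r = 1 / \<alpha>" using assms by (simp add: r_def field_simps)
  also have "1 + 1 / r = 1 / (1 - \<alpha>)" using assms by (simp add: r_def field_simps)
  finally show ?thesis by simp
qed

text \<open>This is the characteristic rate, at which the tangent bound is sharp. Its reciprocals
  depend on the ratio of the sides alone, so they stay bounded for bounded aspect ratio.\<close>

lemma gm_eq_tangent:
  assumes "0 < a" "0 < b"
  defines "\<alpha> \<equiv> sqrt a / (sqrt a + sqrt b)"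
  shows "0 < \<alpha>" "\<alpha> < 1" "1 / \<alpha> = 1 + sqrt (b / a)" "1 / (1 - \<alpha>) = 1 + sqrt (a / b)"
    "gm a b = a / \<alpha> + b / (1 - \<alpha>)"
proof -
  have p: "sqrt a > 0" "sqrt b > 0" using assms by auto
  have q: "sqrt a + sqrt b > 0" using p by linarith
  show "0 < \<alpha>" unfolding \<alpha>_def by (intro divide_pos_pos p q)
  show "\<alpha> < 1" unfolding \<alpha>_def divide_less_eq_1_pos[OF q] using p by linarith
  have ia: "1 / \<alpha> = (sqrt a + sqrt b) / sqrt a" by (simp add: \<alpha>_def)
  have b': "1 - \<alpha> = sqrt b / (sqrt a + sqrt b)" 
  proof -
    have "1 - \<alpha> = (sqrt a + sqrt b) / (sqrt a + sqrt b) - sqrt a / (sqrt a + sqrt b)"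
      using q by (simp add: \<alpha>_def)
    then show ?thesis unfolding diff_divide_distrib[symmetric] by simp
  qed
  have ib: "1 / (1 - \<alpha>) = (sqrt a + sqrt b) / sqrt b" by (simp add: b')
  show "1 / \<alpha> = 1 + sqrt (b / a)" using p by (simp add: ia real_sqrt_divide field_simps)
  show "1 / (1 - \<alpha>) = 1 + sqrt (a / b)" using p by (simp add: ib real_sqrt_divide field_simps)
  have cancel: "x * x * (y / x) = x * y" if "x > 0" for x y :: real using that by simp
  have "a / \<alpha> = (sqrt a * sqrt a) * (1 / \<alpha>)" using assms by simp
  also have "\<dots> = sqrt a * (sqrt a + sqrt b)" unfolding ia by (rule cancel[OF p(1)])
  finally have 1: "a / \<alpha> = sqrt a * (sqrt a + sqrt b)" .
  have "b / (1 - \<alpha>) = (sqrt b * sqrt b) * (1 / (1 - \<alpha>))" using assms by simp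
  also have "\<dots> = sqrt b * (sqrt a + sqrt b)" unfolding ib by (rule cancel[OF p(2)])
  finally have 2: "b / (1 - \<alpha>) = sqrt b * (sqrt a + sqrt b)" .
  show "gm a b = a / \<alpha> + b / (1 - \<alpha>)"
    unfolding 1 2 gm_def power2_eq_square by (simp only: distrib_right)
qed

lemma lp_cong: "(\<And>i j. i < m \<Longrightarrow> j < k \<Longrightarrow> w i j = w' i j) \<Longrightarrow> lp w m k = lp w' m k"
  by (induction w m k rule: lp.induct) auto

lemma lp_nonneg: "(\<And>i j. i < m \<Longrightarrow> j < k \<Longrightarrow> 0 \<le> w i j) \<Longrightarrow> 0 \<le> lp w m k"
  by (induction w m k rule: lp.induct) (auto intro!: add_nonneg_nonneg simp: le_max_iff_disj)

lemma lp_scale: "0 \<le> c \<Longrightarrow> lp (\<lambda>i j. c * w i j) m k = c * lp w m k"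
proof (induction "\<lambda>i j. c * w i j" m k rule: lp.induct)
  case (3 m k)
  then show ?case by (simp add: max_mult_distrib_left distrib_left)
qed auto

lemma lp_measurable:
  "(\<And>i j. i < m \<Longrightarrow> j < k \<Longrightarrow> (\<lambda>x. W x i j) \<in> borel_measurable N) \<Longrightarrow> (\<lambda>x. lp (W x) m k) \<in> borel_measurable N"
proof (induction m arbitrary: k)
  case (Suc m)
  note IHm = Suc.IH and prem = Suc.prems
  show ?case
    using prem
  proof (induction k)
    case (Suc k)
    have "(\<lambda>x. lp (W x) m (Suc k)) \<in> borel_measurable N" using IHm Suc.prems by simp
    moreover have "(\<lambda>x. lp (W x) (Suc m) k) \<in> borel_measurable N" using Suc by simp
    moreover have "(\<lambda>x. W x m k) \<in> borel_measurable N" using Suc.prems by simp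
    ultimately show ?case by simp
  qed simp
qed simp

lemma lp_step_le:
  assumes "\<And>i j. i < m \<Longrightarrow> j < k \<Longrightarrow> 0 \<le> w i j"
  shows "\<lbrakk>m' \<le> m; k' \<le> k; m'' \<le> m'; k'' \<le> k'\<rbrakk> \<Longrightarrow> lp w m'' k'' \<le> lp w m' k'"
proof (induction "m' + k'" arbitrary: m' k' rule: less_induct)
  case less
  show ?case
  proof (cases "m'' = m' \<and> k'' = k'")
    case False
    show ?thesis
    proof (cases "m'' = 0 \<or> k'' = 0")
      case True
      then have "lp w m'' k'' = 0" by (cases m''; cases k'') auto
      then show ?thesis using lp_nonneg[of m' k' w] assms less.prems by auto
    next
      case pos: False
      then obtain a b where ab: "m' = Suc a" "k' = Suc b" using less.prems by (cases m'; cases k') auto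
      have w: "0 \<le> w a b" using assms less.prems ab by auto
      show ?thesis
      proof (cases "m'' = m'")
        case True
        then have "lp w m'' k'' \<le> lp w (Suc a) b"
          using less.hyps[of "Suc a" b] less.prems False ab by auto
        then show ?thesis using w ab by auto
      next
        case False
        then have "lp w m'' k'' \<le> lp w a (Suc b)"
          using less.hyps[of a "Suc b"] less.prems False ab by auto
        then show ?thesis using w ab by auto
      qed
    qed
  qed simp
qed

lemma lp_shift_le:
  assumes "\<And>i j. i < m \<Longrightarrow> j < k \<Longrightarrow> 0 \<le> w i j" "s + m' \<le> m" "t + k' \<le> k"
  shows "lp (\<lambda>i j. w (i + s) (j + t)) m' k' \<le> lp w (m' + s) (k' + t)"
  using assms(2,3)
proof (induction "m' + k'" arbitrary: m' k' rule: less_induct)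
  case less
  show ?case
  proof (cases "m' = 0 \<or> k' = 0")
    case True
    then have "lp (\<lambda>i j. w (i + s) (j + t)) m' k' = 0" by (cases m'; cases k') auto
    then show ?thesis using lp_nonneg[of "m' + s" "k' + t" w] assms(1) less.prems by auto
  next
    case False
    then obtain a b where ab: "m' = Suc a" "k' = Suc b" by (cases m'; cases k') auto
    have "lp (\<lambda>i j. w (i + s) (j + t)) a (Suc b) \<le> lp w (a + s) (Suc b + t)"
      "lp (\<lambda>i j. w (i + s) (j + t)) (Suc a) b \<le> lp w (Suc a + s) (b + t)"
      using less.hyps[of a "Suc b"] less.hyps[of "Suc a" b] less.prems ab by auto
    then show ?thesis unfolding ab by (auto intro: add_mono max.mono)
  qed
qed

lemma stat_lp_nonneg:
  "(\<And>p. p \<in> {..m} \<times> {..k} \<Longrightarrow> 0 \<le> z p) \<Longrightarrow> 0 \<le> stat_lp z m k"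
  by (induction z m k rule: stat_lp.induct) (auto intro!: add_nonneg_nonneg simp: le_max_iff_disj)

lemma lp_le_stat_lp:
  "(\<And>p. p \<in> {..m} \<times> {..k} \<Longrightarrow> 0 \<le> z p) \<Longrightarrow> lp (\<lambda>i j. z (Suc i, Suc j)) m k \<le> stat_lp z m k"
proof (induction z m k rule: stat_lp.induct)
  case (2 z i)
  then show ?case using stat_lp_nonneg[of "Suc i" 0 z] by auto
next
  case (3 z j)
  then show ?case using stat_lp_nonneg[of 0 "Suc j" z] by auto
next
  case (4 z i j)
  then show ?case by (auto intro!: add_mono max.mono)
qed simp

lemma lp_Suc_ge:
  "w m k + lp w m (Suc k) \<le> lp w (Suc m) (Suc k)" "w m k + lp w (Suc m) k \<le> lp w (Suc m) (Suc k)"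
  by simp_all

text \<open>A maximal path follows one axis for a while and then stays in the bulk. On the
  horizontal axis it collects the columns \<open>1\<close> to \<open>s + 1\<close> and turns up in
  the last of them, so the bulk rectangle starts in column \<open>s + 1\<close> too. The induction
  removes the last cell of the path, which belongs to the bulk rectangle.\<close>

lemma stat_lp_exit:
  "(\<exists>s\<le>i. stat_lp z (Suc i) (Suc j) \<le> (\<Sum>a<Suc s. z (Suc a, 0)) + lp (\<lambda>a b. z (Suc (a + s), Suc b)) (Suc i - s) (Suc j)) \<or>
   (\<exists>t\<le>j. stat_lp z (Suc i) (Suc j) \<le> (\<Sum>b<Suc t. z (0, Suc b)) + lp (\<lambda>a b. z (Suc a, Suc (b + t))) (Suc i) (Suc j - t))"
  (is "?I i j \<or> ?J i j")
proof (induction "i + j" arbitrary: i j rule: less_induct)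
  case less
  consider (l) "stat_lp z (Suc i) (Suc j) = z (Suc i, Suc j) + stat_lp z i (Suc j)"
    | (r) "stat_lp z (Suc i) (Suc j) = z (Suc i, Suc j) + stat_lp z (Suc i) j"
    by (metis max_def stat_lp.simps(4))
  then show ?case
  proof cases
    case l
    show ?thesis
    proof (cases i)
      case 0
      have "stat_lp z (Suc i) (Suc j) = z (Suc i, Suc j) + (\<Sum>b<Suc j. z (0, Suc b))"
        unfolding l unfolding 0 stat_lp_boundary ..
      \<comment> \<open>The left neighbour of the cell lies on the vertical axis, so the path leaves
        that axis at height \<open>Suc j\<close>, which is the exit index
        \<open>t = j\<close>.\<close>
      then have "?J i j"
        by (intro exI[of _ j]) (simp add: 0 del: stat_lp.simps)
      then show ?thesis ..
    next
      case (Suc i')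
      have "?I i' j \<or> ?J i' j" using less Suc by simp
      then show ?thesis
      proof
        assume "?I i' j"
        then obtain s where s: "s \<le> i'" "stat_lp z i (Suc j) \<le> (\<Sum>a<Suc s. z (Suc a, 0)) + lp (\<lambda>a b. z (Suc (a + s), Suc b)) (Suc i' - s) (Suc j)"
          using Suc by auto
        have e: "Suc i - s = Suc (Suc i' - s)" using s Suc by simp
        have "?I i j"
        proof (intro exI conjI)
          show "s \<le> i" using s Suc by simp
          show "stat_lp z (Suc i) (Suc j) \<le> (\<Sum>a<Suc s. z (Suc a, 0)) + lp (\<lambda>a b. z (Suc (a + s), Suc b)) (Suc i - s) (Suc j)"
            using s Suc lp_Suc_ge(1)[of "\<lambda>a b. z (Suc (a + s), Suc b)" "Suc i' - s" j]
            unfolding l e by (simp del: lp.simps stat_lp.simps sum.lessThan_Suc)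
        qed
        then show ?thesis ..
      next
        assume "?J i' j"
        then obtain t where t: "t \<le> j" "stat_lp z i (Suc j) \<le> (\<Sum>b<Suc t. z (0, Suc b)) + lp (\<lambda>a b. z (Suc a, Suc (b + t))) (Suc i') (Suc j - t)"
          using Suc by auto
        have e: "Suc j - t = Suc (j - t)" using t by simp
        have "?J i j"
        proof (intro exI conjI)
          show "t \<le> j" using t Suc by simp
          show "stat_lp z (Suc i) (Suc j) \<le> (\<Sum>b<Suc t. z (0, Suc b)) + lp (\<lambda>a b. z (Suc a, Suc (b + t))) (Suc i) (Suc j - t)"
            using t Suc lp_Suc_ge(1)[of "\<lambda>a b. z (Suc a, Suc (b + t))" i "j - t"]
            unfolding l e by (simp del: lp.simps stat_lp.simps sum.lessThan_Suc)
        qed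
        then show ?thesis ..
      qed
    qed
  next
    case r
    show ?thesis
    proof (cases j)
      case 0
      have "stat_lp z (Suc i) (Suc j) = z (Suc i, Suc j) + (\<Sum>a<Suc i. z (Suc a, 0))"
        unfolding r unfolding 0 stat_lp_boundary ..
      then have "?I i j"
        by (intro exI[of _ i]) (simp add: 0 del: stat_lp.simps)
      then show ?thesis ..
    next
      case (Suc j')
      have "?I i j' \<or> ?J i j'" using less Suc by simp
      then show ?thesis
      proof
        assume "?I i j'"
        then obtain s where s: "s \<le> i" "stat_lp z (Suc i) j \<le> (\<Sum>a<Suc s. z (Suc a, 0)) + lp (\<lambda>a b. z (Suc (a + s), Suc b)) (Suc i - s) (Suc j')"
          using Suc by auto
        have e: "Suc i - s = Suc (i - s)" using s by simp
        have "?I i j"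
        proof (intro exI conjI)
          show "s \<le> i" using s Suc by simp
          show "stat_lp z (Suc i) (Suc j) \<le> (\<Sum>a<Suc s. z (Suc a, 0)) + lp (\<lambda>a b. z (Suc (a + s), Suc b)) (Suc i - s) (Suc j)"
            using s Suc lp_Suc_ge(2)[of "\<lambda>a b. z (Suc (a + s), Suc b)" "i - s" j]
            unfolding r e by (simp del: lp.simps stat_lp.simps sum.lessThan_Suc)
        qed
        then show ?thesis ..
      next
        assume "?J i j'"
        then obtain t where t: "t \<le> j'" "stat_lp z (Suc i) j \<le> (\<Sum>b<Suc t. z (0, Suc b)) + lp (\<lambda>a b. z (Suc a, Suc (b + t))) (Suc i) (Suc j' - t)"
          using Suc by auto
        have e: "Suc j - t = Suc (Suc j' - t)" using t Suc by simp
        have "?J i j"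
        proof (intro exI conjI)
          show "t \<le> j" using t Suc by simp
          show "stat_lp z (Suc i) (Suc j) \<le> (\<Sum>b<Suc t. z (0, Suc b)) + lp (\<lambda>a b. z (Suc a, Suc (b + t))) (Suc i) (Suc j - t)"
            using t Suc lp_Suc_ge(2)[of "\<lambda>a b. z (Suc a, Suc (b + t))" i "Suc j' - t"]
            unfolding r e by (simp del: lp.simps stat_lp.simps sum.lessThan_Suc)
        qed
        then show ?thesis ..
      qed
    qed
  qed
qed

section \<open>Large deviations in a rectangle\<close>

definition iid_space :: "nat \<Rightarrow> nat \<Rightarrow> (nat \<times> nat \<Rightarrow> real) measure" where
  "iid_space m k = PiM ({..<m} \<times> {..<k}) (\<lambda>_. expm 1)"

text \<open>The value of \<open>lp\<close> is a function of finitely many weights, so only their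
  joint law matters. This is applied to rectangles inside the stationary model and to boxes of the
  lattice.\<close>

lemma lp_law:
  assumes X: "\<And>p. p \<in> {..<m} \<times> {..<k} \<Longrightarrow> X p \<in> borel_measurable N"
    and D: "distr N (PiM ({..<m} \<times> {..<k}) (\<lambda>_. borel)) (\<lambda>\<omega>. \<lambda>p\<in>{..<m} \<times> {..<k}. X p \<omega>) = iid_space m k"
    and B: "B \<in> sets borel"
  shows "measure N {\<omega>\<in>space N. lp (\<lambda>i j. X (i, j) \<omega>) m k \<in> B}
    = measure (iid_space m k) {z\<in>space (iid_space m k). lp (\<lambda>i j. z (i, j)) m k \<in> B}"
proof -
  let ?S = "{..<m} \<times> {..<k}" and ?f = "\<lambda>\<omega>. \<lambda>p\<in>{..<m} \<times> {..<k}. X p \<omega>"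
  have f: "?f \<in> N \<rightarrow>\<^sub>M PiM ?S (\<lambda>_. borel)" using X by measurable
  have "(\<lambda>z. lp (\<lambda>i j. z (i, j)) m k) \<in> borel_measurable (PiM ?S (\<lambda>_. borel))"
    by (rule lp_measurable) simp
  then have A: "{z\<in>space (PiM ?S (\<lambda>_. borel)). lp (\<lambda>i j. z (i, j)) m k \<in> B} \<in> sets (PiM ?S (\<lambda>_. borel))"
    using B by measurable
  have "{z\<in>space (iid_space m k). lp (\<lambda>i j. z (i, j)) m k \<in> B} = {z\<in>space (PiM ?S (\<lambda>_. borel)). lp (\<lambda>i j. z (i, j)) m k \<in> B}"
    by (simp add: iid_space_def space_PiM)
  then have "measure (iid_space m k) {z\<in>space (iid_space m k). lp (\<lambda>i j. z (i, j)) m k \<in> B}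
     = measure N (?f -` {z\<in>space (PiM ?S (\<lambda>_. borel)). lp (\<lambda>i j. z (i, j)) m k \<in> B} \<inter> space N)"
    unfolding D[symmetric] using measure_distr[OF f A] by simp
  also have "?f -` {z\<in>space (PiM ?S (\<lambda>_. borel)). lp (\<lambda>i j. z (i, j)) m k \<in> B} \<inter> space N
    = {\<omega>\<in>space N. lp (\<lambda>i j. X (i, j) \<omega>) m k \<in> B}"
  proof -
    have "lp (\<lambda>i j. ?f \<omega> (i, j)) m k = lp (\<lambda>i j. X (i, j) \<omega>) m k" for \<omega>
      by (rule lp_cong) simp
    then show ?thesis by (auto simp: space_PiM)
  qed
  finally show ?thesis by simp
qed

lemma stat_rate_pos: "0 < \<alpha> \<Longrightarrow> \<alpha> < 1 \<Longrightarrow> 0 < stat_rate \<alpha> p"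
  by (simp add: stat_rate_def)

lemma prob_space_stat_space: "0 < \<alpha> \<Longrightarrow> \<alpha> < 1 \<Longrightarrow> prob_space (stat_space \<alpha> m k)"
  unfolding stat_space_def by (intro prob_space_PiM prob_space_exponential_density stat_rate_pos)

lemma sets_stat_space: "sets (stat_space \<alpha> m k) = sets (PiM ({..m} \<times> {..k}) (\<lambda>_. borel))"
  unfolding stat_space_def by (intro sets_PiM_cong) auto

lemma stat_space_component: "p \<in> {..m} \<times> {..k} \<Longrightarrow> (\<lambda>z. z p) \<in> borel_measurable (stat_space \<alpha> m k)"
  unfolding measurable_cong_sets[OF sets_stat_space refl] by measurable

text \<open>Off the axes all weights have rate one, so a sub-rectangle that avoids the axes is a
  homogeneous model. Estimates are moved through this identity in both directions.\<close>

lemma lp_law_stat_space: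
  assumes \<alpha>: "0 < \<alpha>" "\<alpha> < 1" and st: "s + m' \<le> m" "t + k' \<le> k" and B: "B \<in> sets borel"
  shows "measure (stat_space \<alpha> m k) {z\<in>space (stat_space \<alpha> m k). lp (\<lambda>i j. z (Suc (i + s), Suc (j + t))) m' k' \<in> B}
    = measure (iid_space m' k') {z\<in>space (iid_space m' k'). lp (\<lambda>i j. z (i, j)) m' k' \<in> B}"
proof -
  let ?f = "\<lambda>p :: nat \<times> nat. (Suc (fst p + s), Suc (snd p + t))"
  let ?I = "{..<m'} \<times> {..<k'}"
  have "distr (stat_space \<alpha> m k) (PiM ?I (\<lambda>i. expm (stat_rate \<alpha> (?f i)))) (\<lambda>z. \<lambda>p\<in>?I. z (?f p)) = PiM ?I (\<lambda>i. expm (stat_rate \<alpha> (?f i)))"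
    unfolding stat_space_def
    by (rule distr_PiM_reindex) (use st \<alpha> in \<open>auto intro!: prob_space_exponential_density stat_rate_pos inj_onI\<close>)
  moreover have "PiM ?I (\<lambda>i. expm (stat_rate \<alpha> (?f i))) = iid_space m' k'"
    by (simp add: iid_space_def stat_rate_def)
  moreover have "distr (stat_space \<alpha> m k) (iid_space m' k') (\<lambda>z. \<lambda>p\<in>?I. z (?f p))
    = distr (stat_space \<alpha> m k) (PiM ?I (\<lambda>_. borel)) (\<lambda>z. \<lambda>p\<in>?I. z (?f p))"
    by (rule distr_cong) (auto simp: iid_space_def intro!: sets_PiM_cong)
  ultimately have "distr (stat_space \<alpha> m k) (PiM ?I (\<lambda>_. borel)) (\<lambda>z. \<lambda>p\<in>?I. z (?f p)) = iid_space m' k'"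
    by simp
  note D = this
  have "(\<lambda>z. z (?f p)) \<in> borel_measurable (stat_space \<alpha> m k)" if "p \<in> ?I" for p
    by (rule stat_space_component) (use that st in auto)
  from lp_law[OF this D B] show ?thesis by simp
qed

lemma AE_stat_space_nonneg:
  assumes "0 < \<alpha>" "\<alpha> < 1"
  shows "AE z in stat_space \<alpha> m k. \<forall>p\<in>{..m} \<times> {..k}. 0 \<le> z p"
proof (rule AE_finite_allI)
  fix p assume p: "p \<in> {..m} \<times> {..k}"
  have "AE x in expm (stat_rate \<alpha> p). 0 \<le> x"
    by (subst AE_density) (auto simp: exponential_density_def)
  then show "AE z in stat_space \<alpha> m k. 0 \<le> z p"
    unfolding stat_space_def using p assms
    by (intro AE_PiM_component prob_space_exponential_density stat_rate_pos) auto
qed simp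

lemma stat_sums_concentration:
  fixes K r0 \<epsilon> :: real
  assumes "K > 0" "r0 > 0" "\<epsilon> > 0"
  obtains \<kappa> where "\<kappa> > 0"
    "\<And>\<alpha> m k n s. \<lbrakk>r0 \<le> \<alpha>; r0 \<le> 1 - \<alpha>; real m \<le> K * real n; s \<le> m\<rbrakk> \<Longrightarrow>
      measure (stat_space \<alpha> m k) {z\<in>space (stat_space \<alpha> m k). (\<Sum>a<s. z (Suc a, 0)) \<ge> s / \<alpha> + \<epsilon> * n} \<le> exp (- \<kappa> * n) \<and>
      measure (stat_space \<alpha> m k) {z\<in>space (stat_space \<alpha> m k). (\<Sum>a<s. z (Suc a, 0)) \<le> s / \<alpha> - \<epsilon> * n} \<le> exp (- \<kappa> * n)"
    "\<And>\<alpha> m k n t. \<lbrakk>r0 \<le> \<alpha>; r0 \<le> 1 - \<alpha>; real k \<le> K * real n; t \<le> k\<rbrakk> \<Longrightarrow>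
      measure (stat_space \<alpha> m k) {z\<in>space (stat_space \<alpha> m k). (\<Sum>b<t. z (0, Suc b)) \<ge> t / (1 - \<alpha>) + \<epsilon> * n} \<le> exp (- \<kappa> * n) \<and>
      measure (stat_space \<alpha> m k) {z\<in>space (stat_space \<alpha> m k). (\<Sum>b<t. z (0, Suc b)) \<le> t / (1 - \<alpha>) - \<epsilon> * n} \<le> exp (- \<kappa> * n)"
    "\<And>\<alpha> m k n. \<lbrakk>r0 \<le> \<alpha>; r0 \<le> 1 - \<alpha>; real k \<le> K * real n\<rbrakk> \<Longrightarrow>
      measure (stat_space \<alpha> m k) {z\<in>space (stat_space \<alpha> m k). (\<Sum>b<k. sweep m k z (0, Suc b)) \<ge> k / (1 - \<alpha>) + \<epsilon> * n} \<le> exp (- \<kappa> * n) \<and>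
      measure (stat_space \<alpha> m k) {z\<in>space (stat_space \<alpha> m k). (\<Sum>b<k. sweep m k z (0, Suc b)) \<le> k / (1 - \<alpha>) - \<epsilon> * n} \<le> exp (- \<kappa> * n)"
proof -
  obtain \<kappa> where k: "\<kappa> > 0" and main:
    "\<And>(S :: (nat \<times> nat) set) F r \<rho> n. finite S \<Longrightarrow> F \<subseteq> S \<Longrightarrow> (\<And>i. r i > 0) \<Longrightarrow> (\<And>i. i \<in> F \<Longrightarrow> r i = \<rho>)
      \<Longrightarrow> r0 \<le> \<rho> \<Longrightarrow> real (card F) \<le> K * real n \<Longrightarrow>
      measure (PiM S (\<lambda>i. expm (r i))) {z\<in>space (PiM S (\<lambda>i. expm (r i))). (\<Sum>i\<in>F. z i) \<ge> card F / \<rho> + \<epsilon> * n} \<le> exp (- \<kappa> * n)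
    \<and> measure (PiM S (\<lambda>i. expm (r i))) {z\<in>space (PiM S (\<lambda>i. expm (r i))). (\<Sum>i\<in>F. z i) \<le> card F / \<rho> - \<epsilon> * n} \<le> exp (- \<kappa> * n)"
  proof (rule exponential_sum_concentration[OF assms], goal_cases)
    case (1 \<kappa>)
    show ?case by (rule 1(1)[OF 1(2) 1(3)])
  qed
  have I: "measure (stat_space \<alpha> m k) {z\<in>space (stat_space \<alpha> m k). (\<Sum>a<s. z (Suc a, 0)) \<ge> s / \<alpha> + \<epsilon> * n} \<le> exp (- \<kappa> * n) \<and>
      measure (stat_space \<alpha> m k) {z\<in>space (stat_space \<alpha> m k). (\<Sum>a<s. z (Suc a, 0)) \<le> s / \<alpha> - \<epsilon> * n} \<le> exp (- \<kappa> * n)"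
    if h: "r0 \<le> \<alpha>" "r0 \<le> 1 - \<alpha>" "real m \<le> K * real n" "s \<le> m" for \<alpha> m k n s
  proof -
    have inj: "inj_on (\<lambda>a. (Suc a, 0::nat)) {..<s}" by (auto intro: inj_onI)
    have "(\<Sum>p\<in>(\<lambda>a. (Suc a, 0)) ` {..<s}. z p) = (\<Sum>a<s. z (Suc a, 0))" for z :: "nat \<times> nat \<Rightarrow> real"
      by (simp add: sum.reindex[OF inj])
    moreover have "card ((\<lambda>a. (Suc a, 0::nat)) ` {..<s}) = s" by (simp add: card_image inj)
    moreover have "(\<lambda>a. (Suc a, 0::nat)) ` {..<s} \<subseteq> {..m} \<times> {..k}" using h by auto
    moreover have "stat_rate \<alpha> i = \<alpha>" if "i \<in> (\<lambda>a. (Suc a, 0::nat)) ` {..<s}" for i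
      using that by (auto simp: stat_rate_def)
    moreover have "0 < stat_rate \<alpha> i" for i using h assms by (intro stat_rate_pos) auto
    ultimately show ?thesis
      using main[of "{..m} \<times> {..k}" "(\<lambda>a. (Suc a, 0)) ` {..<s}" "stat_rate \<alpha>" \<alpha> n] h
      by (simp add: stat_space_def[symmetric])
  qed
  have J: "measure (stat_space \<alpha> m k) {z\<in>space (stat_space \<alpha> m k). (\<Sum>b<t. z (0, Suc b)) \<ge> t / (1 - \<alpha>) + \<epsilon> * n} \<le> exp (- \<kappa> * n) \<and>
      measure (stat_space \<alpha> m k) {z\<in>space (stat_space \<alpha> m k). (\<Sum>b<t. z (0, Suc b)) \<le> t / (1 - \<alpha>) - \<epsilon> * n} \<le> exp (- \<kappa> * n)"
    if h: "r0 \<le> \<alpha>" "r0 \<le> 1 - \<alpha>" "real k \<le> K * real n" "t \<le> k" for \<alpha> m k n t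
  proof -
    have inj: "inj_on (\<lambda>b. (0::nat, Suc b)) {..<t}" by (auto intro: inj_onI)
    have "(\<Sum>p\<in>(\<lambda>b. (0, Suc b)) ` {..<t}. z p) = (\<Sum>b<t. z (0, Suc b))" for z :: "nat \<times> nat \<Rightarrow> real"
      by (simp add: sum.reindex[OF inj])
    moreover have "card ((\<lambda>b. (0::nat, Suc b)) ` {..<t}) = t" by (simp add: card_image inj)
    moreover have "(\<lambda>b. (0::nat, Suc b)) ` {..<t} \<subseteq> {..m} \<times> {..k}" using h by auto
    moreover have "stat_rate \<alpha> i = 1 - \<alpha>" if "i \<in> (\<lambda>b. (0::nat, Suc b)) ` {..<t}" for i
      using that by (auto simp: stat_rate_def)
    moreover have "0 < stat_rate \<alpha> i" for i using h assms by (intro stat_rate_pos) auto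
    ultimately show ?thesis
      using main[of "{..m} \<times> {..k}" "(\<lambda>b. (0, Suc b)) ` {..<t}" "stat_rate \<alpha>" "1 - \<alpha>" n] h
      by (simp add: stat_space_def[symmetric])
  qed
  \<comment> \<open>Burke's property enters the estimates here: the sum along the right side is the
    sum along the left axis composed with the measure preserving map \<open>sweep\<close>.\<close>
  have swp: "measure (stat_space \<alpha> m k) {z\<in>space (stat_space \<alpha> m k). (\<Sum>b<k. sweep m k z (0, Suc b)) \<in> B}
    = measure (stat_space \<alpha> m k) {z\<in>space (stat_space \<alpha> m k). (\<Sum>b<k. z (0, Suc b)) \<in> B}"
    if \<alpha>: "0 < \<alpha>" "\<alpha> < 1" and B: "B \<in> sets borel" for \<alpha> m k B
  proof -
    let ?P = "stat_space \<alpha> m k"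
    have s: "sweep m k \<in> ?P \<rightarrow>\<^sub>M ?P" "distr ?P ?P (sweep m k) = ?P"
      using sweep_preserves[OF \<alpha>] by auto
    have "(\<lambda>z. \<Sum>b<k. z (0, Suc b)) \<in> borel_measurable ?P"
      by (intro borel_measurable_sum stat_space_component) auto
    then have A: "{z\<in>space ?P. (\<Sum>b<k. z (0, Suc b)) \<in> B} \<in> sets ?P" using B by measurable
    have "measure ?P {z\<in>space ?P. (\<Sum>b<k. z (0, Suc b)) \<in> B} = measure (distr ?P ?P (sweep m k)) {z\<in>space ?P. (\<Sum>b<k. z (0, Suc b)) \<in> B}"
      by (simp add: s(2))
    also have "\<dots> = measure ?P (sweep m k -` {z\<in>space ?P. (\<Sum>b<k. z (0, Suc b)) \<in> B} \<inter> space ?P)"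
      by (rule measure_distr[OF s(1) A])
    also have "sweep m k -` {z\<in>space ?P. (\<Sum>b<k. z (0, Suc b)) \<in> B} \<inter> space ?P
       = {z\<in>space ?P. (\<Sum>b<k. sweep m k z (0, Suc b)) \<in> B}"
      using measurable_space[OF s(1)] by auto
    finally show ?thesis by simp
  qed
  have SJ: "measure (stat_space \<alpha> m k) {z\<in>space (stat_space \<alpha> m k). (\<Sum>b<k. sweep m k z (0, Suc b)) \<ge> k / (1 - \<alpha>) + \<epsilon> * n} \<le> exp (- \<kappa> * n) \<and>
      measure (stat_space \<alpha> m k) {z\<in>space (stat_space \<alpha> m k). (\<Sum>b<k. sweep m k z (0, Suc b)) \<le> k / (1 - \<alpha>) - \<epsilon> * n} \<le> exp (- \<kappa> * n)"
    if h: "r0 \<le> \<alpha>" "r0 \<le> 1 - \<alpha>" "real k \<le> K * real n" for \<alpha> m k n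
    using J[OF h order_refl, of m] swp[of \<alpha> "{k / (1 - \<alpha>) + \<epsilon> * n ..}" m k] swp[of \<alpha> "{.. k / (1 - \<alpha>) - \<epsilon> * n}" m k] h assms
    by simp
  show ?thesis by (rule that[OF k I J SJ])
qed

section \<open>Upper and lower tails of the homogeneous passage time\<close>

lemma char_rate_bounds:
  fixes a b L H :: real
  assumes "0 < L" "L \<le> a" "a \<le> H" "L \<le> b" "b \<le> H"
  defines "\<alpha> \<equiv> sqrt a / (sqrt a + sqrt b)"
  shows "sqrt (L / H) / 2 \<le> \<alpha>" "sqrt (L / H) / 2 \<le> 1 - \<alpha>"
proof -
  have p: "0 < sqrt L" "sqrt L \<le> sqrt a" "sqrt a \<le> sqrt H" "sqrt L \<le> sqrt b" "sqrt b \<le> sqrt H"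
    using assms by auto
  have q: "sqrt a + sqrt b > 0" "sqrt a + sqrt b \<le> 2 * sqrt H" using p by linarith+
  have r: "sqrt (L / H) / 2 = sqrt L / (2 * sqrt H)" by (simp add: real_sqrt_divide)
  have "1 - \<alpha> = (sqrt a + sqrt b) / (sqrt a + sqrt b) - sqrt a / (sqrt a + sqrt b)"
    using q by (simp add: \<alpha>_def)
  then have b: "1 - \<alpha> = sqrt b / (sqrt a + sqrt b)" unfolding diff_divide_distrib[symmetric] by simp
  show "sqrt (L / H) / 2 \<le> \<alpha>" unfolding r \<alpha>_def by (rule frac_le) (use p q in linarith)+
  show "sqrt (L / H) / 2 \<le> 1 - \<alpha>" unfolding r b by (rule frac_le) (use p q in linarith)+
qed

text \<open>Serves two purposes: it makes thin rectangles comparable with rectangles of bounded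
  aspect ratio, and it absorbs lattice roundings once \<open>n\<close> is large.\<close>

lemma gm_small_enlargement:
  fixes K \<epsilon> :: real
  assumes "K > 0" "\<epsilon> > 0"
  obtains \<eta> where "\<eta> > 0" "\<eta> \<le> 1"
    "\<And>a b n h. \<lbrakk>0 \<le> n; 0 \<le> a; a \<le> K * n; 0 \<le> b; b \<le> K * n; 0 \<le> h; h \<le> \<eta> * n\<rbrakk> \<Longrightarrow> gm (a + h) (b + h) \<le> gm a b + \<epsilon> * n"
proof -
  \<comment> \<open>By \<open>gm_add_le\<close> the increase is \<open>2 * h\<close> plus twice a
    square root. The second bound makes \<open>2 * h\<close> at most half of
    \<open>\<epsilon> * n\<close>; the third bounds \<open>\<eta> * (2 * K + 1)\<close> by
    \<open>(\<epsilon> / 4)^2\<close>, which leaves the other half for the square root.\<close>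
  define \<eta> where "\<eta> = min 1 (min (\<epsilon> / 4) (\<epsilon>\<^sup>2 / (16 * (2 * K + 1))))"
  have \<eta>: "\<eta> > 0" "\<eta> \<le> 1" "\<eta> \<le> \<epsilon> / 4" "\<eta> \<le> \<epsilon>\<^sup>2 / (16 * (2 * K + 1))"
  proof -
    show "\<eta> > 0" using assms by (simp add: \<eta>_def)
    show "\<eta> \<le> 1" by (simp add: \<eta>_def)
    show "\<eta> \<le> \<epsilon> / 4" unfolding \<eta>_def by (rule min.coboundedI2, rule min.cobounded1)
    show "\<eta> \<le> \<epsilon>\<^sup>2 / (16 * (2 * K + 1))" unfolding \<eta>_def by (rule min.coboundedI2, rule min.cobounded2)
  qed
  have \<eta>2: "\<eta> * (2 * K + 1) \<le> (\<epsilon> / 4)\<^sup>2"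
  proof -
    have "\<eta> * (16 * (2 * K + 1)) \<le> \<epsilon>\<^sup>2" using \<eta>(4) assms by (simp add: pos_le_divide_eq)
    then have "(\<eta> * (2 * K + 1)) * 16 \<le> \<epsilon>\<^sup>2" by (simp add: algebra_simps)
    then have "\<eta> * (2 * K + 1) \<le> \<epsilon>\<^sup>2 / 16" by (simp only: pos_le_divide_eq)
    then show ?thesis by (simp add: power_divide)
  qed
  show ?thesis
  proof (rule that[OF \<eta>(1,2)])
    fix a b n h :: real
    assume h: "0 \<le> n" "0 \<le> a" "a \<le> K * n" "0 \<le> b" "b \<le> K * n" "0 \<le> h" "h \<le> \<eta> * n"
    have "h \<le> 1 * n" using h \<eta> by (meson mult_right_mono order_trans)
    then have "a + b + h \<le> (2 * K + 1) * n" using h by (simp add: algebra_simps)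
    then have "h * (a + b + h) \<le> (\<eta> * n) * ((2 * K + 1) * n)"
      using h \<eta> by (intro mult_mono) auto
    also have "\<dots> = (\<eta> * (2 * K + 1)) * n\<^sup>2" by (simp add: power2_eq_square)
    also have "\<dots> \<le> (\<epsilon> / 4)\<^sup>2 * n\<^sup>2" using \<eta>2 by (intro mult_right_mono) auto
    finally have "h * (a + b + h) \<le> (\<epsilon> / 4 * n)\<^sup>2" by (simp only: power_mult_distrib)
    then have "sqrt (h * (a + b + h)) \<le> \<epsilon> / 4 * n"
      using h assms by (intro real_le_lsqrt) auto
    moreover have "h \<le> \<epsilon> / 4 * n" using h \<eta> by (meson mult_right_mono order_trans)
    ultimately show "gm (a + h) (b + h) \<le> gm a b + \<epsilon> * n"
      using gm_add_le[of a b h] h by linarith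
  qed
qed

text \<open>Weights on the axes can only increase the passage time, and the stationary passage time
  is a sum of two concentrated sums.\<close>

theorem lp_upper_tail:
  fixes K \<epsilon> :: real
  assumes "K > 0" "\<epsilon> > 0"
  obtains \<kappa> where "\<kappa> > 0"
    "\<And>n m k. \<lbrakk>n \<ge> 1; real m \<le> K * n; real k \<le> K * n\<rbrakk> \<Longrightarrow>
      measure (iid_space m k) {z\<in>space (iid_space m k). lp (\<lambda>i j. z (i, j)) m k \<ge> gm m k + \<epsilon> * real n} \<le> 2 * exp (- \<kappa> * n)"
proof -
  obtain \<eta> where \<eta>: "\<eta> > 0" "\<eta> \<le> 1"
    "\<And>a b n h. \<lbrakk>0 \<le> n; 0 \<le> a; a \<le> K * n; 0 \<le> b; b \<le> K * n; 0 \<le> h; h \<le> \<eta> * n\<rbrakk> \<Longrightarrow> gm (a + h) (b + h) \<le> gm a b + \<epsilon> / 2 * n"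
  proof (rule gm_small_enlargement[of K "\<epsilon> / 2"], goal_cases)
    case (3 \<eta>)
    show ?case by (rule 3(1)[OF 3(2-4)])
  qed (use assms in auto)
  define r0 where "r0 = sqrt (\<eta> / (K + \<eta>)) / 2"
  have r0: "r0 > 0" using \<eta> assms by (simp add: r0_def)
  have e4: "\<epsilon> / 4 > 0" using assms by simp
  obtain \<kappa> where k: "\<kappa> > 0" and
    I: "\<And>\<alpha> m k n s. \<lbrakk>r0 \<le> \<alpha>; r0 \<le> 1 - \<alpha>; real m \<le> K * real n; s \<le> m\<rbrakk> \<Longrightarrow>
      measure (stat_space \<alpha> m k) {z\<in>space (stat_space \<alpha> m k). (\<Sum>a<s. z (Suc a, 0)) \<ge> s / \<alpha> + \<epsilon> / 4 * n} \<le> exp (- \<kappa> * n)" and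
    J: "\<And>\<alpha> m k n. \<lbrakk>r0 \<le> \<alpha>; r0 \<le> 1 - \<alpha>; real k \<le> K * real n\<rbrakk> \<Longrightarrow>
      measure (stat_space \<alpha> m k) {z\<in>space (stat_space \<alpha> m k). (\<Sum>b<k. sweep m k z (0, Suc b)) \<ge> k / (1 - \<alpha>) + \<epsilon> / 4 * n} \<le> exp (- \<kappa> * n)"
  proof (rule stat_sums_concentration[OF assms(1) r0 e4], goal_cases)
    case (1 \<kappa>)
    show ?case by (rule 1(1)[OF 1(2) conjunct1[OF 1(3)] conjunct1[OF 1(5)]])
  qed
  show ?thesis
  proof (rule that[OF k])
    fix n m k :: nat
    assume h: "n \<ge> 1" "real m \<le> K * n" "real k \<le> K * n"
    \<comment> \<open>A thin rectangle would push its characteristic rate to 0 or 1. The rate is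
      therefore taken from the rectangle enlarged by \<open>\<eta> * n\<close> in both directions,
      at a cost of at most \<open>\<epsilon> / 2 * n\<close>; each of the two sums may use another
      \<open>\<epsilon> / 4 * n\<close>.\<close>
    define a b where "a = m + \<eta> * n" and "b = k + \<eta> * n"
    have nn: "\<eta> * n > 0" using \<eta> h by simp
    have ab: "0 < a" "0 < b" "\<eta> * n \<le> a" "a \<le> (K + \<eta>) * n" "\<eta> * n \<le> b" "b \<le> (K + \<eta>) * n"
      using h \<eta> nn by (auto simp: a_def b_def algebra_simps intro!: add_nonneg_pos)
    define \<alpha> where "\<alpha> = sqrt a / (sqrt a + sqrt b)"
    note ch = gm_eq_tangent[OF ab(1,2), folded \<alpha>_def]
    have "\<eta> * n / ((K + \<eta>) * n) = \<eta> / (K + \<eta>)" using h by simp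
    then have r: "r0 \<le> \<alpha>" "r0 \<le> 1 - \<alpha>"
      using char_rate_bounds[OF nn ab(3-6), folded \<alpha>_def] by (simp_all add: r0_def)
    let ?P = "stat_space \<alpha> m k"
    interpret P: prob_space ?P using prob_space_stat_space ch by simp
    let ?A = "{z\<in>space ?P. (\<Sum>a<m. z (Suc a, 0)) \<ge> m / \<alpha> + \<epsilon> / 4 * n}"
    let ?B = "{z\<in>space ?P. (\<Sum>b<k. sweep m k z (0, Suc b)) \<ge> k / (1 - \<alpha>) + \<epsilon> / 4 * n}"
    let ?L = "{z\<in>space ?P. lp (\<lambda>i j. z (Suc (i + 0), Suc (j + 0))) m k \<in> {gm m k + \<epsilon> * real n..}}"
    have "(\<lambda>z. \<Sum>a<m. z (Suc a, 0)) \<in> borel_measurable ?P"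
      by (intro borel_measurable_sum stat_space_component) auto
    then have A: "?A \<in> sets ?P" by measurable
    have "(\<lambda>z. \<Sum>b<k. sweep m k z (0, Suc b)) \<in> borel_measurable ?P"
      using sweep_preserves[OF ch(1,2), of m k]
      by (intro borel_measurable_sum) (auto intro!: measurable_compose[of "sweep m k" ?P ?P, OF _ stat_space_component])
    then have B: "?B \<in> sets ?P" by measurable
    have "gm a b \<le> gm m k + \<epsilon> / 2 * n"
      unfolding a_def b_def by (rule \<eta>(3)) (use h \<eta> in auto)
    moreover have "m / \<alpha> \<le> a / \<alpha>" "k / (1 - \<alpha>) \<le> b / (1 - \<alpha>)"
      using ch nn by (auto simp: a_def b_def intro!: divide_right_mono)
    ultimately have gb: "m / \<alpha> + k / (1 - \<alpha>) \<le> gm m k + \<epsilon> / 2 * n" using ch by simp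
    have "AE z in ?P. z \<in> ?L \<longrightarrow> z \<in> ?A \<union> ?B"
      using AE_stat_space_nonneg[OF ch(1,2)] AE_space
    proof eventually_elim
      case (elim z)
      then have le: "lp (\<lambda>i j. z (Suc i, Suc j)) m k \<le> (\<Sum>i<m. z (Suc i, 0)) + (\<Sum>j<k. sweep m k z (0, Suc j))"
        using lp_le_stat_lp[of m k z] unfolding stat_lp_eq_sums by blast
      show ?case
      proof
        assume "z \<in> ?L"
        then have "gm m k + \<epsilon> * n \<le> lp (\<lambda>i j. z (Suc i, Suc j)) m k" by simp
        then show "z \<in> ?A \<union> ?B" using le elim gb by auto
      qed
    qed
    then have "measure ?P ?L \<le> measure ?P (?A \<union> ?B)"
      by (rule P.finite_measure_mono_AE) (use A B in auto)
    also have "\<dots> \<le> measure ?P ?A + measure ?P ?B"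
      by (rule measure_Un_le[OF A B])
    also have "\<dots> \<le> 2 * exp (- \<kappa> * n)"
      using I[OF r h(2) order_refl, of k] J[OF r h(3), of m] by linarith
    finally have "measure ?P ?L \<le> 2 * exp (- \<kappa> * n)" .
    moreover have "measure ?P ?L = measure (iid_space m k) {z\<in>space (iid_space m k). lp (\<lambda>i j. z (i, j)) m k \<in> {gm m k + \<epsilon> * n..}}"
      by (rule lp_law_stat_space) (use ch in auto)
    ultimately show "measure (iid_space m k) {z\<in>space (iid_space m k). lp (\<lambda>i j. z (i, j)) m k \<ge> gm m k + \<epsilon> * real n} \<le> 2 * exp (- \<kappa> * n)"
      by simp
  qed
qed

text \<open>The exit point of the stationary model at \<open>s\<close> costs \<open>sqrt (k / m) * (sqrt m - sqrt (m - s))^2\<close>.\<close>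
lemma exit_near_corner:
  fixes m k s n \<eta> K \<epsilon> G Bs L R \<delta> \<epsilon>1 :: real
  assumes pos: "0 < \<eta>" "0 < K" "0 < \<epsilon>" "0 < n"
    and mk: "\<eta> * n \<le> m" "m \<le> K * n" "\<eta> * n \<le> k" "k \<le> K * n"
    and s: "0 \<le> s" "s \<le> m"
    and R_def: "R = 1 + sqrt (K / \<eta>)"
    and \<delta>_def: "\<delta> = \<epsilon> / (4 * R)"
    and \<epsilon>1_def: "\<epsilon>1 = min (\<epsilon> / 12) (\<delta>\<^sup>2 / (32 * K * R))"
    and n: "n \<ge> 8 * K * R\<^sup>2 / \<delta>\<^sup>2" "n \<ge> 4 * R / \<epsilon>"
    and G: "G \<ge> gm m k - 2 * \<epsilon>1 * n" "G \<le> Bs + L"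
    and Bs: "Bs \<le> (s + 1) * (1 + sqrt (k / m)) + \<epsilon>1 * n"
    and L: "L \<le> gm (m - s) k + \<epsilon>1 * n"
  shows "L > gm m k - \<epsilon> * n"
proof -
  have "0 < \<eta> * n" using pos by simp
  then have mp: "m > 0" "k > 0" using mk by linarith+
  have ratio: "k / m \<le> K / \<eta>" "m / k \<le> K / \<eta>"
  proof -
    have "k / m \<le> (K * n) / (\<eta> * n)" "m / k \<le> (K * n) / (\<eta> * n)"
      by (rule frac_le; use mk mp pos in simp)+
    then show "k / m \<le> K / \<eta>" "m / k \<le> K / \<eta>" using pos by simp_all
  qed
  define q where "q = sqrt (k / m)"
  have q: "q > 0" "1 + q \<le> R" "1 / q \<le> R"
  proof -
    show "q > 0" using mp by (simp add: q_def)
    show "1 + q \<le> R" using ratio by (simp add: q_def R_def)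
    have "1 / q = sqrt (m / k)" using mp by (simp add: q_def real_sqrt_divide)
    then show "1 / q \<le> R" using ratio by (simp add: R_def add_increasing)
  qed
  have R: "R > 0" using q by linarith
  have \<delta>: "\<delta> > 0" using pos R by (simp add: \<delta>_def)
  have \<epsilon>1: "0 < \<epsilon>1" "\<epsilon>1 \<le> \<epsilon> / 12" "\<epsilon>1 \<le> \<delta>\<^sup>2 / (32 * K * R)"
  proof -
    show "0 < \<epsilon>1" using pos R \<delta> by (simp add: \<epsilon>1_def)
    show "\<epsilon>1 \<le> \<epsilon> / 12" unfolding \<epsilon>1_def by (rule min.cobounded1)
    show "\<epsilon>1 \<le> \<delta>\<^sup>2 / (32 * K * R)" unfolding \<epsilon>1_def by (rule min.cobounded2)
  qed
  have mq: "q * m = sqrt (m * k)"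
  proof -
    have "sqrt (m * k) = sqrt ((k / m) * m\<^sup>2)" using mp by (simp add: power2_eq_square)
    also have "\<dots> = q * m" unfolding real_sqrt_mult q_def using mp by simp
    finally show ?thesis by simp
  qed
  have "sqrt ((m - s) * k) = q * sqrt (m * (m - s))"
    unfolding q_def real_sqrt_mult[symmetric] using mp by simp
  then have g2: "gm (m - s) k = m - s + k + 2 * (q * sqrt (m * (m - s)))"
    using gm_expand[of "m - s" k] mp s by simp
  have g1: "gm m k = m + k + 2 * (q * m)" using gm_expand[of m k] mp mq by simp
  \<comment> \<open>The mean loss from following the axis up to \<open>s\<close>. At the
    characteristic rate its first order part vanishes and a square remains, which will be bounded
    below by \<open>s^2 / (4 * m)\<close>.\<close>
  have D: "gm m k - s * (1 + q) - gm (m - s) k = q * (m + (m - s) - 2 * sqrt (m * (m - s)))"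
    unfolding g1 g2 by (simp add: distrib_left right_diff_distrib)
  have D0: "m + (m - s) - 2 * sqrt (m * (m - s)) = (sqrt m - sqrt (m - s))\<^sup>2"
    unfolding power2_diff real_sqrt_mult using mp s by simp
  have D2: "(sqrt m - sqrt (m - s))\<^sup>2 \<ge> s\<^sup>2 / (4 * m)"
  proof -
    have "s = (sqrt m - sqrt (m - s)) * (sqrt m + sqrt (m - s))"
      using mp s by (simp add: algebra_simps)
    also have "\<dots> \<le> (sqrt m - sqrt (m - s)) * (2 * sqrt m)"
      using mp s by (intro mult_left_mono) auto
    finally have "s\<^sup>2 \<le> ((sqrt m - sqrt (m - s)) * (2 * sqrt m))\<^sup>2"
      using s by (intro power_mono) auto
    also have "\<dots> = (sqrt m - sqrt (m - s))\<^sup>2 * (4 * m)"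
      using mp by (simp add: power_mult_distrib)
    finally show ?thesis using mp by (simp add: field_simps)
  qed
  have D1: "q * (s\<^sup>2 / (4 * m)) \<le> gm m k - s * (1 + q) - gm (m - s) k"
    unfolding D D0 by (rule mult_left_mono[OF D2]) (use q in simp)
  have "gm m k - 2 * \<epsilon>1 * n \<le> (s + 1) * (1 + q) + \<epsilon>1 * n + (gm (m - s) k + \<epsilon>1 * n)"
    using G Bs L unfolding q_def by linarith
  then have "gm m k - s * (1 + q) - gm (m - s) k \<le> 4 * (\<epsilon>1 * n) + (1 + q)"
    by (simp add: algebra_simps)
  then have "q * (s\<^sup>2 / (4 * m)) \<le> 4 * (\<epsilon>1 * n) + R" using D1 q by linarith
  then have "(1 / q) * (q * (s\<^sup>2 / (4 * m))) \<le> (1 / q) * (4 * (\<epsilon>1 * n) + R)"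
    using q(1) by (intro mult_left_mono) simp_all
  also have "(1 / q) * (q * (s\<^sup>2 / (4 * m))) = s\<^sup>2 / (4 * m)" using q(1) by simp
  finally have "s\<^sup>2 / (4 * m) \<le> (1 / q) * (4 * (\<epsilon>1 * n) + R)" .
  also have "\<dots> \<le> R * (4 * (\<epsilon>1 * n) + R)"
    using q R \<epsilon>1 pos by (intro mult_right_mono) auto
  finally have "s\<^sup>2 / (4 * m) \<le> R * (4 * (\<epsilon>1 * n) + R)" .
  then have "s\<^sup>2 \<le> (4 * m) * (R * (4 * (\<epsilon>1 * n) + R))"
    using mp by (simp add: pos_divide_le_eq mult.commute)
  also have "\<dots> \<le> (4 * (K * n)) * (R * (4 * (\<epsilon>1 * n) + R))"
    using mk R \<epsilon>1 pos by (intro mult_right_mono) auto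
  also have "\<dots> = 16 * K * R * \<epsilon>1 * n\<^sup>2 + 4 * K * R\<^sup>2 * n"
    by (simp add: algebra_simps power2_eq_square)
  \<comment> \<open>The value of \<open>\<epsilon>1\<close> and the first lower bound on
    \<open>n\<close> are made so that each term is at most half of
    \<open>(\<delta> * n)^2\<close>.\<close>
  also have "\<dots> \<le> \<delta>\<^sup>2 / 2 * n\<^sup>2 + \<delta>\<^sup>2 / 2 * n\<^sup>2"
  proof (intro add_mono)
    have "32 * K * R * \<epsilon>1 \<le> \<delta>\<^sup>2" using \<epsilon>1(3) pos R by (simp add: pos_le_divide_eq mult.commute)
    then have "16 * K * R * \<epsilon>1 \<le> \<delta>\<^sup>2 / 2" by simp
    then show "16 * K * R * \<epsilon>1 * n\<^sup>2 \<le> \<delta>\<^sup>2 / 2 * n\<^sup>2" by (intro mult_right_mono) auto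
    have "8 * K * R\<^sup>2 \<le> \<delta>\<^sup>2 * n" using n(1) \<delta> by (simp add: pos_divide_le_eq mult.commute)
    then have "4 * K * R\<^sup>2 \<le> \<delta>\<^sup>2 / 2 * n" by simp
    then have "4 * K * R\<^sup>2 * n \<le> \<delta>\<^sup>2 / 2 * n * n" using pos by (intro mult_right_mono) auto
    then show "4 * K * R\<^sup>2 * n \<le> \<delta>\<^sup>2 / 2 * n\<^sup>2" by (simp add: power2_eq_square)
  qed
  also have "\<dots> = (\<delta> * n)\<^sup>2" by (simp add: power_mult_distrib)
  finally have "s \<le> \<delta> * n" by (rule power2_le_imp_le) (use \<delta> pos in simp)
  \<comment> \<open>With \<open>\<delta> = \<epsilon> / (4 * R)\<close> and
    \<open>n \<ge> 4 * R / \<epsilon>\<close> the axis part is at most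
    \<open>\<epsilon> / 2 * n\<close>. Three errors of size \<open>\<epsilon>1 * n\<close> add at
    most \<open>\<epsilon> / 4 * n\<close>, so the final inequality is strict.\<close>
  then have "(s + 1) * (1 + q) \<le> (\<delta> * n + 1) * R"
    using q s by (intro mult_mono) auto
  also have "\<dots> = \<epsilon> / 4 * n + R" using R by (simp add: \<delta>_def field_simps)
  finally have 0: "(s + 1) * (1 + q) \<le> \<epsilon> / 4 * n + R" .
  have "R \<le> \<epsilon> / 4 * n" using n(2) pos by (simp add: field_simps)
  with 0 have 1: "(s + 1) * (1 + q) \<le> \<epsilon> / 4 * n + \<epsilon> / 4 * n" by linarith
  have 2: "\<epsilon>1 * n \<le> \<epsilon> / 12 * n" using \<epsilon>1 pos by (intro mult_right_mono) auto
  have 3: "\<epsilon> * n > 0" using pos by simp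
  have "L \<ge> gm m k - 2 * \<epsilon>1 * n - (s + 1) * (1 + q) - \<epsilon>1 * n"
    using G Bs unfolding q_def by linarith
  with 1 2 3 show ?thesis by linarith
qed

lemma measure_union_bound:
  fixes c :: real
  assumes "finite I" "\<And>i. i \<in> I \<Longrightarrow> A i \<in> sets N" "\<And>i. i \<in> I \<Longrightarrow> measure N (A i) \<le> c" "prob_space N"
  shows "measure N (\<Union>i\<in>I. A i) \<le> card I * c"
proof -
  interpret prob_space N by fact
  have "measure N (\<Union>i\<in>I. A i) \<le> (\<Sum>i\<in>I. measure N (A i))"
    by (rule measure_UNION_le) (use assms in auto)
  also have "\<dots> \<le> (\<Sum>i\<in>I. c :: real)" by (rule sum_mono) (use assms in auto)
  finally show ?thesis by simp
qed

text \<open>All axis sums are controlled, and the upper tail is applied to every rectangle that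
  remains after an exit point. Then a stationary path of typical length must exit near the corner,
  and its bulk part alone is already long enough. The two events for the total, one per exit point
  for the axis sums and two per exit point for the rectangles give \<open>3 * m + 3 * k + 8\<close>,
  whence the prefactor. The lower bound on the sides keeps the characteristic rate away from 0 and
  1.\<close>

theorem lp_lower_tail:
  fixes K \<epsilon> \<eta> :: real
  assumes pos: "K > 0" "\<epsilon> > 0" "\<eta> > 0"
  obtains \<kappa> N where "\<kappa> > 0"
    "\<And>n m k. \<lbrakk>n \<ge> N; \<eta> * n \<le> real m; real m \<le> K * n; \<eta> * n \<le> real k; real k \<le> K * n\<rbrakk> \<Longrightarrow>
      measure (iid_space m k) {z\<in>space (iid_space m k). lp (\<lambda>i j. z (i, j)) m k \<le> gm m k - \<epsilon> * real n}
        \<le> (6 * K * n + 8) * exp (- \<kappa> * n)"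
proof -
  define R where "R = 1 + sqrt (K / \<eta>)"
  define \<delta> where "\<delta> = \<epsilon> / (4 * R)"
  define \<epsilon>1 where "\<epsilon>1 = min (\<epsilon> / 12) (\<delta>\<^sup>2 / (32 * K * R))"
  have R: "R > 0" unfolding R_def using pos by (intro add_pos_nonneg) auto
  have \<epsilon>1: "\<epsilon>1 > 0" using pos R by (simp add: \<epsilon>1_def \<delta>_def)
  define r0 where "r0 = sqrt (\<eta> / K) / 2"
  have r0: "r0 > 0" using pos by (simp add: r0_def)
  obtain \<kappa>1 where k1: "\<kappa>1 > 0" and
    I: "\<And>\<alpha> m k n s. \<lbrakk>r0 \<le> \<alpha>; r0 \<le> 1 - \<alpha>; real m \<le> K * real n; s \<le> m\<rbrakk> \<Longrightarrow>
      measure (stat_space \<alpha> m k) {z\<in>space (stat_space \<alpha> m k). (\<Sum>a<s. z (Suc a, 0)) \<ge> s / \<alpha> + \<epsilon>1 * n} \<le> exp (- \<kappa>1 * n) \<and>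
      measure (stat_space \<alpha> m k) {z\<in>space (stat_space \<alpha> m k). (\<Sum>a<s. z (Suc a, 0)) \<le> s / \<alpha> - \<epsilon>1 * n} \<le> exp (- \<kappa>1 * n)" and
    J: "\<And>\<alpha> m k n t. \<lbrakk>r0 \<le> \<alpha>; r0 \<le> 1 - \<alpha>; real k \<le> K * real n; t \<le> k\<rbrakk> \<Longrightarrow>
      measure (stat_space \<alpha> m k) {z\<in>space (stat_space \<alpha> m k). (\<Sum>b<t. z (0, Suc b)) \<ge> t / (1 - \<alpha>) + \<epsilon>1 * n} \<le> exp (- \<kappa>1 * n)" and
    SJ: "\<And>\<alpha> m k n. \<lbrakk>r0 \<le> \<alpha>; r0 \<le> 1 - \<alpha>; real k \<le> K * real n\<rbrakk> \<Longrightarrow>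
      measure (stat_space \<alpha> m k) {z\<in>space (stat_space \<alpha> m k). (\<Sum>b<k. sweep m k z (0, Suc b)) \<le> k / (1 - \<alpha>) - \<epsilon>1 * n} \<le> exp (- \<kappa>1 * n)"
  proof (rule stat_sums_concentration[OF pos(1) r0 \<epsilon>1], goal_cases)
    case (1 \<kappa>)
    show ?case by (rule 1(1)[OF 1(2) 1(3) conjunct1[OF 1(4)] conjunct2[OF 1(5)]])
  qed
  obtain \<kappa>2 where k2: "\<kappa>2 > 0" and
    U: "\<And>n m k. \<lbrakk>n \<ge> 1; real m \<le> K * n; real k \<le> K * n\<rbrakk> \<Longrightarrow>
      measure (iid_space m k) {z\<in>space (iid_space m k). lp (\<lambda>i j. z (i, j)) m k \<ge> gm m k + \<epsilon>1 * real n} \<le> 2 * exp (- \<kappa>2 * n)"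
  proof (rule lp_upper_tail[OF pos(1) \<epsilon>1], goal_cases)
    case (1 \<kappa>)
    show ?case by (rule 1(1)[OF 1(2) 1(3)])
  qed
  define \<kappa> where "\<kappa> = min \<kappa>1 \<kappa>2"
  define N where "N = max 1 (nat \<lceil>max (8 * K * R\<^sup>2 / \<delta>\<^sup>2) (4 * R / \<epsilon>)\<rceil>)"
  show ?thesis
  proof (rule that[of \<kappa> N])
    show "\<kappa> > 0" using k1 k2 by (simp add: \<kappa>_def)
  next
    fix n m k :: nat
    assume h: "n \<ge> N" "\<eta> * n \<le> real m" "real m \<le> K * n" "\<eta> * n \<le> real k" "real k \<le> K * n"
    have n: "n \<ge> 1" "real n \<ge> 8 * K * R\<^sup>2 / \<delta>\<^sup>2" "real n \<ge> 4 * R / \<epsilon>"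
      using h(1) by (auto simp: N_def)
    have n0: "0 < real n" using n by simp
    have nn: "\<eta> * n > 0" using n pos by simp
    have mk: "real m > 0" "real k > 0" using nn h by linarith+
    define \<alpha> where "\<alpha> = sqrt (real m) / (sqrt (real m) + sqrt (real k))"
    note ch = gm_eq_tangent[OF mk, folded \<alpha>_def]
    have "\<eta> * n / (K * n) = \<eta> / K" using n by simp
    then have r: "r0 \<le> \<alpha>" "r0 \<le> 1 - \<alpha>"
      using char_rate_bounds[OF nn h(2-5), folded \<alpha>_def] by (simp_all add: r0_def)
    let ?P = "stat_space \<alpha> m k"
    have pr: "prob_space ?P" using prob_space_stat_space ch by simp
    interpret P: prob_space ?P by (rule pr)
    define e where "e = exp (- \<kappa> * n)"
    have e: "exp (- \<kappa>1 * n) \<le> e" "exp (- \<kappa>2 * n) \<le> e" by (auto simp: e_def \<kappa>_def mult_right_mono)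
    define A1 where "A1 = {z\<in>space ?P. (\<Sum>a<m. z (Suc a, 0)) \<le> m / \<alpha> - \<epsilon>1 * n}"
    define A2 where "A2 = {z\<in>space ?P. (\<Sum>b<k. sweep m k z (0, Suc b)) \<le> k / (1 - \<alpha>) - \<epsilon>1 * n}"
    define B1 where "B1 s = {z\<in>space ?P. (\<Sum>a<s. z (Suc a, 0)) \<ge> s / \<alpha> + \<epsilon>1 * n}" for s
    define B2 where "B2 t = {z\<in>space ?P. (\<Sum>b<t. z (0, Suc b)) \<ge> t / (1 - \<alpha>) + \<epsilon>1 * n}" for t
    define C1 where "C1 s = {z\<in>space ?P. lp (\<lambda>i j. z (Suc (i + s), Suc (j + 0))) (m - s) k \<in> {gm (real (m - s)) k + \<epsilon>1 * real n..}}" for s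
    define C2 where "C2 t = {z\<in>space ?P. lp (\<lambda>i j. z (Suc (i + 0), Suc (j + t))) m (k - t) \<in> {gm m (real (k - t)) + \<epsilon>1 * real n..}}" for t
    let ?L = "{z\<in>space ?P. lp (\<lambda>i j. z (Suc (i + 0), Suc (j + 0))) m k \<in> {..gm m k - \<epsilon> * real n}}"
    have m1: "(\<lambda>z. \<Sum>a<s. z (Suc a, 0)) \<in> borel_measurable ?P" if "s \<le> m" for s
      using that by (intro borel_measurable_sum stat_space_component) auto
    have m2: "(\<lambda>z. \<Sum>b<t. z (0, Suc b)) \<in> borel_measurable ?P" if "t \<le> k" for t
      using that by (intro borel_measurable_sum stat_space_component) auto
    have m3: "(\<lambda>z. \<Sum>b<k. sweep m k z (0, Suc b)) \<in> borel_measurable ?P"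
      using sweep_preserves[OF ch(1,2), of m k]
      by (intro borel_measurable_sum) (auto intro!: measurable_compose[of "sweep m k" ?P ?P, OF _ stat_space_component])
    have m4: "(\<lambda>z. lp (\<lambda>i j. z (Suc (i + s), Suc (j + t))) (m - s) (k - t)) \<in> borel_measurable ?P" for s t
      by (intro lp_measurable stat_space_component) auto
    have sA: "A1 \<in> sets ?P" "A2 \<in> sets ?P"
      unfolding A1_def A2_def using m1[of m] m3 by measurable
    have sB1: "B1 s \<in> sets ?P" if "s \<in> {..m}" for s unfolding B1_def using m1[OF that[unfolded atMost_iff]] by measurable
    have sB2: "B2 s \<in> sets ?P" if "s \<in> {..k}" for s unfolding B2_def using m2[OF that[unfolded atMost_iff]] by measurable
    have sC1: "C1 s \<in> sets ?P" for s unfolding C1_def using m4[of s 0] unfolding diff_zero by measurable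
    have sC2: "C2 t \<in> sets ?P" for t unfolding C2_def using m4[of 0 t] unfolding diff_zero by measurable
    have pA: "measure ?P A1 \<le> e" "measure ?P A2 \<le> e"
      using I[OF r h(3) order_refl, of k] SJ[OF r h(5), of m] e unfolding A1_def A2_def by linarith+
    have pB1: "measure ?P (B1 s) \<le> e" if "s \<in> {..m}" for s
      using I[OF r h(3), of s k] that e unfolding B1_def by auto
    have pB2: "measure ?P (B2 t) \<le> e" if "t \<in> {..k}" for t
      using J[OF r h(5), of t m] that e unfolding B2_def by auto
    have pC1: "measure ?P (C1 s) \<le> 2 * e" if "s \<in> {..m}" for s
    proof -
      have "measure ?P (C1 s) = measure (iid_space (m - s) k) {z\<in>space (iid_space (m - s) k). lp (\<lambda>i j. z (i, j)) (m - s) k \<in> {gm (real (m - s)) k + \<epsilon>1 * real n..}}"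
        unfolding C1_def by (rule lp_law_stat_space) (use ch that in auto)
      also have "\<dots> \<le> 2 * exp (- \<kappa>2 * n)" using U[OF n(1), of "m - s" k] h by simp
      finally show ?thesis using e by linarith
    qed
    have pC2: "measure ?P (C2 t) \<le> 2 * e" if "t \<in> {..k}" for t
    proof -
      have "measure ?P (C2 t) = measure (iid_space m (k - t)) {z\<in>space (iid_space m (k - t)). lp (\<lambda>i j. z (i, j)) m (k - t) \<in> {gm m (real (k - t)) + \<epsilon>1 * real n..}}"
        unfolding C2_def by (rule lp_law_stat_space) (use ch that in auto)
      also have "\<dots> \<le> 2 * exp (- \<kappa>2 * n)" using U[OF n(1), of m "k - t"] h by simp
      finally show ?thesis using e by linarith
    qed
    let ?U1 = "\<Union>s\<in>{..m}. B1 s" and ?U2 = "\<Union>t\<in>{..k}. B2 t" and ?U3 = "\<Union>s\<in>{..m}. C1 s" and ?U4 = "\<Union>t\<in>{..k}. C2 t"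
    have sU: "?U1 \<in> sets ?P" "?U2 \<in> sets ?P" "?U3 \<in> sets ?P" "?U4 \<in> sets ?P"
      using sB1 sB2 sC1 sC2 by (auto intro!: sets.finite_UN)
    have pU: "measure ?P ?U1 \<le> card {..m} * e" "measure ?P ?U2 \<le> card {..k} * e"
      "measure ?P ?U3 \<le> card {..m} * (2 * e)" "measure ?P ?U4 \<le> card {..k} * (2 * e)"
      by (intro measure_union_bound finite_atMost sB1 sB2 sC1 sC2 pB1 pB2 pC1 pC2 pr; assumption)+
    have "AE z in ?P. z \<in> ?L \<longrightarrow> z \<in> A1 \<union> A2 \<union> ?U1 \<union> ?U2 \<union> ?U3 \<union> ?U4"
      using AE_stat_space_nonneg[OF ch(1,2)] AE_space
    proof eventually_elim
      case (elim z)
      have z: "z \<in> space ?P" using elim by simp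
      show ?case
      proof (rule impI, rule ccontr)
        assume "z \<in> ?L" and "z \<notin> A1 \<union> A2 \<union> ?U1 \<union> ?U2 \<union> ?U3 \<union> ?U4"
        then have zL: "lp (\<lambda>i j. z (Suc i, Suc j)) m k \<le> gm m k - \<epsilon> * n"
          and a1: "(\<Sum>a<m. z (Suc a, 0)) > m / \<alpha> - \<epsilon>1 * n"
          and a2: "(\<Sum>b<k. sweep m k z (0, Suc b)) > k / (1 - \<alpha>) - \<epsilon>1 * n"
          and b1: "\<And>s. s \<le> m \<Longrightarrow> (\<Sum>a<s. z (Suc a, 0)) < s / \<alpha> + \<epsilon>1 * n"
          and b2: "\<And>t. t \<le> k \<Longrightarrow> (\<Sum>b<t. z (0, Suc b)) < t / (1 - \<alpha>) + \<epsilon>1 * n"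
          and c1: "\<And>s. s \<le> m \<Longrightarrow> lp (\<lambda>i j. z (Suc (i + s), Suc j)) (m - s) k < gm (real (m - s)) k + \<epsilon>1 * n"
          and c2: "\<And>t. t \<le> k \<Longrightarrow> lp (\<lambda>i j. z (Suc i, Suc (j + t))) m (k - t) < gm m (real (k - t)) + \<epsilon>1 * n"
          using z by (auto simp: A1_def A2_def B1_def B2_def C1_def C2_def not_le)
        have G: "stat_lp z m k \<ge> gm m k - 2 * \<epsilon>1 * n"
          using a1 a2 ch(5) unfolding stat_lp_eq_sums by linarith
        obtain m' k' where mk': "m = Suc m'" "k = Suc k'" using mk by (cases m; cases k) auto
        have w: "0 \<le> z (Suc i, Suc j)" if "i < m" "j < k" for i j using elim that by auto
        from stat_lp_exit[of m' z k'] show False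
        proof
          assume "\<exists>s\<le>m'. stat_lp z (Suc m') (Suc k') \<le> (\<Sum>a<Suc s. z (Suc a, 0)) + lp (\<lambda>a b. z (Suc (a + s), Suc b)) (Suc m' - s) (Suc k')"
          then obtain s where s: "s \<le> m'" "stat_lp z m k \<le> (\<Sum>a<Suc s. z (Suc a, 0)) + lp (\<lambda>a b. z (Suc (a + s), Suc b)) (m - s) k"
            unfolding mk' by blast
          have sle: "s \<le> m" "Suc s \<le> m" "m - s + s = m" using s(1) mk' by auto
          have "gm m k - \<epsilon> * n < lp (\<lambda>a b. z (Suc (a + s), Suc b)) (m - s) k"
          proof (rule exit_near_corner[OF pos(3,1,2) n0 h(2-5) _ _ R_def \<delta>_def \<epsilon>1_def n(2,3) G s(2)])
            have "real (Suc s) * (1 / \<alpha>) = (s + 1) * (1 + sqrt (k / m))" unfolding ch(3) by simp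
            then show "(\<Sum>a<Suc s. z (Suc a, 0)) \<le> (real s + 1) * (1 + sqrt (k / m)) + \<epsilon>1 * n"
              using b1[OF sle(2)] by (simp add: add.commute del: sum.lessThan_Suc)
            show "lp (\<lambda>a b. z (Suc (a + s), Suc b)) (m - s) k \<le> gm (real m - real s) k + \<epsilon>1 * n"
              using c1[of s] sle by (simp add: of_nat_diff)
          qed (use n sle in auto)
          moreover have "lp (\<lambda>a b. z (Suc (a + s), Suc (b + 0))) (m - s) k \<le> lp (\<lambda>i j. z (Suc i, Suc j)) (m - s + s) (k + 0)"
            by (rule lp_shift_le[where m = m and k = k]) (use w sle in auto)
          ultimately show False using zL sle by simp
        next
          assume "\<exists>t\<le>k'. stat_lp z (Suc m') (Suc k') \<le> (\<Sum>b<Suc t. z (0, Suc b)) + lp (\<lambda>a b. z (Suc a, Suc (b + t))) (Suc m') (Suc k' - t)"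
          then obtain t where t: "t \<le> k'" "stat_lp z m k \<le> (\<Sum>b<Suc t. z (0, Suc b)) + lp (\<lambda>a b. z (Suc a, Suc (b + t))) m (k - t)"
            unfolding mk' by blast
          have tle: "t \<le> k" "Suc t \<le> k" "k - t + t = k" using t(1) mk' by auto
          \<comment> \<open>An exit from the vertical axis is the horizontal case with
            \<open>m\<close> and \<open>k\<close> exchanged.\<close>
          have "gm k m - \<epsilon> * n < lp (\<lambda>a b. z (Suc a, Suc (b + t))) m (k - t)"
          proof (rule exit_near_corner[OF pos(3,1,2) n0 h(4,5,2,3) _ _ R_def \<delta>_def \<epsilon>1_def n(2,3) _ t(2)])
            show "gm k m - 2 * \<epsilon>1 * n \<le> stat_lp z m k" using G by (simp add: gm_commute)
            have "real (Suc t) * (1 / (1 - \<alpha>)) = (t + 1) * (1 + sqrt (m / k))" unfolding ch(4) by simp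
            then show "(\<Sum>b<Suc t. z (0, Suc b)) \<le> (real t + 1) * (1 + sqrt (m / k)) + \<epsilon>1 * n"
              using b2[OF tle(2)] by (simp add: add.commute del: sum.lessThan_Suc)
            show "lp (\<lambda>a b. z (Suc a, Suc (b + t))) m (k - t) \<le> gm (real k - real t) m + \<epsilon>1 * n"
              using c2[of t] tle by (simp add: of_nat_diff gm_commute)
          qed (use n tle in auto)
          moreover have "lp (\<lambda>a b. z (Suc (a + 0), Suc (b + t))) m (k - t) \<le> lp (\<lambda>i j. z (Suc i, Suc j)) (m + 0) (k - t + t)"
            by (rule lp_shift_le[where m = m and k = k]) (use w tle in auto)
          ultimately show False using zL tle by (simp add: gm_commute)
        qed
      qed
    qed
    then have "measure ?P ?L \<le> measure ?P (A1 \<union> A2 \<union> ?U1 \<union> ?U2 \<union> ?U3 \<union> ?U4)"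
      by (rule P.finite_measure_mono_AE) (use sA sU in auto)
    also have "\<dots> \<le> measure ?P A1 + measure ?P A2 + measure ?P ?U1 + measure ?P ?U2 + measure ?P ?U3 + measure ?P ?U4"
      using sA sU by (intro order_trans[OF measure_Un_le] add_mono order_refl sets.Un)
    also have "\<dots> \<le> e + e + card {..m} * e + card {..k} * e + card {..m} * (2 * e) + card {..k} * (2 * e)"
      using pA pU by (intro add_mono)
    also have "\<dots> = (3 * real m + 3 * real k + 8) * e" by (simp add: algebra_simps)
    also have "\<dots> \<le> (6 * K * n + 8) * e"
      using h by (intro mult_right_mono) (auto simp: e_def)
    finally have "measure ?P ?L \<le> (6 * K * n + 8) * exp (- \<kappa> * n)" by (simp add: e_def)
    moreover have "measure ?P ?L = measure (iid_space m k) {z\<in>space (iid_space m k). lp (\<lambda>i j. z (i, j)) m k \<in> {..gm m k - \<epsilon> * n}}"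
      by (rule lp_law_stat_space) (use ch in auto)
    ultimately show "measure (iid_space m k) {z\<in>space (iid_space m k). lp (\<lambda>i j. z (i, j)) m k \<le> gm m k - \<epsilon> * real n}
        \<le> (6 * K * n + 8) * exp (- \<kappa> * n)"
      by simp
  qed
qed

section \<open>The almost sure law for all rectangles\<close>

text \<open>A bijection from the quadrant onto the lattice wedge with
  \<open>cell 0 0 = (0, 1)\<close>, the start of all paths. The steps \<open>(1, 0)\<close>,
  \<open>(-1, 1)\<close> and \<open>(0, 1)\<close> become right, up and diagonal, and the speed is
  evaluated at \<open>a - b\<close>.\<close>

definition cell :: "nat \<Rightarrow> nat \<Rightarrow> int \<times> int" where
  "cell a b = (int a - int b, int b + 1)"

lemma cell_eq_iff [simp]: "cell a b = cell a' b' \<longleftrightarrow> a = a' \<and> b = b'"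
  by (auto simp: cell_def)

lemma cell_in_wedge [simp]: "cell a b \<in> lattice_wedge"
  by (auto simp: cell_def lattice_wedge_def)

lemma law_of_box:
  fixes X :: "int \<times> int \<Rightarrow> 'a \<Rightarrow> real"
  assumes M: "prob_space M" and ind: "prob_space.indep_vars M (\<lambda>_. borel) X lattice_wedge"
    and dist: "\<And>p. p \<in> lattice_wedge \<Longrightarrow> distributed M lborel (X p) (exponential_density 1)"
    and mk: "m > 0" "k > 0" and B: "B \<in> sets borel"
  shows "measure M {\<omega>\<in>space M. lp (\<lambda>i j. X (cell (a + i) (b + j)) \<omega>) m k \<in> B}
    = measure (iid_space m k) {z\<in>space (iid_space m k). lp (\<lambda>i j. z (i, j)) m k \<in> B}"
proof -
  interpret prob_space M by fact
  define I where "I = {..<m} \<times> {..<k}"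
  define f where "f p = cell (a + fst p) (b + snd p)" for p :: "nat \<times> nat"
  define J where "J = f ` I"
  have inj: "inj_on f I" by (auto simp: f_def inj_on_def)
  have fJ: "f \<in> I \<rightarrow> J" by (auto simp: J_def)
  have JL: "J \<subseteq> lattice_wedge" by (auto simp: J_def f_def)
  have rv: "X p \<in> borel_measurable M" if "p \<in> J" for p
    using distributed_measurable[OF dist, of p] that JL by auto
  have "J \<noteq> {}" using mk by (auto simp: J_def I_def lessThan_empty_iff)
  have "distr M (PiM J (\<lambda>_. borel)) (\<lambda>\<omega>. \<lambda>p\<in>J. X p \<omega>) = PiM J (\<lambda>p. distr M borel (X p))"
    using indep_vars_iff_distr_eq_PiM'[OF \<open>J \<noteq> {}\<close>, of X "\<lambda>_. borel"] rv indep_vars_subset[OF ind JL] by simp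
  also have "\<dots> = PiM J (\<lambda>_. expm 1)"
  proof (rule PiM_cong)
    fix p assume p: "p \<in> J"
    have "distr M borel (X p) = distr M lborel (X p)" by (rule distr_cong) auto
    also have "\<dots> = expm 1" using distributed_distr_eq_density[OF dist, of p] p JL by auto
    finally show "distr M borel (X p) = expm 1" .
  qed simp
  finally have DJ: "distr M (PiM J (\<lambda>_. borel)) (\<lambda>\<omega>. \<lambda>p\<in>J. X p \<omega>) = PiM J (\<lambda>_. expm 1)" .
  have m1: "(\<lambda>\<omega>. \<lambda>p\<in>J. X p \<omega>) \<in> M \<rightarrow>\<^sub>M PiM J (\<lambda>_. borel)" using rv by measurable
  have m2: "(\<lambda>x. \<lambda>p\<in>I. x (f p)) \<in> PiM J (\<lambda>_. borel :: real measure) \<rightarrow>\<^sub>M PiM I (\<lambda>_. borel)"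
    using fJ by (intro measurable_restrict measurable_component_singleton) auto
  have "distr M (PiM I (\<lambda>_. borel)) (\<lambda>\<omega>. \<lambda>p\<in>I. X (f p) \<omega>)
    = distr M (PiM I (\<lambda>_. borel)) ((\<lambda>x. \<lambda>p\<in>I. x (f p)) \<circ> (\<lambda>\<omega>. \<lambda>p\<in>J. X p \<omega>))"
    using fJ by (intro distr_cong) (auto simp: restrict_def fun_eq_iff)
  also have "\<dots> = distr (distr M (PiM J (\<lambda>_. borel)) (\<lambda>\<omega>. \<lambda>p\<in>J. X p \<omega>)) (PiM I (\<lambda>_. borel)) (\<lambda>x. \<lambda>p\<in>I. x (f p))"
    by (rule distr_distr[OF m2 m1, symmetric])
  also have "\<dots> = distr (PiM J (\<lambda>_. expm 1)) (PiM I (\<lambda>_. borel)) (\<lambda>x. \<lambda>p\<in>I. x (f p))"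
    by (simp only: DJ)
  also have "\<dots> = distr (PiM J (\<lambda>_. expm 1)) (PiM I (\<lambda>_. expm 1)) (\<lambda>x. \<lambda>p\<in>I. x (f p))"
    by (rule distr_cong) (auto intro!: sets_PiM_cong)
  also have "\<dots> = PiM I (\<lambda>_. expm 1)"
    by (rule distr_PiM_reindex) (use inj fJ prob_space_exponential_density[of 1] in auto)
  finally have D: "distr M (PiM I (\<lambda>_. borel)) (\<lambda>\<omega>. \<lambda>p\<in>I. X (f p) \<omega>) = iid_space m k"
    by (simp add: iid_space_def I_def)
  have "X (f p) \<in> borel_measurable M" if "p \<in> I" for p by (rule rv) (use fJ that in blast)
  from lp_law[OF this[unfolded I_def] D[unfolded I_def] B] show ?thesis by (simp add: f_def)
qed

lemma summable_poly_exp: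
  fixes K \<kappa>1 \<kappa>2 :: real
  assumes "K > 0" "\<kappa>1 > 0" "\<kappa>2 > 0"
  shows "summable (\<lambda>n. (K * real n + 1) ^ 4 * (2 * exp (- \<kappa>1 * real n) + (6 * K * real n + 8) * exp (- \<kappa>2 * real n)))"
proof (rule summable_comparison_test_bigo)
  show "summable (\<lambda>n. norm (1 / real n ^ 2))"
    using inverse_power_summable[of 2, where 'a = real] by (simp add: inverse_eq_divide)
  have "(\<lambda>n. (K * real n + 1) ^ 4 * (2 * exp (- \<kappa>1 * real n))) \<in> O(\<lambda>n. 1 / real n ^ 2)"
    "(\<lambda>n. (K * real n + 1) ^ 4 * ((6 * K * real n + 8) * exp (- \<kappa>2 * real n))) \<in> O(\<lambda>n. 1 / real n ^ 2)"
    using assms by real_asymp+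
  then show "(\<lambda>n. (K * real n + 1) ^ 4 * (2 * exp (- \<kappa>1 * real n) + (6 * K * real n + 8) * exp (- \<kappa>2 * real n))) \<in> O(\<lambda>n. 1 / real n ^ 2)"
    unfolding distrib_left by (rule sum_in_bigo)
qed

text \<open>Together with the sign of the weights this is all that the deterministic part uses of
  the randomness. The lower bound is asked only for sides of at least \<open>\<epsilon> * n\<close>,
  where the aspect ratio is bounded and \<open>lp_lower_tail\<close> applies.\<close>

definition hydro_bounds :: "(nat \<Rightarrow> nat \<Rightarrow> real) \<Rightarrow> nat \<Rightarrow> nat \<Rightarrow> real \<Rightarrow> bool" where
  "hydro_bounds w n K \<epsilon> \<longleftrightarrow> (\<forall>a b m k. a \<le> K * n \<and> b \<le> K * n \<and> m \<le> K * n \<and> k \<le> K * n \<longrightarrow>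
     lp (\<lambda>i j. w (a + i) (b + j)) m k \<le> gm m k + \<epsilon> * n \<and>
     (\<epsilon> * n \<le> m \<and> \<epsilon> * n \<le> k \<longrightarrow> gm m k - \<epsilon> * n \<le> lp (\<lambda>i j. w (a + i) (b + j)) m k))"

lemma AE_hydro_bounds:
  fixes X :: "nat \<Rightarrow> int \<times> int \<Rightarrow> 'a \<Rightarrow> real"
  assumes M: "prob_space M" and ind: "\<And>n. prob_space.indep_vars M (\<lambda>_. borel) (X n) lattice_wedge"
    and dist: "\<And>n p. p \<in> lattice_wedge \<Longrightarrow> distributed M lborel (X n p) (exponential_density 1)"
    and K: "K > 0" and \<epsilon>: "\<epsilon> > 0"
  shows "AE \<omega> in M. \<forall>\<^sub>F n in sequentially. hydro_bounds (\<lambda>a b. X n (cell a b) \<omega>) n K \<epsilon>"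
proof -
  interpret prob_space M by fact
  have rK: "real K > 0" using K by simp
  obtain \<kappa>1 where k1: "\<kappa>1 > 0" and
    U: "\<And>n m k. \<lbrakk>n \<ge> 1; real m \<le> real K * n; real k \<le> real K * n\<rbrakk> \<Longrightarrow>
      measure (iid_space m k) {z\<in>space (iid_space m k). lp (\<lambda>i j. z (i, j)) m k \<ge> gm m k + \<epsilon> * real n} \<le> 2 * exp (- \<kappa>1 * n)"
  proof (rule lp_upper_tail[OF rK \<epsilon>], goal_cases)
    case (1 \<kappa>)
    show ?case by (rule 1(1)[OF 1(2) 1(3)])
  qed
  obtain \<kappa>2 N where k2: "\<kappa>2 > 0" and
    L: "\<And>n m k. \<lbrakk>n \<ge> N; \<epsilon> * n \<le> real m; real m \<le> real K * n; \<epsilon> * n \<le> real k; real k \<le> real K * n\<rbrakk> \<Longrightarrow>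
      measure (iid_space m k) {z\<in>space (iid_space m k). lp (\<lambda>i j. z (i, j)) m k \<le> gm m k - \<epsilon> * real n}
        \<le> (6 * real K * real n + 8) * exp (- \<kappa>2 * n)"
  proof (rule lp_lower_tail[OF rK \<epsilon> \<epsilon>], goal_cases)
    case (1 \<kappa> N)
    show ?case by (rule 1(1)[OF 1(2) 1(3)])
  qed
  define I where "I n = {..K * n} \<times> {..K * n} \<times> {..K * n} \<times> {..K * n}" for n
  let ?lp = "\<lambda>n a b m k \<omega>. lp (\<lambda>i j. X n (cell (a + i) (b + j)) \<omega>) m k"
  \<comment> \<open>Empty rectangles get no bad event: the bounds hold for them outright, and
    \<open>law_of_box\<close> speaks of nonempty ones.\<close>
  define B where "B n = (\<lambda>(a, b, m, k). if m = 0 \<or> k = 0 then {} else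
      {\<omega>\<in>space M. ?lp n a b m k \<omega> \<in> {gm m k + \<epsilon> * n ..}} \<union>
      (if \<epsilon> * n \<le> m \<and> \<epsilon> * n \<le> k then {\<omega>\<in>space M. ?lp n a b m k \<omega> \<in> {..gm m k - \<epsilon> * n}} else {}))" for n
  define c where "c n = 2 * exp (- \<kappa>1 * real n) + (6 * real K * real n + 8) * exp (- \<kappa>2 * real n)" for n :: nat
  have meas: "{\<omega>\<in>space M. ?lp n a b m k \<omega> \<in> C} \<in> sets M" if "C \<in> sets borel" for n a b m k C
  proof -
    have "?lp n a b m k \<in> borel_measurable M"
      using distributed_measurable[OF dist] by (intro lp_measurable) auto
    then show ?thesis using that by measurable
  qed
  have Bs: "B n i \<in> sets M" for n i
    unfolding B_def using meas[of "{t..}" for t] meas[of "{..t}" for t] by (auto split: prod.split intro!: sets.Un)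
  have Bm: "measure M (B n i) \<le> c n" if n: "n \<ge> max 1 N" and i: "i \<in> I n" for n i
  proof -
    obtain a b m k where abmk: "i = (a, b, m, k)" by (metis surj_pair)
    show ?thesis
    proof (cases "m = 0 \<or> k = 0")
      case True
      then show ?thesis by (simp add: B_def abmk c_def)
    next
      case False
      then have mk: "m > 0" "k > 0" by auto
      have le: "real m \<le> real K * n" "real k \<le> real K * n"
        using i by (auto simp: I_def abmk of_nat_mult[symmetric] simp del: of_nat_mult)
      let ?A1 = "{\<omega>\<in>space M. ?lp n a b m k \<omega> \<in> {gm m k + \<epsilon> * n ..}}"
      let ?A2 = "{\<omega>\<in>space M. ?lp n a b m k \<omega> \<in> {..gm m k - \<epsilon> * n}}"
      have 1: "measure M ?A1 \<le> 2 * exp (- \<kappa>1 * n)"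
        using U[of n m k] n le by (subst law_of_box[OF M ind dist mk]) auto
      have 2: "measure M ?A2 \<le> (6 * real K * n + 8) * exp (- \<kappa>2 * n)" if "\<epsilon> * n \<le> m" "\<epsilon> * n \<le> k"
        using L[of n m k] n le that by (subst law_of_box[OF M ind dist mk]) auto
      show ?thesis
      proof (cases "\<epsilon> * n \<le> m \<and> \<epsilon> * n \<le> k")
        case True
        then have "B n i = ?A1 \<union> ?A2" using mk by (simp add: B_def abmk)
        then have "measure M (B n i) \<le> measure M ?A1 + measure M ?A2"
          using measure_Un_le[OF meas meas, of "{gm m k + \<epsilon> * n ..}" "{..gm m k - \<epsilon> * n}"] by simp
        then show ?thesis using 1 2 True by (simp add: c_def)
      next
        case False
        then have eq: "B n i = ?A1" using mk by (auto simp: B_def abmk)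
        have "0 \<le> (6 * real K * n + 8) * exp (- \<kappa>2 * n)" by simp
        then show ?thesis using 1 unfolding c_def eq by linarith
      qed
    qed
  qed
  define A where "A n = (\<Union>i\<in>I n. B n i)" for n
  have finI: "finite (I n)" for n by (simp add: I_def)
  have As: "A n \<in> sets M" for n unfolding A_def using Bs finI by (intro sets.finite_UN) auto
  have Am: "measure M (A n) \<le> (real K * n + 1) ^ 4 * c n" if n: "n \<ge> max 1 N" for n
  proof -
    have "measure M (A n) \<le> card (I n) * c n"
      unfolding A_def by (rule measure_union_bound[OF finI Bs Bm[OF n] M])
    also have "real (card (I n)) = (real K * n + 1) ^ 4"
    proof -
      have "card (I n) = (K * n + 1) ^ 4" by (simp add: I_def power4_eq_xxxx)
      then show ?thesis by (simp only: of_nat_power of_nat_add of_nat_mult of_nat_1)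
    qed
    finally show ?thesis .
  qed
  have "summable (\<lambda>n. measure M (A n))"
  proof (rule summable_comparison_test_ev)
    show "\<forall>\<^sub>F n in sequentially. norm (measure M (A n)) \<le> (real K * n + 1) ^ 4 * c n"
      using Am by (intro eventually_sequentiallyI[of "max 1 N"]) simp
    show "summable (\<lambda>n. (real K * n + 1) ^ 4 * c n)"
      unfolding c_def by (rule summable_poly_exp[OF rK k1 k2])
  qed
  then have "AE \<omega> in M. eventually (\<lambda>n. \<omega> \<in> space M - A n) sequentially"
    by (intro borel_cantelli_AE1 As) (simp_all add: emeasure_eq_measure)
  then show ?thesis
  proof (rule AE_mp, intro AE_I2 impI)
    fix \<omega> assume \<omega>: "\<omega> \<in> space M"
    assume "eventually (\<lambda>n. \<omega> \<in> space M - A n) sequentially"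
    then show "\<forall>\<^sub>F n in sequentially. hydro_bounds (\<lambda>a b. X n (cell a b) \<omega>) n K \<epsilon>"
    proof (eventually_elim)
      case (elim n)
      show ?case unfolding hydro_bounds_def
      proof (intro allI impI)
        fix a b m k assume h: "a \<le> K * n \<and> b \<le> K * n \<and> m \<le> K * n \<and> k \<le> K * n"
        show "?lp n a b m k \<omega> \<le> gm m k + \<epsilon> * n \<and> (\<epsilon> * n \<le> m \<and> \<epsilon> * n \<le> k \<longrightarrow> gm m k - \<epsilon> * n \<le> ?lp n a b m k \<omega>)"
        proof (cases "m = 0 \<or> k = 0")
          case True
          then have "?lp n a b m k \<omega> = 0" by (cases m; cases k) auto
          moreover have "\<not> (\<epsilon> * n \<le> m \<and> \<epsilon> * n \<le> k) \<or> n = 0" using True \<epsilon>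
            by (auto simp: mult_le_0_iff)
          moreover have "0 \<le> \<epsilon> * n" using \<epsilon> by simp
          moreover have "n = 0 \<Longrightarrow> gm m k = 0" using h by (simp add: gm_def)
          ultimately show ?thesis using add_nonneg_nonneg[OF gm_nonneg[of m k] \<open>0 \<le> \<epsilon> * n\<close>] by auto
        next
          case False
          have "(a, b, m, k) \<in> I n" using h by (simp add: I_def)
          then have "\<omega> \<notin> B n (a, b, m, k)" using elim by (auto simp: A_def)
          then show ?thesis using False \<omega> by (auto simp: B_def split: if_splits)
        qed
      qed
    qed
  qed
qed

theorem uniform_hydrodynamics:
  fixes X :: "nat \<Rightarrow> int \<times> int \<Rightarrow> 'a \<Rightarrow> real"
  assumes M: "prob_space M" and ind: "\<And>n. prob_space.indep_vars M (\<lambda>_. borel) (X n) lattice_wedge"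
    and dist: "\<And>n p. p \<in> lattice_wedge \<Longrightarrow> distributed M lborel (X n p) (exponential_density 1)"
  shows "AE \<omega> in M. (\<forall>n a b. 0 \<le> X n (cell a b) \<omega>) \<and>
    (\<forall>K \<epsilon>. \<epsilon> > 0 \<longrightarrow> (\<forall>\<^sub>F n in sequentially. hydro_bounds (\<lambda>a b. X n (cell a b) \<omega>) n K \<epsilon>))"
proof -
  interpret prob_space M by fact
  have "AE \<omega> in M. 0 \<le> X n (cell a b) \<omega>" for n a b
  proof -
    have D: "distributed M lborel (X n (cell a b)) (exponential_density 1)" by (rule dist) simp
    have "AE x in distr M lborel (X n (cell a b)). 0 \<le> x"
      unfolding distributed_distr_eq_density[OF D]
      by (subst AE_density) (auto simp: exponential_density_def)
    then show ?thesis
      using distributed_measurable[OF D] by (subst (asm) AE_distr_iff) auto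
  qed
  then have "AE \<omega> in M. \<forall>n a b. 0 \<le> X n (cell a b) \<omega>"
    by (simp add: AE_all_countable)
  \<comment> \<open>Countably many pairs suffice, since \<open>hydro_bounds\<close> becomes weaker
    when \<open>K\<close> decreases or \<open>\<epsilon>\<close> increases.\<close>
  moreover have "AE \<omega> in M. \<forall>K j. \<forall>\<^sub>F n in sequentially. hydro_bounds (\<lambda>a b. X n (cell a b) \<omega>) n (Suc K) (1 / real (Suc j))"
    unfolding AE_all_countable by (intro allI AE_hydro_bounds[OF M ind dist]) auto
  ultimately show ?thesis
  proof eventually_elim
    case (elim \<omega>)
    have "\<forall>\<^sub>F n in sequentially. hydro_bounds (\<lambda>a b. X n (cell a b) \<omega>) n K \<epsilon>" if \<epsilon>: "\<epsilon> > 0" for K \<epsilon>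
    proof -
      obtain j where j: "1 / real (Suc j) < \<epsilon>"
        using \<epsilon> nat_approx_posE by blast
      have "\<forall>\<^sub>F n in sequentially. hydro_bounds (\<lambda>a b. X n (cell a b) \<omega>) n (Suc K) (1 / real (Suc j))"
        using elim by blast
      then show ?thesis
      proof eventually_elim
        case (elim n)
        have le: "1 / real (Suc j) * n \<le> \<epsilon> * n" using j by (intro mult_right_mono) auto
        show ?case unfolding hydro_bounds_def
        proof (intro allI impI)
          fix a b m k assume "a \<le> K * n \<and> b \<le> K * n \<and> m \<le> K * n \<and> k \<le> K * n"
          then have "a \<le> Suc K * n \<and> b \<le> Suc K * n \<and> m \<le> Suc K * n \<and> k \<le> Suc K * n" by auto
          then have "lp (\<lambda>i j. X n (cell (a + i) (b + j)) \<omega>) m k \<le> gm m k + 1 / real (Suc j) * n \<and>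
             (1 / real (Suc j) * n \<le> m \<and> 1 / real (Suc j) * n \<le> k \<longrightarrow> gm m k - 1 / real (Suc j) * n \<le> lp (\<lambda>i j. X n (cell (a + i) (b + j)) \<omega>) m k)"
            using elim unfolding hydro_bounds_def by blast
          then show "lp (\<lambda>i j. X n (cell (a + i) (b + j)) \<omega>) m k \<le> gm m k + \<epsilon> * n \<and>
             (\<epsilon> * n \<le> m \<and> \<epsilon> * n \<le> k \<longrightarrow> gm m k - \<epsilon> * n \<le> lp (\<lambda>i j. X n (cell (a + i) (b + j)) \<omega>) m k)"
            using le by linarith
        qed
      qed
    qed
    then show ?case using elim by blast
  qed
qed

section \<open>Chains and rectangles for a discontinuous speed\<close>

text \<open>The properties of a speed in epsilon form, stable under translation of the argument. The
  last clause is how \<open>c(x) = min(c(x-), c(x+))\<close> is used: on the side with the smaller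
  limit the speed is nearly bounded by its value at \<open>x\<close>.\<close>

definition regular_speed :: "(real \<Rightarrow> real) \<Rightarrow> bool" where
  "regular_speed f \<longleftrightarrow> (\<forall>x. 0 < f x) \<and>
     (\<forall>x a. a < f x \<longrightarrow> (\<exists>\<rho>>0. \<forall>y. \<bar>y - x\<bar> < \<rho> \<longrightarrow> a < f y)) \<and>
     (\<forall>x e. 0 < e \<longrightarrow> (\<exists>\<rho>>0. (\<forall>y z. x < y \<and> y < x + \<rho> \<and> x < z \<and> z < x + \<rho> \<longrightarrow> \<bar>f y - f z\<bar> \<le> e) \<and>
        (\<forall>y z. x - \<rho> < y \<and> y < x \<and> x - \<rho> < z \<and> z < x \<longrightarrow> \<bar>f y - f z\<bar> \<le> e))) \<and>
     (\<forall>x e. 0 < e \<longrightarrow> (\<exists>\<rho>>0. (\<forall>y. x < y \<and> y < x + \<rho> \<longrightarrow> f y \<le> f x + e) \<or>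
        (\<forall>y. x - \<rho> < y \<and> y < x \<longrightarrow> f y \<le> f x + e)))"

lemma regular_speed_pos: "regular_speed f \<Longrightarrow> 0 < f x"
  by (drule regular_speed_def[THEN iffD1], drule conjunct1, erule spec)

lemma regular_speed_lsc:
  "regular_speed f \<Longrightarrow> a < f x \<Longrightarrow> \<exists>\<rho>>0. \<forall>y. \<bar>y - x\<bar> < \<rho> \<longrightarrow> a < f y"
  by (drule regular_speed_def[THEN iffD1], drule conjunct2, drule conjunct1, blast)

lemma regular_speed_sides:
  "regular_speed f \<Longrightarrow> 0 < e \<Longrightarrow> \<exists>\<rho>>0. (\<forall>y z. x < y \<and> y < x + \<rho> \<and> x < z \<and> z < x + \<rho> \<longrightarrow> \<bar>f y - f z\<bar> \<le> e) \<and>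
        (\<forall>y z. x - \<rho> < y \<and> y < x \<and> x - \<rho> < z \<and> z < x \<longrightarrow> \<bar>f y - f z\<bar> \<le> e)"
  by (drule regular_speed_def[THEN iffD1], drule conjunct2, drule conjunct2, drule conjunct1, blast)

lemma regular_speed_good_side:
  "regular_speed f \<Longrightarrow> 0 < e \<Longrightarrow> \<exists>\<rho>>0. (\<forall>y. x < y \<and> y < x + \<rho> \<longrightarrow> f y \<le> f x + e) \<or>
        (\<forall>y. x - \<rho> < y \<and> y < x \<longrightarrow> f y \<le> f x + e)"
  by (drule regular_speed_def[THEN iffD1], drule conjunct2, drule conjunct2, drule conjunct2, blast)

lemma at_right_limitD:
  fixes c :: "real \<Rightarrow> real"
  assumes "(c \<longlongrightarrow> r) (at_right x)" "0 < e"
  shows "\<exists>\<rho>>0. \<forall>y. x < y \<and> y < x + \<rho> \<longrightarrow> \<bar>c y - r\<bar> < e"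
proof -
  have "\<forall>\<^sub>F y in at_right x. dist (c y) r < e" using assms by (rule tendstoD)
  then obtain b where "b > x" "\<forall>y>x. y < b \<longrightarrow> dist (c y) r < e"
    by (auto simp: eventually_at_right_field)
  then show ?thesis by (intro exI[of _ "b - x"]) (auto simp: dist_real_def)
qed

lemma at_left_limitD:
  fixes c :: "real \<Rightarrow> real"
  assumes "(c \<longlongrightarrow> r) (at_left x)" "0 < e"
  shows "\<exists>\<rho>>0. \<forall>y. x - \<rho> < y \<and> y < x \<longrightarrow> \<bar>c y - r\<bar> < e"
proof -
  have "\<forall>\<^sub>F y in at_left x. dist (c y) r < e" using assms by (rule tendstoD)
  then obtain b where "b < x" "\<forall>y>b. y < x \<longrightarrow> dist (c y) r < e"
    by (auto simp: eventually_at_left_field)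
  then show ?thesis by (intro exI[of _ "x - b"]) (auto simp: dist_real_def)
qed

lemma regular_speed_of_speed_function:
  assumes c: "speed_function c"
  shows "regular_speed c"
  unfolding regular_speed_def
proof (intro conjI allI impI)
  show "0 < c x" for x using c unfolding speed_function_def by blast
next
  fix x a assume "a < c x"
  then have "\<forall>\<^sub>F y in at x. a < c y" using c by (auto simp: speed_function_def lsc_at_def)
  then obtain d where "d > 0" "\<forall>y. y \<noteq> x \<and> dist y x < d \<longrightarrow> a < c y"
    by (auto simp: eventually_at)
  then have "a < c y" if "\<bar>y - x\<bar> < d" for y
    using \<open>a < c x\<close> that by (cases "y = x") (auto simp: dist_real_def)
  then show "\<exists>\<rho>>0. \<forall>y. \<bar>y - x\<bar> < \<rho> \<longrightarrow> a < c y"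
    using \<open>d > 0\<close> by blast
next
  fix x e :: real assume e: "0 < e"
  obtain l r where lr: "(c \<longlongrightarrow> l) (at_left x)" "(c \<longlongrightarrow> r) (at_right x)"
    using c unfolding speed_function_def by blast
  obtain \<rho>1 where 1: "\<rho>1 > 0" "\<And>y. x < y \<Longrightarrow> y < x + \<rho>1 \<Longrightarrow> \<bar>c y - r\<bar> < e / 2"
    using at_right_limitD[OF lr(2), of "e / 2"] e by auto
  obtain \<rho>2 where 2: "\<rho>2 > 0" "\<And>y. x - \<rho>2 < y \<Longrightarrow> y < x \<Longrightarrow> \<bar>c y - l\<bar> < e / 2"
    using at_left_limitD[OF lr(1), of "e / 2"] e by auto
  show "\<exists>\<rho>>0. (\<forall>y z. x < y \<and> y < x + \<rho> \<and> x < z \<and> z < x + \<rho> \<longrightarrow> \<bar>c y - c z\<bar> \<le> e) \<and>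
        (\<forall>y z. x - \<rho> < y \<and> y < x \<and> x - \<rho> < z \<and> z < x \<longrightarrow> \<bar>c y - c z\<bar> \<le> e)"
  proof (intro exI[of _ "min \<rho>1 \<rho>2"] conjI allI impI)
    fix y z assume h: "x < y \<and> y < x + min \<rho>1 \<rho>2 \<and> x < z \<and> z < x + min \<rho>1 \<rho>2"
    have "\<bar>c y - r\<bar> < e / 2" "\<bar>c z - r\<bar> < e / 2" by (rule 1(2); use h in linarith)+
    then show "\<bar>c y - c z\<bar> \<le> e" by linarith
  next
    fix y z assume h: "x - min \<rho>1 \<rho>2 < y \<and> y < x \<and> x - min \<rho>1 \<rho>2 < z \<and> z < x"
    have "x - \<rho>2 < y" "x - \<rho>2 < z" using h by linarith+
    have "\<bar>c y - l\<bar> < e / 2" "\<bar>c z - l\<bar> < e / 2" by (rule 2(2); use h \<open>x - \<rho>2 < y\<close> \<open>x - \<rho>2 < z\<close> in linarith)+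
    then show "\<bar>c y - c z\<bar> \<le> e" by linarith
  qed (use 1 2 in auto)
next
  fix x e :: real assume e: "0 < e"
  obtain l r where lr: "(c \<longlongrightarrow> l) (at_left x)" "(c \<longlongrightarrow> r) (at_right x)"
    using c unfolding speed_function_def by blast
  have "Lim (at_left x) c = l" "Lim (at_right x) c = r"
    using lr by (auto intro: tendsto_Lim)
  then have cx: "c x = min l r" using c unfolding speed_function_def by metis
  obtain \<rho>1 where 1: "\<rho>1 > 0" "\<And>y. x < y \<Longrightarrow> y < x + \<rho>1 \<Longrightarrow> \<bar>c y - r\<bar> < e"
    using at_right_limitD[OF lr(2) e] by auto
  obtain \<rho>2 where 2: "\<rho>2 > 0" "\<And>y. x - \<rho>2 < y \<Longrightarrow> y < x \<Longrightarrow> \<bar>c y - l\<bar> < e"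
    using at_left_limitD[OF lr(1) e] by auto
  show "\<exists>\<rho>>0. (\<forall>y. x < y \<and> y < x + \<rho> \<longrightarrow> c y \<le> c x + e) \<or>
        (\<forall>y. x - \<rho> < y \<and> y < x \<longrightarrow> c y \<le> c x + e)"
  proof (cases "r \<le> l")
    case True
    then have "c x = r" using cx by simp
    have "c y \<le> c x + e" if "x < y" "y < x + \<rho>1" for y
      using 1(2)[of y] that \<open>c x = r\<close> by linarith
    then show ?thesis using 1(1) by blast
  next
    case False
    then have "c x = l" using cx by simp
    have "c y \<le> c x + e" if "x - \<rho>2 < y" "y < x" for y
      using 2(2)[of y] that \<open>c x = l\<close> by linarith
    then show ?thesis using 2(1) by blast
  qed
qed

lemma regular_speed_shift:
  assumes "regular_speed c"
  shows "regular_speed (\<lambda>x. c (x - q))"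
  unfolding regular_speed_def
proof (intro conjI allI impI)
  show "0 < c (x - q)" for x by (rule regular_speed_pos[OF assms])
next
  fix x a assume "a < c (x - q)"
  then obtain \<rho> where r: "\<rho> > 0" "\<And>y. \<bar>y - (x - q)\<bar> < \<rho> \<Longrightarrow> a < c y"
    using regular_speed_lsc[OF assms] by blast
  have "a < c (y - q)" if "\<bar>y - x\<bar> < \<rho>" for y using r(2)[of "y - q"] that by simp
  then show "\<exists>\<rho>>0. \<forall>y. \<bar>y - x\<bar> < \<rho> \<longrightarrow> a < c (y - q)" using r(1) by blast
next
  fix x e :: real assume "0 < e"
  then obtain \<rho> where r: "\<rho> > 0" "\<And>y z. x - q < y \<and> y < x - q + \<rho> \<and> x - q < z \<and> z < x - q + \<rho> \<Longrightarrow> \<bar>c y - c z\<bar> \<le> e"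
    "\<And>y z. x - q - \<rho> < y \<and> y < x - q \<and> x - q - \<rho> < z \<and> z < x - q \<Longrightarrow> \<bar>c y - c z\<bar> \<le> e"
    using regular_speed_sides[OF assms, of e "x - q"] by blast
  show "\<exists>\<rho>>0. (\<forall>y z. x < y \<and> y < x + \<rho> \<and> x < z \<and> z < x + \<rho> \<longrightarrow> \<bar>c (y - q) - c (z - q)\<bar> \<le> e) \<and>
        (\<forall>y z. x - \<rho> < y \<and> y < x \<and> x - \<rho> < z \<and> z < x \<longrightarrow> \<bar>c (y - q) - c (z - q)\<bar> \<le> e)"
    by (intro exI[of _ \<rho>] conjI allI impI r) auto
next
  fix x e :: real assume "0 < e"
  then obtain \<rho> where r: "\<rho> > 0" "(\<forall>y. x - q < y \<and> y < x - q + \<rho> \<longrightarrow> c y \<le> c (x - q) + e) \<or>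
        (\<forall>y. x - q - \<rho> < y \<and> y < x - q \<longrightarrow> c y \<le> c (x - q) + e)"
    using regular_speed_good_side[OF assms, of e "x - q"] by blast
  from r(2) show "\<exists>\<rho>>0. (\<forall>y. x < y \<and> y < x + \<rho> \<longrightarrow> c (y - q) \<le> c (x - q) + e) \<or>
        (\<forall>y. x - \<rho> < y \<and> y < x \<longrightarrow> c (y - q) \<le> c (x - q) + e)"
  proof
    assume h: "\<forall>y. x - q < y \<and> y < x - q + \<rho> \<longrightarrow> c y \<le> c (x - q) + e"
    have "c (y - q) \<le> c (x - q) + e" if "x < y" "y < x + \<rho>" for y using h that by simp
    then show ?thesis using r(1) by blast
  next
    assume h: "\<forall>y. x - q - \<rho> < y \<and> y < x - q \<longrightarrow> c y \<le> c (x - q) + e"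
    have "c (y - q) \<le> c (x - q) + e" if "x - \<rho> < y" "y < x" for y using h that by simp
    then show ?thesis using r(1) by blast
  qed
qed

lemma compact_interval_subcover:
  fixes r :: "real \<Rightarrow> real"
  assumes "\<And>x. r x > 0"
  obtains C where "finite C" "{lo..hi} \<subseteq> (\<Union>x\<in>C. {x - r x<..<x + r x})"
proof (rule compactE_image[of "{lo..hi}" "{lo..hi}" "\<lambda>x. {x - r x<..<x + r x}"])
  show "{lo..hi} \<subseteq> (\<Union>x\<in>{lo..hi}. {x - r x<..<x + r x})" using assms by force
qed (use that in auto)

lemma locally_bounded_imp_bounded:
  fixes g :: "real \<Rightarrow> real"
  assumes "\<And>x. \<exists>\<rho>>0. \<exists>B. \<forall>y. \<bar>y - x\<bar> < \<rho> \<longrightarrow> g y \<le> B"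
  shows "\<exists>B. \<forall>y\<in>{lo..hi}. g y \<le> B"
proof -
  obtain r B where rB: "\<And>x. r x > 0" "\<And>x y. \<bar>y - x\<bar> < r x \<Longrightarrow> g y \<le> B x"
    using assms by metis
  obtain C where C: "finite C" "{lo..hi} \<subseteq> (\<Union>x\<in>C. {x - r x<..<x + r x})"
    using compact_interval_subcover[of r lo hi] rB(1) by blast
  show ?thesis
  proof (intro exI ballI)
    fix y assume "y \<in> {lo..hi}"
    then obtain x where x: "x \<in> C" "\<bar>y - x\<bar> < r x" using C(2) by (force simp: abs_less_iff)
    have "g y \<le> B x" using rB(2) x by blast
    also have "\<dots> \<le> Max (B ` C)" using C x by simp
    finally show "g y \<le> Max (B ` C)" .
  qed
qed

lemma regular_speed_bounds:
  assumes f: "regular_speed f"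
  obtains fm fM where "0 < fm" "\<And>x. lo \<le> x \<Longrightarrow> x \<le> hi \<Longrightarrow> fm \<le> f x \<and> f x \<le> fM"
proof -
  have "\<exists>\<rho>>0. \<exists>B. \<forall>y. \<bar>y - x\<bar> < \<rho> \<longrightarrow> f y \<le> B" for x
  proof -
    obtain \<rho> where r: "\<rho> > 0" "\<And>y z. x < y \<and> y < x + \<rho> \<and> x < z \<and> z < x + \<rho> \<Longrightarrow> \<bar>f y - f z\<bar> \<le> 1"
      "\<And>y z. x - \<rho> < y \<and> y < x \<and> x - \<rho> < z \<and> z < x \<Longrightarrow> \<bar>f y - f z\<bar> \<le> 1"
      using regular_speed_sides[OF f zero_less_one, of x] by blast
    have "f y \<le> max (f x) (max (f (x + \<rho> / 2)) (f (x - \<rho> / 2)) + 1)" if "\<bar>y - x\<bar> < \<rho>" for y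
    proof -
      consider "y = x" | "x < y" | "y < x" by linarith
      then show ?thesis
      proof cases
        case 2
        then have "\<bar>f y - f (x + \<rho> / 2)\<bar> \<le> 1" using r(1) that by (intro r(2)) auto
        then show ?thesis by linarith
      next
        case 3
        then have "\<bar>f y - f (x - \<rho> / 2)\<bar> \<le> 1" using r(1) that by (intro r(3)) auto
        then show ?thesis by linarith
      qed auto
    qed
    then show ?thesis using r(1) by blast
  qed
  then obtain fM where fM: "\<And>y. y \<in> {lo..hi} \<Longrightarrow> f y \<le> fM"
    using locally_bounded_imp_bounded[of f lo hi] by blast
  \<comment> \<open>A positive lower bound for \<open>f\<close> is an upper bound for
    \<open>1 / f\<close>, so the same compactness argument applies; locally it is lower
    semicontinuity.\<close>
  have "\<exists>\<rho>>0. \<exists>B. \<forall>y. \<bar>y - x\<bar> < \<rho> \<longrightarrow> 1 / f y \<le> B" for x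
  proof -
    have "f x / 2 < f x" using regular_speed_pos[OF f] by simp
    then obtain \<rho> where r: "\<rho> > 0" "\<And>y. \<bar>y - x\<bar> < \<rho> \<Longrightarrow> f x / 2 < f y"
      using regular_speed_lsc[OF f] by blast
    have "1 / f y \<le> 2 / f x" if "\<bar>y - x\<bar> < \<rho>" for y
      using r(2)[OF that] regular_speed_pos[OF f, of x] regular_speed_pos[OF f, of y] by (simp add: field_simps)
    then show ?thesis using r(1) by blast
  qed
  then obtain B where B: "\<And>y. y \<in> {lo..hi} \<Longrightarrow> 1 / f y \<le> B"
    using locally_bounded_imp_bounded[of "\<lambda>y. 1 / f y" lo hi] by blast
  have "1 / (\<bar>B\<bar> + 1) \<le> f y" if "y \<in> {lo..hi}" for y
  proof -
    have p: "f y > 0" by (rule regular_speed_pos[OF f])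
    have "1 / f y \<le> \<bar>B\<bar> + 1" using B[OF that] by linarith
    then show ?thesis using p by (simp add: field_simps)
  qed
  moreover have "1 / (\<bar>B\<bar> + 1) > 0" by simp
  ultimately show ?thesis using that[of "1 / (\<bar>B\<bar> + 1)" fM] fM by auto
qed

text \<open>\<open>D\<close> consists of the centres and the end points of a finite cover by
  intervals on whose two halves \<open>f\<close> oscillates little. An interval that avoids
  \<open>D\<close> lies in one covering interval and on one side of its centre.\<close>

lemma regular_speed_partition:
  assumes f: "regular_speed f" and e: "0 < e"
  obtains D where "finite D"
    "\<And>s t x y. \<lbrakk>lo \<le> s; s \<le> t; t \<le> hi; {s..t} \<inter> D = {}; x \<in> {s..t}; y \<in> {s..t}\<rbrakk> \<Longrightarrow> \<bar>f x - f y\<bar> \<le> e"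
proof -
  have "\<forall>x. \<exists>\<rho>>0. (\<forall>y z. x < y \<and> y < x + \<rho> \<and> x < z \<and> z < x + \<rho> \<longrightarrow> \<bar>f y - f z\<bar> \<le> e) \<and>
        (\<forall>y z. x - \<rho> < y \<and> y < x \<and> x - \<rho> < z \<and> z < x \<longrightarrow> \<bar>f y - f z\<bar> \<le> e)"
    using regular_speed_sides[OF f e] by blast
  then obtain r where r: "\<And>x. r x > 0"
    "\<And>x y z. x < y \<and> y < x + r x \<and> x < z \<and> z < x + r x \<Longrightarrow> \<bar>f y - f z\<bar> \<le> e"
    "\<And>x y z. x - r x < y \<and> y < x \<and> x - r x < z \<and> z < x \<Longrightarrow> \<bar>f y - f z\<bar> \<le> e"
    by metis
  obtain C where C: "finite C" "{lo..hi} \<subseteq> (\<Union>x\<in>C. {x - r x<..<x + r x})"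
    using compact_interval_subcover[of r lo hi] r(1) by blast
  define D where "D = C \<union> (\<lambda>x. x + r x) ` C \<union> (\<lambda>x. x - r x) ` C"
  show ?thesis
  proof (rule that[of D])
    show "finite D" using C by (simp add: D_def)
  next
    fix s t x y assume h: "lo \<le> s" "s \<le> t" "t \<le> hi" "{s..t} \<inter> D = {}" "x \<in> {s..t}" "y \<in> {s..t}"
    have "s \<in> {lo..hi}" using h by simp
    then obtain a where a: "a \<in> C" "a - r a < s" "s < a + r a" using C(2) by fastforce
    have "a \<in> D" "a + r a \<in> D" using a by (auto simp: D_def)
    then have "a \<notin> {s..t}" "a + r a \<notin> {s..t}" using h by auto
    then have 1: "t < a + r a" and 2: "t < a \<or> a < s" using a by auto
    show "\<bar>f x - f y\<bar> \<le> e"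
    proof (cases "a < s")
      case True
      then show ?thesis using h 1 by (intro r(2)[of a]) auto
    next
      case False
      then show ?thesis using h a 2 by (intro r(3)[of a]) auto
    qed
  qed
qed

lemma finite_common_scale:
  fixes Q :: "'b \<Rightarrow> real \<Rightarrow> bool"
  assumes "finite D" "\<And>d. d \<in> D \<Longrightarrow> \<exists>\<rho>>0. Q d \<rho>" "\<And>d \<rho> \<rho>'. \<lbrakk>Q d \<rho>; 0 < \<rho>'; \<rho>' \<le> \<rho>\<rbrakk> \<Longrightarrow> Q d \<rho>'"
  shows "\<exists>\<rho>>0. \<forall>d\<in>D. Q d \<rho>"
  using assms(1,2)
proof (induction rule: finite_induct)
  case empty
  then show ?case by (intro exI[of _ 1]) auto
next
  case (insert d D)
  then obtain \<rho>1 \<rho>2 where 1: "\<rho>1 > 0" "\<forall>d\<in>D. Q d \<rho>1" and 2: "\<rho>2 > 0" "Q d \<rho>2" by (metis insertCI)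
  then have "Q d' (min \<rho>1 \<rho>2)" if "d' \<in> insert d D" for d'
    using that assms(3)[of d' _ "min \<rho>1 \<rho>2"] by auto
  then show ?case using 1 2 by (intro exI[of _ "min \<rho>1 \<rho>2"]) auto
qed

text \<open>The radius \<open>2 * \<rho>\<close> leaves room for a window around any point within
  \<open>\<rho>\<close> of \<open>d\<close>. The separation \<open>4 * \<rho>\<close> forces a chain
  to travel a distance comparable to \<open>\<rho>\<close> between the neighbourhoods of two points
  of \<open>D\<close>.\<close>

lemma regular_speed_scale:
  assumes f: "regular_speed f" and e: "0 < e" and D: "finite D" and \<rho>0: "0 < \<rho>0"
  obtains \<rho> where "0 < \<rho>" "\<rho> \<le> \<rho>0"
    "\<And>d x. d \<in> D \<Longrightarrow> \<bar>x - d\<bar> \<le> 2 * \<rho> \<Longrightarrow> f d - e \<le> f x"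
    "\<And>d. d \<in> D \<Longrightarrow> (\<forall>y. d < y \<and> y \<le> d + \<rho> \<longrightarrow> f y \<le> f d + e) \<or> (\<forall>y. d - \<rho> \<le> y \<and> y < d \<longrightarrow> f y \<le> f d + e)"
    "\<And>d d'. d \<in> D \<Longrightarrow> d' \<in> D \<Longrightarrow> d \<noteq> d' \<Longrightarrow> 4 * \<rho> \<le> \<bar>d - d'\<bar>"
proof -
  \<comment> \<open>The point 0 is inserted only to have a witness for
    \<open>\<rho> \<le> \<rho>0\<close> when \<open>D\<close> is empty.\<close>
  have "\<exists>\<rho>>0. \<forall>d\<in>insert 0 D. (\<forall>x. \<bar>x - d\<bar> \<le> 2 * \<rho> \<longrightarrow> f d - e \<le> f x) \<and>
      ((\<forall>y. d < y \<and> y \<le> d + \<rho> \<longrightarrow> f y \<le> f d + e) \<or> (\<forall>y. d - \<rho> \<le> y \<and> y < d \<longrightarrow> f y \<le> f d + e)) \<and>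
      (\<forall>d'\<in>D. d \<noteq> d' \<longrightarrow> 4 * \<rho> \<le> \<bar>d - d'\<bar>) \<and> \<rho> \<le> \<rho>0"
  proof (rule finite_common_scale[OF finite.insertI[OF D]], goal_cases)
    case (1 d)
    obtain \<rho>1 where 1: "\<rho>1 > 0" "\<And>y. \<bar>y - d\<bar> < \<rho>1 \<Longrightarrow> f d - e < f y"
      using regular_speed_lsc[OF f, of "f d - e" d] e by auto
    have "\<exists>\<rho>>0. (\<forall>y. d < y \<and> y < d + \<rho> \<longrightarrow> f y \<le> f d + e) \<or> (\<forall>y. d - \<rho> < y \<and> y < d \<longrightarrow> f y \<le> f d + e)"
      by (rule regular_speed_good_side[OF f e])
    then obtain \<rho>2 where 2: "\<rho>2 > 0" "(\<forall>y. d < y \<and> y < d + \<rho>2 \<longrightarrow> f y \<le> f d + e) \<or> (\<forall>y. d - \<rho>2 < y \<and> y < d \<longrightarrow> f y \<le> f d + e)"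
      by blast
    obtain \<rho>3 where 3: "\<rho>3 > 0" "\<forall>x\<in>D. x \<noteq> d \<longrightarrow> \<rho>3 \<le> dist d x"
      using finite_set_avoid[OF D, of d] by blast
    define \<rho> where "\<rho> = min \<rho>0 (min (\<rho>1 / 3) (min (\<rho>2 / 2) (\<rho>3 / 4)))"
    have \<rho>: "0 < \<rho>" "\<rho> \<le> \<rho>0" "2 * \<rho> < \<rho>1" "\<rho> < \<rho>2" "4 * \<rho> \<le> \<rho>3"
      using \<rho>0 1(1) 2(1) 3(1) unfolding \<rho>_def by linarith+
    have "f d - e \<le> f x" if "\<bar>x - d\<bar> \<le> 2 * \<rho>" for x using 1(2)[of x] that \<rho> by linarith
    moreover have "(\<forall>y. d < y \<and> y \<le> d + \<rho> \<longrightarrow> f y \<le> f d + e) \<or> (\<forall>y. d - \<rho> \<le> y \<and> y < d \<longrightarrow> f y \<le> f d + e)"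
      using 2(2)
    proof
      assume h: "\<forall>y. d < y \<and> y < d + \<rho>2 \<longrightarrow> f y \<le> f d + e"
      have "f y \<le> f d + e" if "d < y" "y \<le> d + \<rho>" for y using h that \<rho>(4) by auto
      then show ?thesis by blast
    next
      assume h: "\<forall>y. d - \<rho>2 < y \<and> y < d \<longrightarrow> f y \<le> f d + e"
      have "f y \<le> f d + e" if "d - \<rho> \<le> y" "y < d" for y using h that \<rho>(4) by auto
      then show ?thesis by blast
    qed
    moreover have "4 * \<rho> \<le> \<bar>d - d'\<bar>" if "d' \<in> D" "d \<noteq> d'" for d'
      using 3(2) that \<rho>(5) by (force simp: dist_real_def)
    ultimately show ?case using \<rho>(1,2) by blast
  next
    case (2 d \<rho> \<rho>')
    note h = 2
    show ?case
    proof (intro conjI ballI impI allI)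
      show "f d - e \<le> f x" if "\<bar>x - d\<bar> \<le> 2 * \<rho>'" for x using h that by auto
      show "4 * \<rho>' \<le> \<bar>d - d'\<bar>" if "d' \<in> D" "d \<noteq> d'" for d' using h that by force
      show "\<rho>' \<le> \<rho>0" using h by auto
      have "(\<forall>y. d < y \<and> y \<le> d + \<rho> \<longrightarrow> f y \<le> f d + e) \<or> (\<forall>y. d - \<rho> \<le> y \<and> y < d \<longrightarrow> f y \<le> f d + e)"
        using h by blast
      then show "(\<forall>y. d < y \<and> y \<le> d + \<rho>' \<longrightarrow> f y \<le> f d + e) \<or> (\<forall>y. d - \<rho>' \<le> y \<and> y < d \<longrightarrow> f y \<le> f d + e)"
      proof (elim disjE)
        assume a: "\<forall>y. d < y \<and> y \<le> d + \<rho> \<longrightarrow> f y \<le> f d + e"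
        have "f y \<le> f d + e" if "d < y" "y \<le> d + \<rho>'" for y
          using a[rule_format, of y] that h(3) by simp
        then show ?thesis by blast
      next
        assume a: "\<forall>y. d - \<rho> \<le> y \<and> y < d \<longrightarrow> f y \<le> f d + e"
        have "f y \<le> f d + e" if "d - \<rho>' \<le> y" "y < d" for y
          using a[rule_format, of y] that h(3) by simp
        then show ?thesis by blast
      qed
    qed
  qed
  then obtain \<rho> where r: "0 < \<rho>" and R: "\<forall>d\<in>insert 0 D. (\<forall>x. \<bar>x - d\<bar> \<le> 2 * \<rho> \<longrightarrow> f d - e \<le> f x) \<and>
      ((\<forall>y. d < y \<and> y \<le> d + \<rho> \<longrightarrow> f y \<le> f d + e) \<or> (\<forall>y. d - \<rho> \<le> y \<and> y < d \<longrightarrow> f y \<le> f d + e)) \<and>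
      (\<forall>d'\<in>D. d \<noteq> d' \<longrightarrow> 4 * \<rho> \<le> \<bar>d - d'\<bar>) \<and> \<rho> \<le> \<rho>0"
    by (elim exE conjE)
  show ?thesis
  proof (rule that[of \<rho>])
    show "0 < \<rho>" by fact
    show "\<rho> \<le> \<rho>0" using R[THEN bspec, of 0] by simp
    show "f d - e \<le> f x" if "d \<in> D" "\<bar>x - d\<bar> \<le> 2 * \<rho>" for d x using R[THEN bspec, of d] that by simp
    show "(\<forall>y. d < y \<and> y \<le> d + \<rho> \<longrightarrow> f y \<le> f d + e) \<or> (\<forall>y. d - \<rho> \<le> y \<and> y < d \<longrightarrow> f y \<le> f d + e)" if "d \<in> D" for d
      by (rule R[THEN bspec, OF insertI2[OF that], THEN conjunct2, THEN conjunct1])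
    show "4 * \<rho> \<le> \<bar>d - d'\<bar>" if "d \<in> D" "d' \<in> D" "d \<noteq> d'" for d d' using R[THEN bspec, of d] that by simp
  qed
qed

section \<open>Chain sums, and the values that chains of rectangles certify\<close>

definition window_inf :: "(real \<Rightarrow> real) \<Rightarrow> real \<Rightarrow> real \<Rightarrow> real" where
  "window_inf f \<delta> x = Inf (f ` {x - \<delta>..x + \<delta>})"

lemma window_inf_le:
  assumes "regular_speed f" "\<bar>y - x\<bar> \<le> \<delta>"
  shows "window_inf f \<delta> x \<le> f y"
  unfolding window_inf_def
proof (rule cInf_lower)
  show "f y \<in> f ` {x - \<delta>..x + \<delta>}" using assms(2) by (auto simp: abs_le_iff)
  show "bdd_below (f ` {x - \<delta>..x + \<delta>})"
    using regular_speed_pos[OF assms(1)] by (intro bdd_belowI[of _ 0]) (auto intro: less_imp_le)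
qed

lemma window_inf_ge:
  assumes "\<delta> \<ge> 0" "\<And>y. \<bar>y - x\<bar> \<le> \<delta> \<Longrightarrow> B \<le> f y"
  shows "B \<le> window_inf f \<delta> x"
  unfolding window_inf_def
  by (rule cInf_greatest) (use assms in \<open>auto simp: abs_le_iff\<close>)

text \<open>Values reachable by chains of rectangles; the slack \<open>\<eta>\<close> absorbs lattice roundings.\<close>
inductive attains :: "(real \<Rightarrow> real) \<Rightarrow> real \<times> real \<Rightarrow> real \<times> real \<Rightarrow> real \<Rightarrow> bool" for f where
  step: "\<lbrakk>u < u'; v < v'; 0 < \<eta>; 0 < C; \<And>x. u - v' - \<eta> \<le> x \<Longrightarrow> x \<le> u' - v + \<eta> \<Longrightarrow> f x \<le> C\<rbrakk>
    \<Longrightarrow> attains f (u, v) (u', v') (gm (u' - u) (v' - v) / C)"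
| join: "attains f p p' r \<Longrightarrow> attains f p' p'' r' \<Longrightarrow> attains f p p'' (r + r')"

text \<open>Steps of \<open>attains\<close> are strict in both coordinates, so it has no empty
  chain. Stretches of a chain between two exceptional points can be empty, hence this
  closure.\<close>

definition attains0 :: "(real \<Rightarrow> real) \<Rightarrow> real \<times> real \<Rightarrow> real \<times> real \<Rightarrow> real \<Rightarrow> bool" where
  "attains0 f p p' r \<longleftrightarrow> p = p' \<and> r = 0 \<or> attains f p p' r"

lemma attains0_join: "attains0 f p p' r \<Longrightarrow> attains0 f p' p'' r' \<Longrightarrow> attains0 f p p'' (r + r')"
  unfolding attains0_def by (auto intro: attains.join)

lemma attains0_refl: "attains0 f p p 0"
  by (simp add: attains0_def)

lemma attains_imp_attains0: "attains f p p' r \<Longrightarrow> attains0 f p p' r"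
  by (simp add: attains0_def)

lemma gm_diag: "0 \<le> h \<Longrightarrow> gm h h = 4 * h"
  by (simp add: gm_def power2_eq_square algebra_simps)

text \<open>Along the diagonal \<open>gm\<close> is additive, so cutting the run into small squares
  loses nothing, while it confines the rectangles to a thin strip around the line on which the speed
  is evaluated.\<close>

lemma attains_diagonal:
  assumes h: "0 < h" and C: "0 < C" and \<eta>: "0 < \<eta>"
    and f: "\<And>x. \<bar>x - (u - v)\<bar> \<le> \<eta> \<Longrightarrow> f x \<le> C"
  shows "attains f (u, v) (u + h, v + h) (4 * h / C)"
proof -
  obtain M :: nat where M: "2 * h / \<eta> < real M" using reals_Archimedean2 by blast
  have "0 < 2 * h / \<eta>" using h \<eta> by simp
  then have Mp: "0 < real M" using M by linarith
  define s where "s = h / M"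
  have s: "0 < s" "s \<le> \<eta> / 2" using h Mp M \<eta> by (auto simp: s_def field_simps)
  have one: "attains f (a, b) (a + s, b + s) (4 * s / C)" if "a - b = u - v" for a b
  proof -
    have "attains f (a, b) (a + s, b + s) (gm (a + s - a) (b + s - b) / C)"
    proof (rule attains.step[where \<eta> = "\<eta> / 2"])
      fix x assume "a - (b + s) - \<eta> / 2 \<le> x" "x \<le> a + s - b + \<eta> / 2"
      then have "\<bar>x - (u - v)\<bar> \<le> \<eta>" using s that by linarith
      then show "f x \<le> C" by (rule f)
    qed (use s C \<eta> in auto)
    then show ?thesis using s gm_diag[of s] by simp
  qed
  have "attains f (u, v) (u + real (Suc k) * s, v + real (Suc k) * s) (real (Suc k) * (4 * s / C))" for k
  proof (induction k)
    case 0
    then show ?case using one[of u v] by simp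
  next
    case (Suc k)
    have "attains f (u + real (Suc k) * s, v + real (Suc k) * s) (u + real (Suc k) * s + s, v + real (Suc k) * s + s) (4 * s / C)"
      by (rule one) simp
    from attains.join[OF Suc this]
    have "attains f (u, v) (u + real (Suc k) * s + s, v + real (Suc k) * s + s) (real (Suc k) * (4 * s / C) + 4 * s / C)" .
    moreover have "real (Suc (Suc k)) * t = real (Suc k) * t + t" for t by (simp add: distrib_right)
    ultimately show ?case by (simp only: add.assoc)
  qed
  from this[of "M - 1"] Mp have "attains f (u, v) (u + real M * s, v + real M * s) (real M * (4 * s / C))" by simp
  moreover have "real M * s = h" "real M * (4 * s / C) = 4 * h / C" using Mp by (auto simp: s_def)
  ultimately show ?thesis by (simp only:)
qed

lemma speed_ratio_bound:
  fixes B fm \<epsilon> g :: real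
  assumes "fm \<le> B" "0 < fm" "0 < \<epsilon>" "\<epsilon> \<le> fm / 2" "0 \<le> g"
  shows "g / (B - \<epsilon>) \<le> g / (B + \<epsilon>) + 4 * \<epsilon> * g / fm\<^sup>2"
proof -
  have p: "B - \<epsilon> \<ge> fm / 2" "B + \<epsilon> \<ge> fm" using assms by linarith+
  have "g / (B - \<epsilon>) - g / (B + \<epsilon>) = g * (2 * \<epsilon>) / ((B - \<epsilon>) * (B + \<epsilon>))"
    using p assms by (subst diff_frac_eq) (auto simp: algebra_simps)
  also have "\<dots> \<le> g * (2 * \<epsilon>) / (fm / 2 * fm)"
    using p assms by (intro divide_left_mono mult_mono mult_pos_pos mult_nonneg_nonneg) auto
  also have "\<dots> = 4 * \<epsilon> * g / fm\<^sup>2" by (simp add: power2_eq_square)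
  finally show ?thesis by linarith
qed

text \<open>The order of the end points is part of the conclusion because superadditivity needs
  nonnegative total increments in the induction; it is also quoted later to keep chains inside their
  box.\<close>

lemma sum_gm_le:
  fixes u v :: "nat \<Rightarrow> real"
  assumes "a \<le> b" "\<And>k. a \<le> k \<Longrightarrow> k < b \<Longrightarrow> u k \<le> u (Suc k)" "\<And>k. a \<le> k \<Longrightarrow> k < b \<Longrightarrow> v k \<le> v (Suc k)"
  shows "(\<Sum>k=a..<b. gm (u (Suc k) - u k) (v (Suc k) - v k)) \<le> gm (u b - u a) (v b - v a) \<and> u a \<le> u b \<and> v a \<le> v b"
  using assms
proof (induction b rule: dec_induct)
  case base
  then show ?case by simp
next
  case (step n)
  then have IH: "(\<Sum>k=a..<n. gm (u (Suc k) - u k) (v (Suc k) - v k)) \<le> gm (u n - u a) (v n - v a)" "u a \<le> u n" "v a \<le> v n"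
    by auto
  have m: "u n \<le> u (Suc n)" "v n \<le> v (Suc n)" using step by auto
  have "gm (u n - u a) (v n - v a) + gm (u (Suc n) - u n) (v (Suc n) - v n) \<le> gm (u n - u a + (u (Suc n) - u n)) (v n - v a + (v (Suc n) - v n))"
    by (rule gm_superadd) (use IH m in auto)
  then show ?case using IH(1) order_trans[OF IH(2) m(1)] order_trans[OF IH(3) m(2)] step(1) by simp
qed

text \<open>Three scales: \<open>\<epsilon>\<close> is the tolerance in the speed, which holds off
  the finite set \<open>D\<close>; \<open>\<rho>\<close> separates the points of \<open>D\<close>;
  the mesh \<open>\<delta>\<close> is so much smaller than \<open>\<rho>\<close> that detours of
  length \<open>20 * \<delta>\<close> stay harmless. Strict steps are assumed because
  \<open>attains\<close> needs nondegenerate rectangles.\<close>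

locale chain_setup =
  fixes f :: "real \<Rightarrow> real" and U V fm fM \<epsilon> \<rho> \<delta> :: real and D :: "real set" and u v :: "nat \<Rightarrow> real" and K :: nat
  assumes f: "regular_speed f"
    and UV: "0 < U" "0 < V"
    and fm: "0 < fm" "\<And>x. - V - 1 \<le> x \<Longrightarrow> x \<le> U + 1 \<Longrightarrow> fm \<le> f x \<and> f x \<le> fM"
    and \<epsilon>: "0 < \<epsilon>" "\<epsilon> \<le> fm / 2"
    and D: "finite D" "\<And>s t x y. \<lbrakk>- V - 1 \<le> s; s \<le> t; t \<le> U + 1; {s..t} \<inter> D = {}; x \<in> {s..t}; y \<in> {s..t}\<rbrakk> \<Longrightarrow> \<bar>f x - f y\<bar> \<le> \<epsilon>"
    and \<rho>: "0 < \<rho>" "\<rho> \<le> 1"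
      "\<And>d x. d \<in> D \<Longrightarrow> \<bar>x - d\<bar> \<le> 2 * \<rho> \<Longrightarrow> f d - \<epsilon> \<le> f x"
      "\<And>d. d \<in> D \<Longrightarrow> (\<forall>y. d < y \<and> y \<le> d + \<rho> \<longrightarrow> f y \<le> f d + \<epsilon>) \<or> (\<forall>y. d - \<rho> \<le> y \<and> y < d \<longrightarrow> f y \<le> f d + \<epsilon>)"
      "\<And>d d'. d \<in> D \<Longrightarrow> d' \<in> D \<Longrightarrow> d \<noteq> d' \<Longrightarrow> 4 * \<rho> \<le> \<bar>d - d'\<bar>"
    and \<delta>: "0 < \<delta>" "80 * \<delta> \<le> \<rho>"
    and uv0: "u 0 = 0" "v 0 = 0" "u K = U" "v K = V"
    and strict: "\<And>k. k < K \<Longrightarrow> u k < u (Suc k)" "\<And>k. k < K \<Longrightarrow> v k < v (Suc k)"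
    and mesh: "\<And>k. k < K \<Longrightarrow> u (Suc k) - u k + (v (Suc k) - v k) \<le> \<delta>"
begin

definition "pt k = (u k, v k)"
definition "xx k = u k - v k"
definition "val k = gm (u (Suc k) - u k) (v (Suc k) - v k) / window_inf f \<delta> (xx k)"
definition "rem k = (U - u k) + (V - v k)"
text \<open>The rate at which errors in the speed are charged to the distance \<open>rem\<close>
  still to travel, so that they telescope. A step away from \<open>D\<close> needs half of it, since
  \<open>gm\<close> is at most twice the length; a nearly diagonal stretch of height
  \<open>dv\<close> has main value \<open>4 * dv\<close> and needs all of it.\<close>

definition "c1 = 16 * \<epsilon> / fm\<^sup>2"

lemma mono: "a \<le> b \<Longrightarrow> b \<le> K \<Longrightarrow> u a \<le> u b \<and> v a \<le> v b"
  using sum_gm_le[of a b u v] strict by (simp add: less_imp_le)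

lemma in_box: "k \<le> K \<Longrightarrow> 0 \<le> u k \<and> u k \<le> U \<and> 0 \<le> v k \<and> v k \<le> V"
  using mono[of 0 k] mono[of k K] uv0 by simp

lemma xx_in: "k \<le> K \<Longrightarrow> - V \<le> xx k \<and> xx k \<le> U"
  using in_box[of k] by (simp add: xx_def)

lemma small: "\<delta> \<le> 1 / 80"
  using \<delta> \<rho> by linarith

lemma c1_nonneg: "0 \<le> c1"
  using \<epsilon> by (simp add: c1_def)

lemma rem_antimono: "a \<le> b \<Longrightarrow> b \<le> K \<Longrightarrow> rem b \<le> rem a"
  using mono[of a b] by (simp add: rem_def)

lemma rem_xx: "a \<le> b \<Longrightarrow> b \<le> K \<Longrightarrow> \<bar>xx b - xx a\<bar> \<le> rem a - rem b"
  using mono[of a b] by (simp add: rem_def xx_def abs_le_iff)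

lemma window_ge_fm: "k \<le> K \<Longrightarrow> fm \<le> window_inf f \<delta> (xx k)"
  using xx_in[of k] small \<delta> by (intro window_inf_ge) (auto simp: abs_le_iff intro!: fm(2)[THEN conjunct1])

lemma fMpos: "0 < fM"
  using fm(1) fm(2)[of 0] UV by simp

text \<open>A connecting piece, of which only the sign of the value is used. The bound
  \<open>fM\<close> covers the box with a margin of one, half of which is spent on the rectangle and
  half on the slack.\<close>

lemma crude_step:
  assumes "a < a'" "b < b'" "- V - 1 / 2 \<le> a - b'" "a' - b \<le> U + 1 / 2"
  shows "\<exists>R\<ge>0. attains f (a, b) (a', b') R"
proof (intro exI conjI)
  show "attains f (a, b) (a', b') (gm (a' - a) (b' - b) / fM)"
    by (rule attains.step[where \<eta> = "1 / 2"]) (use assms fMpos fm(2) in auto)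
  show "0 \<le> gm (a' - a) (b' - b) / fM" using fMpos by simp
qed

lemma val_le: "k < K \<Longrightarrow> val k \<le> 2 * \<delta> / fm"
proof -
  assume k: "k < K"
  have "gm (u (Suc k) - u k) (v (Suc k) - v k) \<le> 2 * (u (Suc k) - u k + (v (Suc k) - v k))"
    by (rule gm_le) (use strict k in \<open>auto intro: less_imp_le\<close>)
  also have "\<dots> \<le> 2 * \<delta>" using mesh[OF k] by simp
  finally show ?thesis unfolding val_def
    using window_ge_fm[of k] k fm(1) \<delta> by (intro frac_le) auto
qed

lemma near_step:
  assumes k: "k < K"
  shows "\<exists>R. attains0 f (pt k) (pt (Suc k)) R \<and> val k \<le> R + 2 * \<delta> / fm"
proof -
  obtain R where "R \<ge> 0" "attains f (u k, v k) (u (Suc k), v (Suc k)) R"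
    using crude_step[of "u k" "u (Suc k)" "v k" "v (Suc k)"] strict[OF k] in_box[of k] in_box[of "Suc k"] k by auto
  then show ?thesis using val_le[OF k] unfolding pt_def by (intro exI[of _ R]) (auto simp: attains0_def)
qed

text \<open>No exceptional point lies within \<open>4 * \<delta>\<close>, so the speed is constant
  there up to \<open>\<epsilon>\<close>. Both the infimum in \<open>val\<close> and the upper bound
  on the rectangle, including its slack, are then within \<open>\<epsilon>\<close> of
  \<open>f (xx k)\<close>.\<close>

lemma far_step:
  assumes k: "k < K" and far: "\<And>d. d \<in> D \<Longrightarrow> \<bar>xx k - d\<bar> > 4 * \<delta>"
  shows "\<exists>R. attains0 f (pt k) (pt (Suc k)) R \<and> val k \<le> R + c1 * (rem k - rem (Suc k))"
proof -
  define B where "B = f (xx k)"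
  define g where "g = gm (u (Suc k) - u k) (v (Suc k) - v k)"
  have x: "- V \<le> xx k" "xx k \<le> U" using xx_in[of k] k by auto
  have osc: "\<bar>f y - B\<bar> \<le> \<epsilon>" if "\<bar>y - xx k\<bar> \<le> 4 * \<delta>" for y
    unfolding B_def
  proof (rule D(2)[of "xx k - 4 * \<delta>" "xx k + 4 * \<delta>"])
    show "{xx k - 4 * \<delta>..xx k + 4 * \<delta>} \<inter> D = {}" using far by (force simp: abs_less_iff)
  qed (use x small \<delta> that in auto)
  have B: "fm \<le> B" using fm(2)[of "xx k"] x by (simp add: B_def)
  have st: "u k < u (Suc k)" "v k < v (Suc k)" and ms: "u (Suc k) - u k + (v (Suc k) - v k) \<le> \<delta>"
    using strict mesh k by auto
  have g: "0 \<le> g" "g \<le> 2 * (rem k - rem (Suc k))"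
    using gm_le[of "u (Suc k) - u k" "v (Suc k) - v k"] st by (auto simp: g_def rem_def)
  have "attains f (u k, v k) (u (Suc k), v (Suc k)) (g / (B + \<epsilon>))"
    unfolding g_def
  proof (rule attains.step[where \<eta> = \<delta>])
    fix y assume "u k - v (Suc k) - \<delta> \<le> y" "y \<le> u (Suc k) - v k + \<delta>"
    then have "\<bar>y - xx k\<bar> \<le> 4 * \<delta>" using st ms \<delta> unfolding xx_def by linarith
    then show "f y \<le> B + \<epsilon>" using osc[of y] by linarith
  qed (use st \<delta> B \<epsilon> fm in auto)
  moreover have "val k \<le> g / (B + \<epsilon>) + c1 * (rem k - rem (Suc k))"
  proof -
    have "B - \<epsilon> \<le> window_inf f \<delta> (xx k)"
    proof (rule window_inf_ge)
      show "B - \<epsilon> \<le> f y" if "\<bar>y - xx k\<bar> \<le> \<delta>" for y using osc[of y] that \<delta> by linarith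
    qed (use \<delta> in simp)
    then have "val k \<le> g / (B - \<epsilon>)" unfolding val_def g_def[symmetric]
      using g B \<epsilon> fm(1) by (intro divide_left_mono mult_pos_pos) auto
    also have "\<dots> \<le> g / (B + \<epsilon>) + 4 * \<epsilon> * g / fm\<^sup>2"
      by (rule speed_ratio_bound) (use B fm \<epsilon> g in auto)
    also have "4 * \<epsilon> * g / fm\<^sup>2 \<le> 4 * \<epsilon> * (2 * (rem k - rem (Suc k))) / fm\<^sup>2"
      using g \<epsilon> by (intro divide_right_mono mult_left_mono) auto
    also have "\<dots> \<le> c1 * (rem k - rem (Suc k))"
    proof -
      have "c1 * (rem k - rem (Suc k)) = 4 * \<epsilon> * (2 * (rem k - rem (Suc k))) / fm\<^sup>2 + 4 * \<epsilon> * (2 * (rem k - rem (Suc k))) / fm\<^sup>2"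
        by (simp add: c1_def add_divide_distrib[symmetric] algebra_simps)
      moreover have "0 \<le> 4 * \<epsilon> * (2 * (rem k - rem (Suc k))) / fm\<^sup>2" using g \<epsilon> by simp
      ultimately show ?thesis by linarith
    qed
    finally show ?thesis by simp
  qed
  ultimately show ?thesis unfolding pt_def by (auto simp: attains0_def)
qed

lemma free_run:
  assumes "a \<le> b" "b \<le> K" and far: "\<And>k d. a \<le> k \<Longrightarrow> k < b \<Longrightarrow> d \<in> D \<Longrightarrow> \<bar>xx k - d\<bar> > 4 * \<delta>"
  shows "\<exists>R. attains0 f (pt a) (pt b) R \<and> (\<Sum>k=a..<b. val k) \<le> R + c1 * (rem a - rem b)"
  using assms
proof (induction b rule: dec_induct)
  case base
  show ?case by (intro exI[of _ 0]) (simp add: attains0_refl)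
next
  case (step n)
  then obtain R where R: "attains0 f (pt a) (pt n) R" "(\<Sum>k=a..<n. val k) \<le> R + c1 * (rem a - rem n)" by auto
  obtain R' where R': "attains0 f (pt n) (pt (Suc n)) R'" "val n \<le> R' + c1 * (rem n - rem (Suc n))"
    using far_step[of n] step by auto
  show ?case
  proof (intro exI conjI)
    show "attains0 f (pt a) (pt (Suc n)) (R + R')" by (rule attains0_join[OF R(1) R'(1)])
    have "c1 * (rem a - rem (Suc n)) = c1 * (rem a - rem n) + c1 * (rem n - rem (Suc n))" by (simp add: algebra_simps)
    then show "(\<Sum>k=a..<Suc n. val k) \<le> R + R' + c1 * (rem a - rem (Suc n))"
      using R(2) R'(2) step by simp
  qed
qed

text \<open>While the chain stays close to a discontinuity \<open>d\<close>, superadditivity of \<open>gm\<close> lets the whole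
  stretch be replaced by a diagonal run on the side of \<open>d\<close> where the speed is near \<open>f d\<close>.\<close>
lemma gap:
  assumes kk: "k < k'" "k' \<le> K" and d: "d \<in> D" "\<bar>xx k - d\<bar> \<le> 4 * \<delta>" "\<bar>xx k' - d\<bar> \<le> 4 * \<delta>"
    and close: "\<And>j. k \<le> j \<Longrightarrow> j < k' \<Longrightarrow> \<bar>xx j - d\<bar> \<le> \<rho>"
  shows "\<exists>R. attains0 f (pt k) (pt k') R \<and> (\<Sum>j=k..<k'. val j) \<le> R + c1 * (rem k - rem k') + 400 * \<delta> / fm"
proof -
  define B where "B = f d"
  define du where "du = u k' - u k"
  define dv where "dv = v k' - v k"
  have xk: "- V \<le> xx k" "xx k \<le> U" "- V \<le> xx k'" "xx k' \<le> U" using xx_in[of k] xx_in[of k'] kk by auto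
  have B: "fm \<le> B" using fm(2)[of d] xk d small by (simp add: B_def abs_le_iff)
  have win: "B - \<epsilon> \<le> window_inf f \<delta> (xx j)" if "k \<le> j" "j < k'" for j
  proof (rule window_inf_ge)
    fix y assume "\<bar>y - xx j\<bar> \<le> \<delta>"
    then have "\<bar>y - d\<bar> \<le> 2 * \<rho>" using close[OF that] \<delta> by linarith
    then show "B - \<epsilon> \<le> f y" unfolding B_def by (rule \<rho>(3)[OF d(1)])
  qed (use \<delta> in simp)
  have Bp: "B - \<epsilon> \<ge> fm / 2" "B + \<epsilon> \<ge> fm" using B \<epsilon> by linarith+
  have "(\<Sum>j=k..<k'. val j) \<le> (\<Sum>j=k..<k'. gm (u (Suc j) - u j) (v (Suc j) - v j) / (B - \<epsilon>))"
    unfolding val_def using win Bp fm(1) by (intro sum_mono divide_left_mono mult_pos_pos) (auto intro: less_le_trans[of 0 "B - \<epsilon>"])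
  also have "\<dots> = (\<Sum>j=k..<k'. gm (u (Suc j) - u j) (v (Suc j) - v j)) / (B - \<epsilon>)"
    by (simp add: sum_divide_distrib)
  also have "\<dots> \<le> gm du dv / (B - \<epsilon>)"
  proof (rule divide_right_mono)
    have "u j \<le> u (Suc j)" "v j \<le> v (Suc j)" if "j < k'" for j
      using strict[of j] that kk by (auto intro: less_imp_le)
    then show "(\<Sum>j=k..<k'. gm (u (Suc j) - u j) (v (Suc j) - v j)) \<le> gm du dv"
      unfolding du_def dv_def using sum_gm_le[of k k' u v] kk by auto
  qed (use Bp fm(1) in simp)
  finally have S: "(\<Sum>j=k..<k'. val j) \<le> gm du dv / (B - \<epsilon>)" .
  have st: "0 < du" "0 < dv"
    using strict[of k] mono[of "Suc k" k'] kk by (auto simp: du_def dv_def)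
  \<comment> \<open>Both ends are close to the line over \<open>d\<close>, so the stretch as a whole
    is nearly diagonal and its merged value is close to \<open>4 * dv\<close>, whatever the chain
    does in between.\<close>
  have duv: "\<bar>du - dv\<bar> \<le> 8 * \<delta>" using d unfolding du_def dv_def xx_def by linarith
  have g: "gm du dv \<le> 4 * dv + 16 * \<delta>"
  proof -
    have "gm du dv \<le> gm (dv + 8 * \<delta>) dv" by (rule gm_mono) (use st duv in auto)
    also have "\<dots> = dv + 8 * \<delta> + dv + 2 * sqrt ((dv + 8 * \<delta>) * dv)"
      using st \<delta> by (simp add: gm_expand)
    also have "sqrt ((dv + 8 * \<delta>) * dv) \<le> dv + 4 * \<delta>"
      using st \<delta> by (intro real_le_lsqrt) (auto simp: power2_eq_square algebra_simps)
    finally show ?thesis by simp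
  qed
  have dvrem: "dv \<le> rem k - rem k'" using st by (simp add: dv_def du_def rem_def)
  show ?thesis
  \<comment> \<open>A short stretch has a value of order \<open>\<delta> / fm\<close> and is merely
    connected; a long one has room for two legs of height \<open>20 * \<delta>\<close> with a
    diagonal run between them. Either way the loss is at most \<open>400 * \<delta> / fm\<close>,
    apart from the error in the speed.\<close>
  proof (cases "dv \<le> 41 * \<delta>")
    case True
    have "gm du dv / (B - \<epsilon>) \<le> (180 * \<delta>) / (fm / 2)"
      using g True Bp fm(1) \<delta> by (intro frac_le) auto
    also have "\<dots> \<le> 400 * \<delta> / fm" using \<delta> fm(1) by (simp add: divide_right_mono)
    finally have S': "(\<Sum>j=k..<k'. val j) \<le> 400 * \<delta> / fm" using S by linarith
    obtain R where R: "R \<ge> 0" "attains f (u k, v k) (u k', v k') R"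
      using crude_step[of "u k" "u k'" "v k" "v k'"] st in_box[of k] in_box[of k'] kk by (auto simp: du_def dv_def)
    have "0 \<le> c1 * (rem k - rem k')" using c1_nonneg rem_antimono[of k k'] kk by simp
    then show ?thesis using R S' unfolding pt_def by (intro exI[of _ R]) (auto simp: attains0_def)
  next
    case False
    \<comment> \<open>The sign \<open>\<sigma>\<close> selects the good side of \<open>d\<close>. A
      line at distance \<open>6 * \<delta>\<close> with a margin of \<open>\<delta>\<close> stays
      strictly on that side and within \<open>\<rho>\<close> of \<open>d\<close>.\<close>
    obtain \<sigma> :: real where \<sigma>: "\<sigma> = 1 \<or> \<sigma> = -1"
      "\<And>y. \<bar>y - (d + 6 * \<sigma> * \<delta>)\<bar> \<le> \<delta> \<Longrightarrow> f y \<le> B + \<epsilon>"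
    proof -
      from \<rho>(4)[OF d(1)] show ?thesis
      proof
        assume a: "\<forall>y. d < y \<and> y \<le> d + \<rho> \<longrightarrow> f y \<le> f d + \<epsilon>"
        show ?thesis
        proof (rule that[of 1])
          fix y assume "\<bar>y - (d + 6 * 1 * \<delta>)\<bar> \<le> \<delta>"
          then have "d < y \<and> y \<le> d + \<rho>" using \<delta> by linarith
          then show "f y \<le> B + \<epsilon>" using a by (simp add: B_def)
        qed simp
      next
        assume a: "\<forall>y. d - \<rho> \<le> y \<and> y < d \<longrightarrow> f y \<le> f d + \<epsilon>"
        show ?thesis
        proof (rule that[of "-1"])
          fix y assume "\<bar>y - (d + 6 * -1 * \<delta>)\<bar> \<le> \<delta>"
          then have "d - \<rho> \<le> y \<and> y < d" using \<delta> by linarith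
          then show "f y \<le> B + \<epsilon>" using a by (simp add: B_def)
        qed simp
      qed
    qed
    define xL where "xL = d + 6 * \<sigma> * \<delta>"
    have xL: "\<bar>xL - d\<bar> \<le> 6 * \<delta>" using \<sigma>(1) \<delta> by (auto simp: xL_def)
    \<comment> \<open>The legs lead to the parallel line and back. Ends and line differ by at most
      \<open>10 * \<delta>\<close> in the coordinate \<open>u - v\<close>, so a leg of height
      \<open>20 * \<delta>\<close> also increases strictly in \<open>u\<close>.\<close>
    define v1 where "v1 = v k + 20 * \<delta>"
    define h where "h = dv - 40 * \<delta>"
    have h: "0 < h" using False \<delta> by (simp add: h_def)
    have hb: "v1 + h + 20 * \<delta> = v k'" by (simp add: v1_def h_def dv_def)
    note b = in_box[of k] in_box[of k']
    obtain R1 where R1: "R1 \<ge> 0" "attains f (u k, v k) (v1 + xL, v1) R1"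
    proof -
      have "u k < v1 + xL" using xL d(2) \<delta> unfolding v1_def xx_def by linarith
      moreover have "v k < v1" using \<delta> by (simp add: v1_def)
      moreover have "- V - 1 / 2 \<le> u k - v1" using xk(1) small unfolding v1_def xx_def by linarith
      moreover have "v1 + xL - v k \<le> U + 1 / 2" using xL d(2) xk(2) small unfolding v1_def by linarith
      ultimately show ?thesis using that crude_step by blast
    qed
    obtain R3 where R3: "R3 \<ge> 0" "attains f (v1 + xL + h, v1 + h) (u k', v k') R3"
    proof -
      have "v1 + xL + h < u k'" using xL d(3) \<delta> hb unfolding xx_def by linarith
      moreover have "v1 + h < v k'" using \<delta> hb by linarith
      moreover have "- V - 1 / 2 \<le> v1 + xL + h - v k'" using xL d(3) xk(3) small hb by linarith
      moreover have "u k' - (v1 + h) \<le> U + 1 / 2" using xk(4) small hb unfolding xx_def by linarith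
      ultimately show ?thesis using that crude_step by blast
    qed
    have R2: "attains f (v1 + xL, v1) (v1 + xL + h, v1 + h) (4 * h / (B + \<epsilon>))"
      by (rule attains_diagonal[where \<eta> = \<delta>]) (use h Bp fm(1) \<delta> \<sigma>(2) in \<open>auto simp: xL_def\<close>)
    have A: "attains f (pt k) (pt k') (R1 + 4 * h / (B + \<epsilon>) + R3)"
      unfolding pt_def by (rule attains.join[OF attains.join[OF R1(2) R2] R3(2)])
    have "(\<Sum>j=k..<k'. val j) \<le> (4 * dv + 16 * \<delta>) / (B - \<epsilon>)"
      using S g Bp fm(1) by (meson divide_right_mono half_gt_zero less_imp_le order_trans)
    also have "\<dots> = 4 * dv / (B - \<epsilon>) + 16 * \<delta> / (B - \<epsilon>)" by (simp add: add_divide_distrib)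
    also have "\<dots> \<le> (4 * dv / (B + \<epsilon>) + 4 * \<epsilon> * (4 * dv) / fm\<^sup>2) + 16 * \<delta> / (fm / 2)"
      using B fm(1) \<epsilon> st Bp \<delta> by (intro add_mono speed_ratio_bound divide_left_mono mult_pos_pos) auto
    also have "4 * dv / (B + \<epsilon>) = 4 * h / (B + \<epsilon>) + 160 * \<delta> / (B + \<epsilon>)"
      by (simp add: h_def add_divide_distrib[symmetric])
    finally have 1: "(\<Sum>j=k..<k'. val j) \<le> 4 * h / (B + \<epsilon>) + 160 * \<delta> / (B + \<epsilon>) + 4 * \<epsilon> * (4 * dv) / fm\<^sup>2 + 32 * \<delta> / fm"
      by simp
    have 2: "160 * \<delta> / (B + \<epsilon>) \<le> 160 * \<delta> / fm"
      using Bp fm(1) \<delta> by (intro divide_left_mono mult_pos_pos) auto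
    have 3: "4 * \<epsilon> * (4 * dv) / fm\<^sup>2 \<le> c1 * (rem k - rem k')"
    proof -
      have "4 * \<epsilon> * (4 * dv) / fm\<^sup>2 = c1 * dv" by (simp add: c1_def)
      also have "\<dots> \<le> c1 * (rem k - rem k')" using dvrem c1_nonneg by (rule mult_left_mono)
      finally show ?thesis .
    qed
    have 4: "160 * \<delta> / fm + 32 * \<delta> / fm \<le> 400 * \<delta> / fm"
      unfolding add_divide_distrib[symmetric] using \<delta> fm(1) by (intro divide_right_mono) auto
    have "(\<Sum>j=k..<k'. val j) \<le> (R1 + 4 * h / (B + \<epsilon>) + R3) + c1 * (rem k - rem k') + 400 * \<delta> / fm"
      using 1 2 3 4 R1(1) R3(1) by linarith
    then show ?thesis using A attains_imp_attains0 by blast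
  qed
qed

text \<open>After a gap the chain must move by at least \<open>\<rho> / 2\<close> before the next one starts, so that
  there are at most \<open>1 + 2 * rem / \<rho>\<close> gaps.\<close>
lemma chain_bound:
  assumes "k \<le> K"
  shows "\<exists>R. attains0 f (pt k) (pt K) R \<and>
    (\<Sum>j=k..<K. val j) \<le> R + c1 * rem k + 500 * \<delta> / fm * (1 + 2 * rem k / \<rho>)"
  using assms
proof (induction "K - k" arbitrary: k rule: less_induct)
  case less
  define E where "E = 500 * \<delta> / fm"
  have E: "0 \<le> E" "400 * \<delta> / fm + 2 * \<delta> / fm \<le> E"
    using \<delta> fm(1) unfolding E_def add_divide_distrib[symmetric] by (auto intro!: divide_right_mono)
  have remn: "0 \<le> rem j" if "j \<le> K" for j using in_box[OF that] by (simp add: rem_def)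
  have split: "(\<Sum>j=a..<b. val j) + (\<Sum>j=b..<c. val j) = (\<Sum>j=a..<c. val j)" if "a \<le> b" "b \<le> c" for a b c
    using that by (rule sum.atLeastLessThan_concat)
  show ?case
  proof (cases "k = K")
    case True
    then show ?thesis using attains0_refl remn[of K] c1_nonneg E \<rho>(1)
      by (intro exI[of _ 0]) (simp add: E_def[symmetric])
  next
    case False
    then have k: "k < K" using less by simp
    show ?thesis
    proof (cases "\<exists>d\<in>D. \<bar>xx k - d\<bar> \<le> 4 * \<delta>")
      case False
      then obtain R where R: "attains0 f (pt k) (pt (Suc k)) R" "val k \<le> R + c1 * (rem k - rem (Suc k))"
        using far_step[OF k] by force
      obtain R' where R': "attains0 f (pt (Suc k)) (pt K) R'"
        "(\<Sum>j=Suc k..<K. val j) \<le> R' + c1 * rem (Suc k) + E * (1 + 2 * rem (Suc k) / \<rho>)"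
      proof -
        have "K - Suc k < K - k" "Suc k \<le> K" using k by auto
        from less(1)[OF this, folded E_def] that show ?thesis by blast
      qed
      have "E * (1 + 2 * rem (Suc k) / \<rho>) \<le> E * (1 + 2 * rem k / \<rho>)"
        using E rem_antimono[of k "Suc k"] k \<rho>(1) by (intro mult_left_mono add_left_mono divide_right_mono) auto
      moreover have "c1 * (rem k - rem (Suc k)) + c1 * rem (Suc k) = c1 * rem k" by (simp add: algebra_simps)
      moreover have "(\<Sum>j=k..<K. val j) = val k + (\<Sum>j=Suc k..<K. val j)"
        using k by (rule sum.atLeast_Suc_lessThan)
      ultimately have "(\<Sum>j=k..<K. val j) \<le> R + R' + c1 * rem k + E * (1 + 2 * rem k / \<rho>)"
        using R(2) R'(2) by linarith
      then show ?thesis using attains0_join[OF R(1) R'(1)] unfolding E_def by blast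
    next
      case True
      then obtain d where d: "d \<in> D" "\<bar>xx k - d\<bar> \<le> 4 * \<delta>" by blast
      \<comment> \<open>The indices at which the chain is close to \<open>d\<close> without having
        left the neighbourhood of radius \<open>\<rho>\<close> before. The gap ends at the largest
        of them, so after it the chain either leaves that neighbourhood before coming close to
        \<open>d\<close> again or never comes close again.\<close>
      define Z where "Z = {j \<in> {k..K}. \<bar>xx j - d\<bar> \<le> 4 * \<delta> \<and> (\<forall>i\<in>{k..<j}. \<bar>xx i - d\<bar> \<le> \<rho>)}"
      define k' where "k' = Max Z"
      have Z: "finite Z" "k \<in> Z" using k d by (auto simp: Z_def)
      have k'Z: "k' \<in> Z" unfolding k'_def using Z by (intro Max_in) auto
      then have k': "k \<le> k'" "k' \<le> K" "\<bar>xx k' - d\<bar> \<le> 4 * \<delta>" "\<And>i. k \<le> i \<Longrightarrow> i < k' \<Longrightarrow> \<bar>xx i - d\<bar> \<le> \<rho>"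
        by (auto simp: Z_def)
      have maxZ: "j \<notin> Z" if "k' < j" for j using Max_ge[OF Z(1), of j] that unfolding k'_def[symmetric] by auto
      obtain R1 where R1: "attains0 f (pt k) (pt k') R1" "(\<Sum>j=k..<k'. val j) \<le> R1 + c1 * (rem k - rem k') + 400 * \<delta> / fm"
      proof (cases "k' = k")
        case True
        have "0 \<le> 400 * \<delta> / fm" using \<delta> fm by simp
        then show ?thesis using that[of 0] True attains0_refl by simp
      next
        case False
        then show ?thesis using gap[of k k' d] k' d that by auto
      qed
      have c1s: "c1 * (rem a - rem b) = c1 * rem a - c1 * rem b" for a b by (rule right_diff_distrib)
      have c1m: "c1 * rem b \<le> c1 * rem a" if "a \<le> b" "b \<le> K" for a b
        using c1_nonneg rem_antimono[OF that] by (intro mult_left_mono)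
      have Er: "E \<le> E * (1 + 2 * rem k / \<rho>)"
        using E remn[of k] k \<rho>(1) by (simp add: mult_le_cancel_left1)
      show ?thesis
      proof (cases "k' = K")
        case True
        have "0 \<le> c1 * rem K" using c1_nonneg remn[of K] by simp
        moreover have "0 \<le> 2 * \<delta> / fm" using \<delta> fm by simp
        ultimately have "(\<Sum>j=k..<K. val j) \<le> R1 + c1 * rem k + E * (1 + 2 * rem k / \<rho>)"
          using R1(2)[unfolded True] E(2) Er c1s[of k K] by linarith
        then show ?thesis using R1(1) True unfolding E_def by blast
      next
        case False
        then have kK: "k' < K" using k' by simp
        \<comment> \<open>The step out of the gap still starts close to \<open>d\<close>, where
          \<open>far_step\<close> does not apply. Its value is given up and charged to the
          gap.\<close>
        obtain R2 where R2: "attains0 f (pt k') (pt (Suc k')) R2" "val k' \<le> R2 + 2 * \<delta> / fm"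
          using near_step[OF kK] by blast
        have v1: "(\<Sum>j=k'..<Suc k'. val j) = val k'" by simp
        define N where "N = {j \<in> {Suc k'..<K}. \<exists>d\<in>D. \<bar>xx j - d\<bar> \<le> 4 * \<delta>}"
        show ?thesis
        proof (cases "N = {}")
          case True
          then have fr: "\<bar>xx j - d'\<bar> > 4 * \<delta>" if "Suc k' \<le> j" "j < K" "d' \<in> D" for j d'
            using that by (force simp: N_def)
          obtain R3 where R3: "attains0 f (pt (Suc k')) (pt K) R3" "(\<Sum>j=Suc k'..<K. val j) \<le> R3 + c1 * (rem (Suc k') - rem K)"
            using free_run[of "Suc k'" K] fr kK by auto
          have s: "(\<Sum>j=k..<K. val j) = (\<Sum>j=k..<k'. val j) + val k' + (\<Sum>j=Suc k'..<K. val j)"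
            using split[of k k' K] split[of k' "Suc k'" K] k' kK v1 by simp
          have "0 \<le> c1 * rem K" using c1_nonneg remn[of K] by simp
          then have "(\<Sum>j=k..<K. val j) \<le> (R1 + R2 + R3) + c1 * rem k + E * (1 + 2 * rem k / \<rho>)"
            using s R1(2) R2(2) R3(2) E(2) Er c1s[of k k'] c1s[of "Suc k'" K] c1m[of k' "Suc k'"] kK by linarith
          then show ?thesis
            using attains0_join[OF attains0_join[OF R1(1) R2(1)] R3(1)] unfolding E_def by blast
        next
          case False
          define k'' where "k'' = Min N"
          have finN: "finite N" by (simp add: N_def)
          have "k'' \<in> N" unfolding k''_def using False finN by (rule Min_in[rotated])
          then obtain d' where k'': "Suc k' \<le> k''" "k'' < K" "d' \<in> D" "\<bar>xx k'' - d'\<bar> \<le> 4 * \<delta>"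
            by (auto simp: N_def)
          have fr: "\<bar>xx j - e\<bar> > 4 * \<delta>" if "Suc k' \<le> j" "j < k''" "e \<in> D" for j e
          proof (rule ccontr)
            assume "\<not> \<bar>xx j - e\<bar> > 4 * \<delta>"
            then have "\<bar>xx j - e\<bar> \<le> 4 * \<delta>" by linarith
            then have "j \<in> N" unfolding N_def using that k''(2) by auto
            then have "k'' \<le> j" unfolding k''_def using finN by simp
            then show False using that by simp
          qed
          obtain R3 where R3: "attains0 f (pt (Suc k')) (pt k'') R3" "(\<Sum>j=Suc k'..<k''. val j) \<le> R3 + c1 * (rem (Suc k') - rem k'')"
            using free_run[of "Suc k'" k''] fr k'' by auto
          obtain R4 where R4: "attains0 f (pt k'') (pt K) R4"
            "(\<Sum>j=k''..<K. val j) \<le> R4 + c1 * rem k'' + E * (1 + 2 * rem k'' / \<rho>)"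
          proof -
            have "K - k'' < K - k" "k'' \<le> K" using k'' k' by auto
            from less(1)[OF this, folded E_def] that show ?thesis by blast
          qed
          \<comment> \<open>Either the chain has left the neighbourhood of radius
            \<open>\<rho>\<close> of \<open>d\<close>, which takes at least
            \<open>\<rho> - 4 * \<delta>\<close>, or the next gap belongs to another point of
            \<open>D\<close>, at distance at least \<open>4 * \<rho>\<close>.\<close>
          have away: "rem k'' \<le> rem k' - \<rho> / 2"
          proof (cases "\<exists>i\<in>{k'..k''}. \<bar>xx i - d\<bar> > \<rho>")
            case True
            then obtain i where i: "k' \<le> i" "i \<le> k''" "\<bar>xx i - d\<bar> > \<rho>" by auto
            have "\<bar>xx i - xx k'\<bar> \<le> rem k' - rem i" using i k'' by (intro rem_xx) auto
            moreover have "rem k'' \<le> rem i" using i k'' by (intro rem_antimono) auto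
            ultimately show ?thesis using i(3) k'(3) \<delta> by linarith
          next
            case F: False
            have "\<not> \<bar>xx k'' - d\<bar> \<le> 4 * \<delta>"
            proof
              assume a: "\<bar>xx k'' - d\<bar> \<le> 4 * \<delta>"
              have "\<bar>xx i - d\<bar> \<le> \<rho>" if "k \<le> i" "i < k''" for i
              proof (cases "i < k'")
                case True
                then show ?thesis by (rule k'(4)[OF that(1)])
              next
                case False
                then have "i \<in> {k'..k''}" using that by simp
                then have "\<not> \<bar>xx i - d\<bar> > \<rho>" using F by blast
                then show ?thesis by linarith
              qed
              then have "k'' \<in> Z" using a k'' k'(1) by (auto simp: Z_def)
              then show False using maxZ k'' by auto
            qed
            then have "d' \<noteq> d" using k'' by auto
            then have "4 * \<rho> \<le> \<bar>d' - d\<bar>" using \<rho>(5)[of d' d] k'' d by auto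
            moreover have "\<bar>xx k'' - xx k'\<bar> \<le> rem k' - rem k''" using k'' by (intro rem_xx) auto
            ultimately show ?thesis using k''(4) k'(3) \<delta> by linarith
          qed
          have s: "(\<Sum>j=k..<K. val j) = (\<Sum>j=k..<k'. val j) + val k' + (\<Sum>j=Suc k'..<k''. val j) + (\<Sum>j=k''..<K. val j)"
            using split[of k k' K] split[of k' "Suc k'" K] split[of "Suc k'" k'' K] k' k'' kK v1 by simp
          have "2 * rem k'' / \<rho> \<le> 2 * (rem k - \<rho> / 2) / \<rho>"
            using away rem_antimono[of k k'] k' \<rho>(1) by (intro divide_right_mono) auto
          also have "\<dots> = 2 * rem k / \<rho> - 1" using \<rho>(1) by (simp add: field_simps)
          finally have "E * (1 + 2 * rem k'' / \<rho>) \<le> E * (2 * rem k / \<rho>)"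
            using E by (intro mult_left_mono) auto
          moreover have "E * (1 + 2 * rem k / \<rho>) = E + E * (2 * rem k / \<rho>)" by (simp add: distrib_left)
          ultimately have "(\<Sum>j=k..<K. val j) \<le> (R1 + R2 + R3 + R4) + c1 * rem k + E * (1 + 2 * rem k / \<rho>)"
            using s R1(2) R2(2) R3(2) R4(2) E(2) c1s[of k k'] c1s[of "Suc k'" k''] c1m[of k' "Suc k'"] kK by linarith
          then show ?thesis
            using attains0_join[OF attains0_join[OF attains0_join[OF R1(1) R2(1)] R3(1)] R4(1)] unfolding E_def by blast
        qed
      qed
    qed
  qed
qed

end

text \<open>The central comparison. It is uniform over all chains of mesh at most
  \<open>\<delta>0\<close>, whatever their number of points, and so applies to discretised paths and
  to lattice paths alike.\<close>

theorem chain_value_attained: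
  fixes f :: "real \<Rightarrow> real"
  assumes f: "regular_speed f" and UV: "0 < U" "0 < V" and e: "0 < e"
  obtains \<delta>0 where "0 < \<delta>0"
    "\<And>\<delta> u v K. \<lbrakk>0 < \<delta>; \<delta> \<le> \<delta>0; u 0 = 0; v 0 = 0; u K = U; v K = V;
        \<And>k. k < K \<Longrightarrow> u k \<le> u (Suc k); \<And>k. k < K \<Longrightarrow> v k \<le> v (Suc k);
        \<And>k. k < K \<Longrightarrow> u (Suc k) - u k + (v (Suc k) - v k) \<le> \<delta>\<rbrakk> \<Longrightarrow>
      \<exists>R. attains f (0, 0) (U, V) R \<and>
        (\<Sum>k<K. gm (u (Suc k) - u k) (v (Suc k) - v k) / window_inf f \<delta> (u k - v k)) \<le> R + e"
proof -
  obtain fm fM where fm: "0 < fm" "\<And>x. - V - 1 \<le> x \<Longrightarrow> x \<le> U + 1 \<Longrightarrow> fm \<le> f x \<and> f x \<le> fM"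
    using regular_speed_bounds[OF f, of "- V - 1" "U + 1"] by metis
  define S where "S = U + V"
  have S: "0 < S" using UV by (simp add: S_def)
  \<comment> \<open>The budget: \<open>\<epsilon>1\<close> makes \<open>c1 * S\<close> at most
    \<open>e / 4\<close>, \<open>\<delta>0\<close> below does the same for the gaps, and the
    perturbation by \<open>\<kappa>\<close> may cost \<open>e / 2\<close>.\<close>
  define \<epsilon>1 where "\<epsilon>1 = min (fm / 2) (e * fm\<^sup>2 / (64 * S))"
  have \<epsilon>1: "0 < \<epsilon>1" "\<epsilon>1 \<le> fm / 2" "\<epsilon>1 \<le> e * fm\<^sup>2 / (64 * S)"
    unfolding \<epsilon>1_def using fm(1) e S by auto
  obtain D where D: "finite D" "\<And>s t x y. \<lbrakk>- V - 1 \<le> s; s \<le> t; t \<le> U + 1; {s..t} \<inter> D = {}; x \<in> {s..t}; y \<in> {s..t}\<rbrakk> \<Longrightarrow> \<bar>f x - f y\<bar> \<le> \<epsilon>1"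
    by (rule regular_speed_partition[OF f \<epsilon>1(1), of "- V - 1" "U + 1"]) blast
  obtain \<rho> where \<rho>: "0 < \<rho>" "\<rho> \<le> 1"
    "\<And>d x. d \<in> D \<Longrightarrow> \<bar>x - d\<bar> \<le> 2 * \<rho> \<Longrightarrow> f d - \<epsilon>1 \<le> f x"
    "\<And>d. d \<in> D \<Longrightarrow> (\<forall>y. d < y \<and> y \<le> d + \<rho> \<longrightarrow> f y \<le> f d + \<epsilon>1) \<or> (\<forall>y. d - \<rho> \<le> y \<and> y < d \<longrightarrow> f y \<le> f d + \<epsilon>1)"
    "\<And>d d'. d \<in> D \<Longrightarrow> d' \<in> D \<Longrightarrow> d \<noteq> d' \<Longrightarrow> 4 * \<rho> \<le> \<bar>d - d'\<bar>"
  proof (rule regular_speed_scale[OF f \<epsilon>1(1) D(1) zero_less_one], goal_cases)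
    case (1 \<rho>)
    show ?case by (rule 1(1)[OF 1(2-6)])
  qed
  define G where "G = 1 + 2 * S / \<rho>"
  have G: "0 < G" using S \<rho> by (simp add: G_def add_pos_pos)
  define \<delta>0 where "\<delta>0 = min (\<rho> / 160) (e * fm / (4000 * G))"
  have \<delta>0: "0 < \<delta>0" "\<delta>0 \<le> \<rho> / 160" "\<delta>0 \<le> e * fm / (4000 * G)"
    unfolding \<delta>0_def using fm(1) e G \<rho>(1) by auto
  show ?thesis
  proof (rule that[OF \<delta>0(1)])
    fix \<delta> :: real and u v :: "nat \<Rightarrow> real" and K :: nat
    assume \<delta>: "0 < \<delta>" "\<delta> \<le> \<delta>0" and uv0: "u 0 = 0" "v 0 = 0" "u K = U" "v K = V"
      and mono: "\<And>k. k < K \<Longrightarrow> u k \<le> u (Suc k)" "\<And>k. k < K \<Longrightarrow> v k \<le> v (Suc k)"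
      and mesh: "\<And>k. k < K \<Longrightarrow> u (Suc k) - u k + (v (Suc k) - v k) \<le> \<delta>"
    have K: "0 < K" using uv0 UV by (cases K) auto
    \<comment> \<open>Mixing in the straight chain with weight \<open>\<kappa>\<close> makes all
      steps strict. Points move by at most \<open>\<kappa> * S \<le> \<delta>\<close>, so a window
      of radius \<open>2 * \<delta>\<close> around the new point contains the old one; the last term
      bounds the lost fraction of the chain value by \<open>e / 2\<close>.\<close>
    define \<kappa> where "\<kappa> = min (1 / 2) (min (\<delta> / S) (e * fm / (4 * S)))"
    have \<kappa>: "0 < \<kappa>" "\<kappa> \<le> 1 / 2"
    proof -
      show "0 < \<kappa>" unfolding \<kappa>_def using \<delta> S e fm(1) by auto
      show "\<kappa> \<le> 1 / 2" unfolding \<kappa>_def by (rule min.cobounded1)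
    qed
    have \<kappa>2: "\<kappa> \<le> \<delta> / S" "\<kappa> \<le> e * fm / (4 * S)"
      unfolding \<kappa>_def by auto
    have \<kappa>S: "\<kappa> * S \<le> \<delta>" using \<kappa>2(1) S by (simp add: pos_le_divide_eq)
    define u' where "u' k = (1 - \<kappa>) * u k + \<kappa> * (k / K * U)" for k :: nat
    define v' where "v' k = (1 - \<kappa>) * v k + \<kappa> * (k / K * V)" for k :: nat
    have box: "0 \<le> u k" "u k \<le> U" "0 \<le> v k" "v k \<le> V" if "k \<le> K" for k
      using sum_gm_le[of 0 k u v] sum_gm_le[of k K u v] mono that uv0 by auto
    have du: "u' (Suc k) - u' k = (1 - \<kappa>) * (u (Suc k) - u k) + \<kappa> * U / K" for k
      by (simp add: u'_def algebra_simps add_divide_distrib)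
    have dv: "v' (Suc k) - v' k = (1 - \<kappa>) * (v (Suc k) - v k) + \<kappa> * V / K" for k
      by (simp add: v'_def algebra_simps add_divide_distrib)
    have xx': "\<bar>(u' k - v' k) - (u k - v k)\<bar> \<le> \<delta>" if "k \<le> K" for k
    proof -
      have "(u' k - v' k) - (u k - v k) = \<kappa> * (k / K * U - k / K * V - (u k - v k))"
        by (simp add: u'_def v'_def algebra_simps)
      moreover have "\<bar>k / K * U - k / K * V - (u k - v k)\<bar> \<le> S"
      proof -
        have q: "0 \<le> real k / K" "real k / K \<le> 1" using that K by auto
        have "k / K * U \<le> 1 * U" "k / K * V \<le> 1 * V" "0 \<le> k / K * U" "0 \<le> k / K * V"
          using q UV by (intro mult_right_mono mult_nonneg_nonneg; simp)+
        then show ?thesis using box[OF that] unfolding S_def by linarith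
      qed
      ultimately have "\<bar>(u' k - v' k) - (u k - v k)\<bar> \<le> \<kappa> * S"
        using \<kappa>(1) by (simp add: abs_mult)
      then show ?thesis using \<kappa>S by linarith
    qed
    interpret C: chain_setup f U V fm fM \<epsilon>1 \<rho> "2 * \<delta>" D u' v' K
    proof (unfold_locales)
      show "80 * (2 * \<delta>) \<le> \<rho>" using \<delta> \<delta>0 by linarith
      show "u' K = U" "v' K = V" using K uv0 by (auto simp: u'_def v'_def algebra_simps)
      show "u' 0 = 0" "v' 0 = 0" using uv0 by (auto simp: u'_def v'_def)
      fix k assume k: "k < K"
      have "0 < \<kappa> * U / K" "0 < \<kappa> * V / K" using \<kappa> UV K by auto
      moreover have "0 \<le> (1 - \<kappa>) * (u (Suc k) - u k)" "0 \<le> (1 - \<kappa>) * (v (Suc k) - v k)"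
        using mono[OF k] \<kappa> by auto
      ultimately show "u' k < u' (Suc k)" "v' k < v' (Suc k)" using du[of k] dv[of k] by linarith+
      have "u' (Suc k) - u' k + (v' (Suc k) - v' k) = (1 - \<kappa>) * (u (Suc k) - u k + (v (Suc k) - v k)) + \<kappa> * S / K"
        unfolding du dv S_def by (simp add: algebra_simps add_divide_distrib)
      also have "\<dots> \<le> 1 * \<delta> + \<delta>"
      proof (intro add_mono mult_mono)
        have "\<kappa> * S / K \<le> \<kappa> * S" using \<kappa> S K by (simp add: divide_le_eq)
        then show "\<kappa> * S / K \<le> \<delta>" using \<kappa>S by linarith
      qed (use mesh[OF k] \<kappa> mono[OF k] in auto)
      finally show "u' (Suc k) - u' k + (v' (Suc k) - v' k) \<le> 2 * \<delta>" by simp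
    qed (use f UV fm \<epsilon>1 D \<rho> \<delta> in auto)
    obtain R where R: "attains0 f (C.pt 0) (C.pt K) R"
      "(\<Sum>j=0..<K. C.val j) \<le> R + C.c1 * C.rem 0 + 500 * (2 * \<delta>) / fm * (1 + 2 * C.rem 0 / \<rho>)"
      using C.chain_bound[of 0] by auto
    have ends: "C.pt 0 = (0, 0)" "C.pt K = (U, V)" "C.rem 0 = S"
      using C.uv0 by (auto simp: C.pt_def C.rem_def S_def)
    have att: "attains f (0, 0) (U, V) R" using R(1) UV unfolding ends attains0_def by auto
    have b1: "C.c1 * S \<le> e / 4"
    proof -
      have "\<epsilon>1 * (64 * S) \<le> e * fm\<^sup>2" using \<epsilon>1(3) S by (simp add: pos_le_divide_eq)
      then show ?thesis using fm(1) by (simp add: C.c1_def pos_divide_le_eq)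
    qed
    have b2: "500 * (2 * \<delta>) / fm * (1 + 2 * S / \<rho>) \<le> e / 4"
    proof -
      have "\<delta> \<le> e * fm / (4000 * G)" using \<delta>(2) \<delta>0(3) by linarith
      then have "\<delta> * (4000 * G) \<le> e * fm" using G by (simp add: pos_le_divide_eq)
      then show ?thesis using fm(1) unfolding G_def[symmetric] by (simp add: pos_divide_le_eq)
    qed
    define T where "T = (\<Sum>k<K. gm (u (Suc k) - u k) (v (Suc k) - v k) / window_inf f \<delta> (u k - v k))"
    have wfm: "fm \<le> window_inf f \<delta> (u k - v k)" if "k < K" for k
    proof (rule window_inf_ge)
      fix y assume "\<bar>y - (u k - v k)\<bar> \<le> \<delta>"
      moreover have "\<delta> \<le> 1" using \<delta> \<delta>0 \<rho> by linarith
      ultimately have "- V - 1 \<le> y" "y \<le> U + 1" using box[of k] that by linarith+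
      then show "fm \<le> f y" using fm(2) by blast
    qed (use \<delta> in simp)
    have T1: "(1 - \<kappa>) * T \<le> (\<Sum>j=0..<K. C.val j)"
      unfolding T_def sum_distrib_left lessThan_atLeast0
    proof (rule sum_mono)
      fix k assume "k \<in> {0..<K}"
      then have k: "k < K" by simp
      have w: "window_inf f (2 * \<delta>) (C.xx k) \<le> window_inf f \<delta> (u k - v k)"
      proof (rule window_inf_ge)
        fix y assume "\<bar>y - (u k - v k)\<bar> \<le> \<delta>"
        then have "\<bar>y - C.xx k\<bar> \<le> 2 * \<delta>" using xx'[of k] k unfolding C.xx_def by linarith
        then show "window_inf f (2 * \<delta>) (C.xx k) \<le> f y" by (rule window_inf_le[OF f])
      qed (use \<delta> in simp)
      have w2: "0 < window_inf f (2 * \<delta>) (C.xx k)"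
        using C.window_ge_fm[of k] k fm(1) by linarith
      have "(1 - \<kappa>) * gm (u (Suc k) - u k) (v (Suc k) - v k) = gm ((1 - \<kappa>) * (u (Suc k) - u k)) ((1 - \<kappa>) * (v (Suc k) - v k))"
        using \<kappa> by (simp add: gm_scale)
      also have "\<dots> \<le> gm (u' (Suc k) - u' k) (v' (Suc k) - v' k)"
        using mono[OF k] \<kappa> UV unfolding du dv by (intro gm_mono) auto
      finally have g: "(1 - \<kappa>) * gm (u (Suc k) - u k) (v (Suc k) - v k) \<le> gm (u' (Suc k) - u' k) (v' (Suc k) - v' k)" .
      have "(1 - \<kappa>) * gm (u (Suc k) - u k) (v (Suc k) - v k) / window_inf f \<delta> (u k - v k)
        \<le> gm (u' (Suc k) - u' k) (v' (Suc k) - v' k) / window_inf f (2 * \<delta>) (C.xx k)"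
        using g w w2 by (intro frac_le) auto
      then show "(1 - \<kappa>) * (gm (u (Suc k) - u k) (v (Suc k) - v k) / window_inf f \<delta> (u k - v k)) \<le> C.val k"
        by (simp add: C.val_def)
    qed
    have T2: "T \<le> 2 * S / fm"
    proof -
      have "T \<le> (\<Sum>k<K. gm (u (Suc k) - u k) (v (Suc k) - v k) / fm)"
        unfolding T_def using wfm fm(1) by (intro sum_mono divide_left_mono mult_pos_pos) (auto intro: less_le_trans)
      also have "\<dots> = (\<Sum>k=0..<K. gm (u (Suc k) - u k) (v (Suc k) - v k)) / fm"
        by (simp add: sum_divide_distrib lessThan_atLeast0)
      also have "\<dots> \<le> gm (u K - u 0) (v K - v 0) / fm"
        using sum_gm_le[of 0 K u v] mono fm(1) by (intro divide_right_mono) auto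
      also have "\<dots> \<le> 2 * S / fm"
        using gm_le[of U V] UV uv0 fm(1) by (intro divide_right_mono) (auto simp: S_def)
      finally show ?thesis .
    qed
    have "\<kappa> * T \<le> e / 2"
    proof -
      have "\<kappa> * T \<le> \<kappa> * (2 * S / fm)" using T2 \<kappa> by (intro mult_left_mono) auto
      also have "\<dots> \<le> e / 2"
      proof -
        have "\<kappa> * (4 * S) \<le> e * fm" using \<kappa>2(2) S by (simp add: pos_le_divide_eq)
        then show ?thesis using fm(1) by (simp add: pos_divide_le_eq)
      qed
      finally show ?thesis .
    qed
    moreover have "(1 - \<kappa>) * T = T - \<kappa> * T" by (simp add: algebra_simps)
    ultimately have "T \<le> R + e"
      using T1 R(2) b1 b2 unfolding ends by linarith
    then show "\<exists>R. attains f (0, 0) (U, V) R \<and>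
        (\<Sum>k<K. gm (u (Suc k) - u k) (v (Suc k) - v k) / window_inf f \<delta> (u k - v k)) \<le> R + e"
      using att unfolding T_def by blast
  qed
qed

section \<open>Chains and admissible paths\<close>

lemma gamma_eq_gm: "gamma p = gm (fst p + snd p) (snd p)"
  by (simp add: gamma_def gm_def)

lemma gamma_scale: "0 \<le> k \<Longrightarrow> gamma (k *\<^sub>R p) = k * gamma p"
  unfolding gamma_eq_gm using gm_scale[of k "fst p + snd p" "snd p"] by (simp add: distrib_left)

lemma window_inf_pos:
  assumes f: "regular_speed f" and "0 \<le> \<delta>"
  shows "0 < window_inf f \<delta> x"
proof -
  obtain fm fM where fm: "0 < fm" "\<And>y. x - \<delta> \<le> y \<Longrightarrow> y \<le> x + \<delta> \<Longrightarrow> fm \<le> f y \<and> f y \<le> fM"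
    using regular_speed_bounds[OF f] by metis
  have "fm \<le> window_inf f \<delta> x"
    using assms(2) fm(2) by (intro window_inf_ge) (auto simp: abs_le_iff)
  then show ?thesis using fm(1) by linarith
qed

text \<open>If a side is 0 no interior \<open>\<alpha>\<close> attains the minimum of the tangents.
  Both sides are therefore enlarged by \<open>h\<close>, and continuity of \<open>gm\<close> gives
  the limit as \<open>h\<close> tends to 0.\<close>

lemma le_gm_of_tangents:
  assumes "0 \<le> a" "0 \<le> b" and X: "\<And>\<alpha>. 0 < \<alpha> \<Longrightarrow> \<alpha> < 1 \<Longrightarrow> X \<le> a / \<alpha> + b / (1 - \<alpha>)"
  shows "X \<le> gm a b"
proof (rule tendsto_lowerbound)
  have "((\<lambda>h. gm (a + h) (b + h)) \<longlongrightarrow> gm (a + 0) (b + 0)) (at_right 0)"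
    unfolding gm_def by (intro tendsto_intros)
  then show "((\<lambda>h. gm (a + h) (b + h)) \<longlongrightarrow> gm a b) (at_right 0)" by simp
  show "\<forall>\<^sub>F h in at_right 0. X \<le> gm (a + h) (b + h)"
    unfolding eventually_at_right_field
  proof (intro exI[of _ 1] conjI allI impI)
    fix h :: real assume h: "0 < h" "h < 1"
    have p: "0 < a + h" "0 < b + h" using assms h by auto
    define \<alpha> where "\<alpha> = sqrt (a + h) / (sqrt (a + h) + sqrt (b + h))"
    note ch = gm_eq_tangent[OF p, folded \<alpha>_def]
    have "X \<le> a / \<alpha> + b / (1 - \<alpha>)" by (rule X[OF ch(1,2)])
    also have "\<dots> \<le> (a + h) / \<alpha> + (b + h) / (1 - \<alpha>)"
      using ch(1,2) h by (intro add_mono divide_right_mono) auto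
    finally show "X \<le> gm (a + h) (b + h)" using ch(5) by simp
  qed simp
qed simp

text \<open>Bounding \<open>gamma\<close> by its tangents reduces the integral to the fundamental theorem of calculus, so no
  integrability of the derivative of \<open>g\<close> has to be discussed.\<close>
lemma segment_integral_le:
  fixes g :: "real \<Rightarrow> real \<times> real"
  assumes st: "s \<le> t" and S: "finite S" and cont: "continuous_on {s..t} g"
    and der: "\<And>r. r \<in> {s<..<t} - S \<Longrightarrow> (g has_vector_derivative D r) (at r)"
    and wed: "\<And>r. r \<in> {s<..<t} - S \<Longrightarrow> 0 \<le> fst (D r) + snd (D r) \<and> 0 \<le> snd (D r)"
    and m: "0 < m" "\<And>r. r \<in> {s..t} \<Longrightarrow> m \<le> f (fst (g r))"
    and int: "((\<lambda>r. gamma (vector_derivative g (at r)) / f (fst (g r))) has_integral I) {s..t}"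
  shows "I \<le> gm ((fst (g t) + snd (g t)) - (fst (g s) + snd (g s))) (snd (g t) - snd (g s)) / m"
    and "fst (g s) + snd (g s) \<le> fst (g t) + snd (g t)" and "snd (g s) \<le> snd (g t)"
proof -
  let ?u = "\<lambda>r. fst (g r) + snd (g r)" and ?v = "\<lambda>r. snd (g r)"
  \<comment> \<open>The derivatives are set to zero on the finite exceptional set, so that the
    inequalities below hold at every point of the interval.\<close>
  define du where "du r = (if r \<in> {s<..<t} - S then fst (D r) + snd (D r) else 0)" for r
  define dv where "dv r = (if r \<in> {s<..<t} - S then snd (D r) else 0)" for r
  have u1: "(du has_integral (?u t - ?u s)) {s..t}"
  proof (rule fundamental_theorem_of_calculus_interior_strong[OF S st])
    fix r assume r: "r \<in> {s<..<t} - S"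
    show "(?u has_vector_derivative du r) (at r)"
      using has_vector_derivative_add[OF bounded_linear.has_vector_derivative[OF bounded_linear_fst der[OF r]] bounded_linear.has_vector_derivative[OF bounded_linear_snd der[OF r]]] r
      by (simp add: du_def)
  qed (use cont in \<open>auto intro!: continuous_intros\<close>)
  have v1: "(dv has_integral (?v t - ?v s)) {s..t}"
  proof (rule fundamental_theorem_of_calculus_interior_strong[OF S st])
    fix r assume r: "r \<in> {s<..<t} - S"
    show "(?v has_vector_derivative dv r) (at r)"
      using bounded_linear.has_vector_derivative[OF bounded_linear_snd der[OF r]] r by (simp add: dv_def)
  qed (use cont in \<open>auto intro!: continuous_intros\<close>)
  have nn: "0 \<le> du r" "0 \<le> dv r" for r using wed[of r] by (auto simp: du_def dv_def)
  have "0 \<le> ?u t - ?u s" using has_integral_nonneg[OF u1] nn by blast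
  then show mu: "?u s \<le> ?u t" by simp
  have "0 \<le> ?v t - ?v s" using has_integral_nonneg[OF v1] nn by blast
  then show mv: "?v s \<le> ?v t" by simp
  have "I * m \<le> gm (?u t - ?u s) (?v t - ?v s)"
  proof (rule le_gm_of_tangents)
    fix \<alpha> :: real assume a: "0 < \<alpha>" "\<alpha> < 1"
    let ?F = "\<lambda>r. gamma (vector_derivative g (at r)) / f (fst (g r))"
    define F where "F r = (if r \<in> {s<..<t} - S then ?F r else 0)" for r
    have "(F has_integral I) {s..t}"
      by (rule has_integral_spike_finite[OF _ _ int, of "insert s (insert t S)"]) (use S in \<open>auto simp: F_def\<close>)
    moreover have "((\<lambda>r. (1 / m) * (du r * (1 / \<alpha>) + dv r * (1 / (1 - \<alpha>)))) has_integral (1 / m) * ((?u t - ?u s) * (1 / \<alpha>) + (?v t - ?v s) * (1 / (1 - \<alpha>)))) {s..t}"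
      by (intro has_integral_mult_right has_integral_add has_integral_mult_left u1 v1)
    moreover have "F r \<le> (1 / m) * (du r * (1 / \<alpha>) + dv r * (1 / (1 - \<alpha>)))" if "r \<in> {s..t}" for r
    proof (cases "r \<in> {s<..<t} - S")
      case True
      then have "F r = gm (du r) (dv r) / f (fst (g r))"
        using vector_derivative_at[OF der[OF True]] by (simp add: F_def gamma_eq_gm du_def dv_def)
      also have "\<dots> \<le> (du r / \<alpha> + dv r / (1 - \<alpha>)) / m"
        using gm_tangent[OF nn a] nn a m that by (intro frac_le) auto
      finally show ?thesis by simp
    next
      case False
      then have "F r = 0" by (auto simp: F_def)
      moreover have "0 \<le> (1 / m) * (du r * (1 / \<alpha>) + dv r * (1 / (1 - \<alpha>)))" using nn a m by auto
      ultimately show ?thesis by simp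
    qed
    ultimately have "I \<le> (1 / m) * ((?u t - ?u s) * (1 / \<alpha>) + (?v t - ?v s) * (1 / (1 - \<alpha>)))"
      by (rule has_integral_le)
    then have "I \<le> ((?u t - ?u s) / \<alpha> + (?v t - ?v s) / (1 - \<alpha>)) / m" by simp
    then show "I * m \<le> (?u t - ?u s) / \<alpha> + (?v t - ?v s) / (1 - \<alpha>)" using m(1) by (simp only: pos_le_divide_eq)
  qed (use mu mv in auto)
  then show "I \<le> gm (?u t - ?u s) (?v t - ?v s) / m" using m(1) by (simp only: pos_le_divide_eq)
qed

text \<open>Time is cut uniformly, finely enough for \<open>u + v\<close> to move by at most
  \<open>\<delta>\<close> per piece. As \<open>u\<close> and \<open>v\<close> are monotone, the
  speed seen on a piece is then at least the window infimum at its start.\<close>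

lemma path_integral_le_chain:
  fixes f :: "real \<Rightarrow> real"
  assumes f: "regular_speed f" and \<delta>: "0 < \<delta>" and g: "g \<in> admissible_paths (x, y)"
  shows "\<exists>u v K. u 0 = 0 \<and> v 0 = 0 \<and> u K = x + y \<and> v K = y \<and>
    (\<forall>k<K. u k \<le> u (Suc k) \<and> v k \<le> v (Suc k) \<and> u (Suc k) - u k + (v (Suc k) - v k) \<le> \<delta>) \<and>
    integral {0..1} (\<lambda>s. gamma (vector_derivative g (at s)) / f (fst (g s)))
      \<le> (\<Sum>k<K. gm (u (Suc k) - u k) (v (Suc k) - v k) / window_inf f \<delta> (u k - v k))"
proof -
  have pc: "g piecewise_C1_differentiable_on {0..1}" and g01: "g 0 = (0, 0)" "g 1 = (x, y)"
    and wed: "\<And>s v. s \<in> {0..1} \<Longrightarrow> (g has_vector_derivative v) (at s) \<Longrightarrow> v \<in> wedge"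
    using g unfolding admissible_paths_def by auto
  obtain S where cont: "continuous_on {0..1} g" and S: "finite S" "g C1_differentiable_on ({0..1} - S)"
    using pc unfolding piecewise_C1_differentiable_on_def by auto
  obtain D where D: "\<And>s. s \<in> {0..1} - S \<Longrightarrow> (g has_vector_derivative D s) (at s)"
    using S(2) unfolding C1_differentiable_on_def by blast
  have W: "0 \<le> fst (D s) + snd (D s) \<and> 0 \<le> snd (D s)" if "s \<in> {0..1} - S" for s
    using wed[OF _ D[OF that]] that by (auto simp: wedge_def split: prod.splits)
  let ?u = "\<lambda>r. fst (g r) + snd (g r)" and ?v = "\<lambda>r. snd (g r)"
  let ?F = "\<lambda>s. gamma (vector_derivative g (at s)) / f (fst (g s))"
  have mono: "?u s \<le> ?u t \<and> ?v s \<le> ?v t" if "0 \<le> s" "s \<le> t" "t \<le> 1" for s t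
  proof -
      have "((\<lambda>r. fst (D r) + snd (D r)) has_integral (?u t - ?u s)) {s..t}"
      proof (rule fundamental_theorem_of_calculus_interior_strong[OF S(1) that(2)])
        fix r assume r: "r \<in> {s<..<t} - S"
        then have r': "r \<in> {0..1} - S" using that by auto
        show "(?u has_vector_derivative fst (D r) + snd (D r)) (at r)"
          by (rule has_vector_derivative_add[OF bounded_linear.has_vector_derivative[OF bounded_linear_fst D[OF r']] bounded_linear.has_vector_derivative[OF bounded_linear_snd D[OF r']]])
      qed (use continuous_on_subset[OF cont, of "{s..t}"] that in \<open>auto intro!: continuous_intros\<close>)
      then have "((\<lambda>r. if r \<in> S then 0 else fst (D r) + snd (D r)) has_integral (?u t - ?u s)) {s..t}"
        by (rule has_integral_spike_finite[OF S(1), rotated]) auto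
      then have 1: "0 \<le> ?u t - ?u s"
        by (rule has_integral_nonneg) (use W that in auto)
      have "((\<lambda>r. snd (D r)) has_integral (?v t - ?v s)) {s..t}"
      proof (rule fundamental_theorem_of_calculus_interior_strong[OF S(1) that(2)])
        fix r assume r: "r \<in> {s<..<t} - S"
        then have r': "r \<in> {0..1} - S" using that by auto
        show "(?v has_vector_derivative snd (D r)) (at r)"
          by (rule bounded_linear.has_vector_derivative[OF bounded_linear_snd D[OF r']])
      qed (use continuous_on_subset[OF cont, of "{s..t}"] that in \<open>auto intro!: continuous_intros\<close>)
      then have "((\<lambda>r. if r \<in> S then 0 else snd (D r)) has_integral (?v t - ?v s)) {s..t}"
        by (rule has_integral_spike_finite[OF S(1), rotated]) auto
      then have 2: "0 \<le> ?v t - ?v s"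
        by (rule has_integral_nonneg) (use W that in auto)
      show ?thesis using 1 2 by simp
  qed
  have "uniformly_continuous_on {0..1} (\<lambda>r. ?u r + ?v r)"
    by (rule compact_uniformly_continuous) (use cont in \<open>auto intro!: continuous_intros\<close>)
  then obtain d where d: "0 < d" "\<And>s t. s \<in> {0..1} \<Longrightarrow> t \<in> {0..1} \<Longrightarrow> dist t s < d \<Longrightarrow> dist (?u t + ?v t) (?u s + ?v s) < \<delta>"
    using \<delta> unfolding uniformly_continuous_on_def by metis
  obtain K :: nat where K: "1 / d < real K" using reals_Archimedean2 by blast
  have "0 < 1 / d" using d by simp
  then have Kp: "0 < real K" using K by linarith
  have Kd: "1 / real K < d" using K d Kp by (simp add: field_simps)
  define tt where "tt k = real k / real K" for k :: nat
  have tt: "0 \<le> tt k" "tt k \<le> tt (Suc k)" "tt (Suc k) - tt k < d" for k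
    using Kp Kd by (auto simp: tt_def divide_right_mono diff_divide_distrib[symmetric])
  have tt1: "tt k \<le> 1" if "k \<le> K" for k using that Kp by (simp add: tt_def)
  have tK: "tt K = 1" "tt 0 = 0" using Kp by (auto simp: tt_def)
  define u where "u k = ?u (tt k)" for k
  define v where "v k = ?v (tt k)" for k
  have step: "u k \<le> u (Suc k) \<and> v k \<le> v (Suc k) \<and> u (Suc k) - u k + (v (Suc k) - v k) \<le> \<delta>" if k: "k < K" for k
  proof -
    have "tt (Suc k) \<le> 1" using tt1[of "Suc k"] k by simp
    then have m: "?u (tt k) \<le> ?u (tt (Suc k)) \<and> ?v (tt k) \<le> ?v (tt (Suc k))" using mono[of "tt k" "tt (Suc k)"] tt by auto
    have "dist (?u (tt (Suc k)) + ?v (tt (Suc k))) (?u (tt k) + ?v (tt k)) < \<delta>"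
      using \<open>tt (Suc k) \<le> 1\<close> tt[of k] tt(1)[of "Suc k"] by (intro d(2)) (auto simp: dist_real_def)
    then show ?thesis using m unfolding u_def v_def dist_real_def by linarith
  qed
  let ?T = "\<lambda>k. gm (u (Suc k) - u k) (v (Suc k) - v k) / window_inf f \<delta> (u k - v k)"
  have le: "integral {0..1} ?F \<le> (\<Sum>k<K. ?T k)"
  proof (cases "?F integrable_on {0..1}")
    \<comment> \<open>A path whose integrand is not integrable has \<open>integral\<close> equal to
      0 by convention, and the chain sum is nonnegative.\<close>
    case False
    then have "integral {0..1} ?F = 0" by (rule not_integrable_integral)
    moreover have "0 \<le> (\<Sum>k<K. ?T k)"
      using window_inf_pos[OF f, of \<delta>] \<delta> by (intro sum_nonneg divide_nonneg_pos) auto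
    ultimately show ?thesis by simp
  next
    case True
    have "integral {0..tt k} ?F \<le> (\<Sum>j<k. ?T j)" if "k \<le> K" for k
      using that
    proof (induction k)
      case 0
      then show ?case by (simp add: tK)
    next
      case (Suc k)
      have k: "k < K" using Suc by simp
      have i: "?F integrable_on {0..tt (Suc k)}"
        by (rule integrable_on_subinterval[OF True]) (use tt1[of "Suc k"] Suc in auto)
      have i2: "?F integrable_on {tt k..tt (Suc k)}"
        by (rule integrable_on_subinterval[OF True]) (use tt1[of "Suc k"] tt(1)[of k] Suc in auto)
      have "integral {tt k..tt (Suc k)} ?F \<le> ?T k"
        unfolding u_def v_def
      proof (rule segment_integral_le(1)[OF tt(2) S(1) _ _ _ _ _ integrable_integral[OF i2]])
        show "continuous_on {tt k..tt (Suc k)} g"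
          by (rule continuous_on_subset[OF cont]) (use tt1[of "Suc k"] tt(1)[of k] k in auto)
        show "0 < window_inf f \<delta> (?u (tt k) - ?v (tt k))" using window_inf_pos[OF f] \<delta> by simp
        fix r
        have in01: "r \<in> {0..1}" if "r \<in> {tt k..tt (Suc k)}" using that tt1[of "Suc k"] tt(1)[of k] k by auto
        show "window_inf f \<delta> (?u (tt k) - ?v (tt k)) \<le> f (fst (g r))" if r: "r \<in> {tt k..tt (Suc k)}"
        proof (rule window_inf_le[OF f])
          have "?u (tt k) \<le> ?u r" "?v (tt k) \<le> ?v r" "?u r \<le> ?u (tt (Suc k))" "?v r \<le> ?v (tt (Suc k))"
            using mono[of "tt k" r] mono[of r "tt (Suc k)"] r in01[OF r] tt1[of "Suc k"] tt(1)[of k] k by auto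
          then show "\<bar>fst (g r) - (?u (tt k) - ?v (tt k))\<bar> \<le> \<delta>"
            using step[OF k] unfolding u_def v_def by linarith
        qed
        assume r: "r \<in> {tt k<..<tt (Suc k)} - S"
        then have r': "r \<in> {0..1} - S" using in01 by auto
        show "(g has_vector_derivative D r) (at r)" by (rule D[OF r'])
        show "0 \<le> fst (D r) + snd (D r) \<and> 0 \<le> snd (D r)" by (rule W[OF r'])
      qed
      moreover have "integral {0..tt k} ?F + integral {tt k..tt (Suc k)} ?F = integral {0..tt (Suc k)} ?F"
        by (rule Henstock_Kurzweil_Integration.integral_combine[OF tt(1) tt(2) i])
      ultimately show ?case using Suc by simp
    qed
    from this[of K] show ?thesis using tK by simp
  qed
  show ?thesis
    by (rule exI[of _ u], rule exI[of _ v], rule exI[of _ K]) (use step le g01 tK in \<open>auto simp: u_def v_def\<close>)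
qed

section \<open>Admissible paths that realise attained values\<close>

definition wedge_pt :: "real \<times> real \<Rightarrow> real \<times> real" where
  "wedge_pt p = (fst p - snd p, snd p)"

text \<open>Monotonicity of the two coordinates replaces the condition on derivatives because it
  passes to concatenations, including the point where the pieces meet. Carrying
  \<open>has_integral\<close> keeps integrability, so that the integrals of the pieces can be
  added.\<close>

definition path_attains :: "(real \<Rightarrow> real) \<Rightarrow> real \<times> real \<Rightarrow> real \<times> real \<Rightarrow> real \<Rightarrow> bool" where
  "path_attains f p p' r \<longleftrightarrow> (\<exists>g I. valid_path g \<and> g 0 = wedge_pt p \<and> g 1 = wedge_pt p' \<and>
     (\<forall>s t. 0 \<le> s \<and> s \<le> t \<and> t \<le> 1 \<longrightarrow> fst (g s) + snd (g s) \<le> fst (g t) + snd (g t) \<and> snd (g s) \<le> snd (g t)) \<and>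
     r \<le> I \<and> ((\<lambda>s. gamma (vector_derivative g (at s)) / f (fst (g s))) has_integral I) {0..1})"

lemma regular_speed_measurable:
  assumes f: "regular_speed f"
  shows "f \<in> borel_measurable borel"
  unfolding borel_measurable_iff_greater
proof
  fix a
  have "open {x. a < f x}"
    unfolding open_dist
  proof
    fix x assume "x \<in> {x. a < f x}"
    then obtain \<rho> where "\<rho> > 0" "\<forall>y. \<bar>y - x\<bar> < \<rho> \<longrightarrow> a < f y"
      using regular_speed_lsc[OF f, of a x] by blast
    then show "\<exists>e>0. \<forall>y. dist y x < e \<longrightarrow> y \<in> {x. a < f x}"
      by (intro exI[of _ \<rho>]) (auto simp: dist_real_def)
  qed
  then show "{w \<in> space borel. a < f w} \<in> sets borel" by simp
qed

text \<open>The straight segment has constant \<open>gamma\<close> of its derivative, equal to the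
  increment of \<open>gm\<close>, and the speed along it is at most \<open>C\<close>. Integrability
  holds because the speed is Borel and bounded below on the segment.\<close>

lemma path_attains_step:
  assumes f: "regular_speed f" and uv: "u < u'" "v < v'" and \<eta>: "0 < \<eta>" and C: "0 < C"
    and fC: "\<And>x. u - v' - \<eta> \<le> x \<Longrightarrow> x \<le> u' - v + \<eta> \<Longrightarrow> f x \<le> C"
  shows "path_attains f (u, v) (u', v') (gm (u' - u) (v' - v) / C)"
proof -
  define g where "g = linepath (wedge_pt (u, v)) (wedge_pt (u', v'))"
  have g: "g s = ((1 - s) * (u - v) + s * (u' - v'), (1 - s) * v + s * v')" for s
    by (simp add: g_def linepath_def wedge_pt_def)
  have vd: "vector_derivative g (at s) = (u' - v' - (u - v), v' - v)" for s
    unfolding g_def by (simp add: vector_derivative_at[OF has_vector_derivative_linepath_within] wedge_pt_def)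
  have usum: "fst (g s) + snd (g s) = u + s * (u' - u)" and vs: "snd (g s) = v + s * (v' - v)" for s
    by (simp_all add: g algebra_simps)
  define k where "k = gm (u' - u) (v' - v)"
  have gk: "gamma (vector_derivative g (at s)) = k" for s
    by (simp add: vd gamma_eq_gm k_def algebra_simps)
  have k: "0 \<le> k" by (simp add: k_def)
  have range: "u - v' \<le> fst (g s)" "fst (g s) \<le> u' - v" if "s \<in> {0..1}" for s
  proof -
    define a b where "a = s * (u' - u)" and "b = s * (v' - v)"
    have "0 \<le> a" "a \<le> 1 * (u' - u)" "0 \<le> b" "b \<le> 1 * (v' - v)"
      unfolding a_def b_def using that uv by (intro mult_nonneg_nonneg mult_right_mono; simp)+
    moreover have "fst (g s) = u + a - (v + b)" using usum[of s] vs[of s] unfolding a_def b_def by simp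
    ultimately show "u - v' \<le> fst (g s)" "fst (g s) \<le> u' - v" by simp_all
  qed
  let ?F = "\<lambda>s. gamma (vector_derivative g (at s)) / f (fst (g s))"
  have F: "?F = (\<lambda>s. k / f (fst (g s)))" by (simp add: gk)
  obtain fm fM where fm: "0 < fm" "\<And>x. u - v' \<le> x \<Longrightarrow> x \<le> u' - v \<Longrightarrow> fm \<le> f x \<and> f x \<le> fM"
    using regular_speed_bounds[OF f] by metis
  have int: "(\<lambda>s. k / f (fst (g s))) integrable_on {0..1}"
  proof (rule measurable_bounded_by_integrable_imp_integrable_real[where g = "\<lambda>_. k / fm"])
    have "(\<lambda>s. fst (g s)) \<in> borel_measurable borel"
      unfolding g by (intro borel_measurable_continuous_onI) (auto intro!: continuous_intros)
    then have "(\<lambda>s. f (fst (g s))) \<in> borel_measurable borel"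
      by (rule measurable_compose) (rule regular_speed_measurable[OF f])
    then have "(\<lambda>s. k / f (fst (g s))) \<in> borel_measurable lborel" by simp
    then show "(\<lambda>s. k / f (fst (g s))) \<in> borel_measurable (lebesgue_on {0..1})"
      by (intro measurable_restrict_space1 measurable_completion)
    show "\<bar>k / f (fst (g s))\<bar> \<le> k / fm" if "s \<in> {0..1}" for s
      using fm(1) fm(2)[OF range[OF that]] k by (auto intro!: frac_le)
  qed auto
  have le: "gm (u' - u) (v' - v) / C \<le> integral {0..1} (\<lambda>s. k / f (fst (g s)))"
  proof -
    have "((\<lambda>s. k / C) has_integral (1 - 0) * (k / C)) {0..1::real}"
      using has_integral_const_real[of "k / C" 0 1] by simp
    then have "(1 - 0) * (k / C) \<le> integral {0..1} (\<lambda>s. k / f (fst (g s)))"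
    proof (rule has_integral_le[OF _ integrable_integral[OF int]])
      fix s :: real assume s: "s \<in> {0..1}"
      have "f (fst (g s)) \<le> C" using range[OF s] \<eta> by (intro fC) auto
      then show "k / C \<le> k / f (fst (g s))"
        using k C regular_speed_pos[OF f] by (intro divide_left_mono mult_pos_pos) auto
    qed
    then show ?thesis by (simp add: k_def)
  qed
  show ?thesis unfolding path_attains_def
  proof (intro exI conjI)
    show "valid_path g" by (simp add: g_def)
    show "g 0 = wedge_pt (u, v)" "g 1 = wedge_pt (u', v')" by (simp_all add: g_def linepath_def)
    show "\<forall>s t. 0 \<le> s \<and> s \<le> t \<and> t \<le> 1 \<longrightarrow> fst (g s) + snd (g s) \<le> fst (g t) + snd (g t) \<and> snd (g s) \<le> snd (g t)"
      unfolding usum unfolding vs using uv by (auto intro!: mult_right_mono)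
    show "(?F has_integral integral {0..1} (\<lambda>s. k / f (fst (g s)))) {0..1}"
      unfolding F by (rule integrable_integral[OF int])
  qed (rule le)
qed

text \<open>Each half is run at double speed. Since \<open>gamma\<close> is homogeneous of degree
  one, the factor 2 from the chain rule cancels the halved time interval.\<close>

lemma path_attains_join:
  assumes "path_attains f p p' r" "path_attains f p' p'' r'"
  shows "path_attains f p p'' (r + r')"
proof -
  let ?G = "\<lambda>g s. gamma (vector_derivative g (at s)) / f (fst (g s))"
  obtain g1 I1 where g1: "valid_path g1" "g1 0 = wedge_pt p" "g1 1 = wedge_pt p'"
    and m1: "\<And>s t. 0 \<le> s \<Longrightarrow> s \<le> t \<Longrightarrow> t \<le> 1 \<Longrightarrow> fst (g1 s) + snd (g1 s) \<le> fst (g1 t) + snd (g1 t) \<and> snd (g1 s) \<le> snd (g1 t)"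
    and I1: "r \<le> I1" "(?G g1 has_integral I1) {0..1}"
    using assms(1) unfolding path_attains_def by blast
  obtain g2 I2 where g2: "valid_path g2" "g2 0 = wedge_pt p'" "g2 1 = wedge_pt p''"
    and m2: "\<And>s t. 0 \<le> s \<Longrightarrow> s \<le> t \<Longrightarrow> t \<le> 1 \<Longrightarrow> fst (g2 s) + snd (g2 s) \<le> fst (g2 t) + snd (g2 t) \<and> snd (g2 s) \<le> snd (g2 t)"
    and I2: "r' \<le> I2" "(?G g2 has_integral I2) {0..1}"
    using assms(2) unfolding path_attains_def by blast
  obtain s1 s2 where s1: "finite s1" "\<forall>x\<in>{0..1} - s1. g1 differentiable at x"
      and s2: "finite s2" "\<forall>x\<in>{0..1} - s2. g2 differentiable at x"
    using g1 g2 by (auto simp: valid_path_def piecewise_C1_differentiable_on_def C1_differentiable_on_eq)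
  define g where "g = g1 +++ g2"
  have gl: "g s = g1 (2 * s)" if "s \<le> 1/2" for s using that by (simp add: g_def joinpaths_def)
  have gr: "g s = g2 (2 * s - 1)" if "1/2 \<le> s" for s
  proof (cases "s = 1/2")
    case True
    then show ?thesis using gl[of "1/2"] g1(3) g2(2) unfolding True by simp
  next
    case False
    then show ?thesis using that by (simp add: g_def joinpaths_def)
  qed
  have d1: "vector_derivative g (at z) = 2 *\<^sub>R vector_derivative g1 (at (2 * z))"
    if "0 \<le> z" "2 * z < 1" "2 * z \<notin> s1" for z
  proof (rule vector_derivative_at[OF has_vector_derivative_transform_within])
    show "0 < \<bar>z - 1/2\<bar>" using that by auto
    have "((\<lambda>x. 2 * x) has_vector_derivative 2) (at z)"
      by (simp add: has_vector_derivative_def has_derivative_def bounded_linear_mult_left)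
    moreover have "(g1 has_vector_derivative vector_derivative g1 (at (2 * z))) (at (2 * z))"
      using s1 that by (auto simp: vector_derivative_works[symmetric])
    ultimately show "((\<lambda>x. g1 (2 * x)) has_vector_derivative 2 *\<^sub>R vector_derivative g1 (at (2 * z))) (at z)"
      by (intro vector_diff_chain_at[simplified o_def])
    show "g1 (2 * x) = g x" if "dist x z < \<bar>z - 1/2\<bar>" for x
      using that \<open>2 * z < 1\<close> by (intro gl[symmetric]) (auto simp: dist_real_def)
  qed simp
  have d2: "vector_derivative g (at z) = 2 *\<^sub>R vector_derivative g2 (at (2 * z - 1))"
    if "1 < 2 * z" "z \<le> 1" "2 * z - 1 \<notin> s2" for z
  proof (rule vector_derivative_at[OF has_vector_derivative_transform_within])
    show "0 < \<bar>z - 1/2\<bar>" using that by auto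
    have "((\<lambda>x. 2 * x - 1) has_vector_derivative 2) (at z)"
      by (simp add: has_vector_derivative_def has_derivative_def bounded_linear_mult_left)
    moreover have "(g2 has_vector_derivative vector_derivative g2 (at (2 * z - 1))) (at (2 * z - 1))"
      using s2 that by (auto simp: vector_derivative_works[symmetric])
    ultimately show "((\<lambda>x. g2 (2 * x - 1)) has_vector_derivative 2 *\<^sub>R vector_derivative g2 (at (2 * z - 1))) (at z)"
      by (intro vector_diff_chain_at[simplified o_def])
    show "g2 (2 * x - 1) = g x" if "dist x z < \<bar>z - 1/2\<bar>" for x
      using that \<open>1 < 2 * z\<close> by (intro gr[symmetric]) (auto simp: dist_real_def)
  qed simp
  have i1: "((\<lambda>x. 2 * ?G g1 (2 * x)) has_integral I1) {0..1/2}"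
    using has_integral_mult_right[OF has_integral_affinity'[where m = 2 and c = 0 and a = 0 and b = "1::real" and f = "?G g1" and i = I1], of 2] I1(2)
    by (simp add: mult.commute)
  have i2: "((\<lambda>x. 2 * ?G g2 (2 * x - 1)) has_integral I2) {1/2..1}"
    using has_integral_mult_right[OF has_integral_affinity'[where m = 2 and c = "-1" and a = 0 and b = "1::real" and f = "?G g2" and i = I2], of 2] I2(2)
    by (simp add: mult.commute)
  have j1: "(?G g has_integral I1) {0..1/2}"
  proof (rule has_integral_spike_finite[OF _ _ i1])
    show "finite (insert (1/2) ((\<lambda>x. 2 * x) -` s1))"
      using s1 by (force intro: finite_vimageI[where h = "\<lambda>x. 2 * x"] inj_onI)
    show "?G g x = 2 * ?G g1 (2 * x)" if "x \<in> {0..1/2} - insert (1/2) ((\<lambda>x. 2 * x) -` s1)" for x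
    proof -
      have x: "0 \<le> x" "2 * x < 1" "2 * x \<notin> s1" using that by auto
      show ?thesis unfolding d1[OF x] using gl[of x] x gamma_scale[of 2] by simp
    qed
  qed
  have j2: "(?G g has_integral I2) {1/2..1}"
  proof (rule has_integral_spike_finite[OF _ _ i2])
    show "finite (insert (1/2) ((\<lambda>x. 2 * x - 1) -` s2))"
      using s2 by (force intro: finite_vimageI[where h = "\<lambda>x. 2*x-1"] inj_onI)
    show "?G g x = 2 * ?G g2 (2 * x - 1)" if "x \<in> {1/2..1} - insert (1/2) ((\<lambda>x. 2 * x - 1) -` s2)" for x
    proof -
      have x: "1 < 2 * x" "x \<le> 1" "2 * x - 1 \<notin> s2" using that by auto
      show ?thesis unfolding d2[OF x] using gr[of x] x gamma_scale[of 2] by simp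
    qed
  qed
  show ?thesis unfolding path_attains_def
  proof (intro exI conjI)
    show "valid_path g" unfolding g_def
      by (rule valid_path_join) (use g1 g2 in \<open>auto simp: pathfinish_def pathstart_def\<close>)
    show "g 0 = wedge_pt p" "g 1 = wedge_pt p''" using gl[of 0] gr[of 1] g1 g2 by auto
    show "(?G g has_integral (I1 + I2)) {0..1}"
      by (rule has_integral_combine[OF _ _ j1 j2]) auto
    show "r + r' \<le> I1 + I2" using I1 I2 by simp
    show "\<forall>s t. 0 \<le> s \<and> s \<le> t \<and> t \<le> 1 \<longrightarrow> fst (g s) + snd (g s) \<le> fst (g t) + snd (g t) \<and> snd (g s) \<le> snd (g t)"
    proof (intro allI impI)
      fix s t :: real assume st: "0 \<le> s \<and> s \<le> t \<and> t \<le> 1"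
      consider "t \<le> 1/2" | "s \<le> 1/2" "1/2 \<le> t" | "1/2 \<le> s" by linarith
      then show "fst (g s) + snd (g s) \<le> fst (g t) + snd (g t) \<and> snd (g s) \<le> snd (g t)"
      proof cases
        case 1
        then show ?thesis using m1[of "2 * s" "2 * t"] st gl[of s] gl[of t] by simp
      next
        case 2
        then show ?thesis using m1[of "2 * s" 1] m2[of 0 "2 * t - 1"] st gl[of s] gr[of t] g1 g2 by auto
      next
        case 3
        then show ?thesis using m2[of "2 * s - 1" "2 * t - 1"] st gr[of s] gr[of t] by simp
      qed
    qed
  qed
qed

lemma attains_imp_path:
  assumes "regular_speed f" "attains f p p' r"
  shows "path_attains f p p' r"
  using assms(2)
proof induction
  case (step u u' v v' \<eta> C)
  then show ?case by (intro path_attains_step[OF assms(1)]) auto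
next
  case (join p p' r p'' r')
  then show ?case by (intro path_attains_join)
qed

text \<open>The derivative is two-sided but monotonicity is known on \<open>[0, 1]\<close> alone, so
  values to the right are compared for \<open>s < 1\<close> and values to the left at
  \<open>s = 1\<close>.\<close>

lemma mono_imp_derivative_nonneg:
  fixes h :: "real \<Rightarrow> real"
  assumes "\<And>s t. 0 \<le> s \<Longrightarrow> s \<le> t \<Longrightarrow> t \<le> 1 \<Longrightarrow> h s \<le> h t" and s: "s \<in> {0..1}"
    and d: "(h has_vector_derivative d) (at s)"
  shows "0 \<le> d"
proof (rule ccontr)
  assume "\<not> 0 \<le> d"
  then have dn: "d < 0" by simp
  have D: "DERIV h s :> d" using d by (simp add: has_real_derivative_iff_has_vector_derivative)
  show False
  proof (cases "s < 1")
    case True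
    obtain e where e: "0 < e" "\<And>k. 0 < k \<Longrightarrow> k < e \<Longrightarrow> h s > h (s + k)"
      using DERIV_neg_dec_right[OF D dn] by auto
    define k where "k = min (e / 2) (1 - s)"
    have "0 < k" "k < e" "k \<le> 1 - s" using e(1) True by (auto simp: k_def)
    then show False using e(2)[of k] assms(1)[of s "s + k"] s by auto
  next
    case False
    then have s1: "s = 1" using s by simp
    obtain e where e: "0 < e" "\<And>k. 0 < k \<Longrightarrow> k < e \<Longrightarrow> h s < h (s - k)"
      using DERIV_neg_dec_left[OF D dn] by auto
    define k where "k = min (e / 2) (1 / 2)"
    have "0 < k" "k < e" "k \<le> 1 / 2" using e(1) by (auto simp: k_def)
    then show False using e(2)[of k] assms(1)[of "s - k" s] s1 by auto
  qed
qed

lemma path_attains_admissible: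
  assumes "path_attains f (0, 0) (x + y, y) r"
  shows "\<exists>g\<in>admissible_paths (x, y). r \<le> integral {0..1} (\<lambda>s. gamma (vector_derivative g (at s)) / f (fst (g s)))"
proof -
  let ?G = "\<lambda>g s. gamma (vector_derivative g (at s)) / f (fst (g s))"
  obtain g I where g: "valid_path g" "g 0 = (0, 0)" "g 1 = (x, y)"
    and m: "\<And>s t. 0 \<le> s \<Longrightarrow> s \<le> t \<Longrightarrow> t \<le> 1 \<Longrightarrow> fst (g s) + snd (g s) \<le> fst (g t) + snd (g t) \<and> snd (g s) \<le> snd (g t)"
    and I: "r \<le> I" "(?G g has_integral I) {0..1}"
    using assms unfolding path_attains_def wedge_pt_def by auto
  have "g \<in> admissible_paths (x, y)"
    unfolding admissible_paths_def
  proof (intro CollectI conjI ballI allI impI)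
    show "g piecewise_C1_differentiable_on {0..1}" using g(1) by (simp add: valid_path_def)
    show "g 0 = (0, 0)" "g 1 = (x, y)" by fact+
    fix s :: real assume s: "s \<in> {0..1}"
    show "g s \<in> wedge" using m[of 0 s] s g(2) by (auto simp: wedge_def split: prod.splits)
    fix v assume v: "(g has_vector_derivative v) (at s)"
    have "0 \<le> fst v + snd v"
      by (rule mono_imp_derivative_nonneg[where h = "\<lambda>s. fst (g s) + snd (g s)" and s = s])
        (use m s has_vector_derivative_add[OF bounded_linear.has_vector_derivative[OF bounded_linear_fst v] bounded_linear.has_vector_derivative[OF bounded_linear_snd v]] in auto)
    moreover have "0 \<le> snd v"
      by (rule mono_imp_derivative_nonneg[where h = "\<lambda>s. snd (g s)" and s = s])
        (use m s bounded_linear.has_vector_derivative[OF bounded_linear_snd v] in auto)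
    ultimately show "v \<in> wedge" by (auto simp: wedge_def split: prod.splits)
  qed
  moreover have "integral {0..1} (?G g) = I" using I(2) by (rule integral_unique)
  ultimately show ?thesis using I(1) by auto
qed

text \<open>A chain of mesh one and superadditivity give a crude bound. Boundedness is what makes
  the real supremum in \<open>Gamma\<close> an upper bound of the path integrals.\<close>

lemma path_integral_bounded:
  assumes f: "regular_speed f" and xy: "0 < x + y" "0 < y"
  shows "\<exists>B. \<forall>g\<in>admissible_paths (x, y). integral {0..1} (\<lambda>s. gamma (vector_derivative g (at s)) / f (fst (g s))) \<le> B"
proof -
  obtain fm fM where fm: "0 < fm" "\<And>z. - y - 1 \<le> z \<Longrightarrow> z \<le> x + y + 1 \<Longrightarrow> fm \<le> f z \<and> f z \<le> fM"
    using regular_speed_bounds[OF f, of "- y - 1" "x + y + 1"] by metis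
  show ?thesis
  proof (intro exI ballI)
    fix g assume g: "g \<in> admissible_paths (x, y)"
    obtain u v K where uv: "u 0 = 0" "v 0 = 0" "u K = x + y" "v K = y"
      and mono: "\<And>k. k < K \<Longrightarrow> u k \<le> u (Suc k)" "\<And>k. k < K \<Longrightarrow> v k \<le> v (Suc k)"
      and le: "integral {0..1} (\<lambda>s. gamma (vector_derivative g (at s)) / f (fst (g s)))
      \<le> (\<Sum>k<K. gm (u (Suc k) - u k) (v (Suc k) - v k) / window_inf f 1 (u k - v k))"
      using path_integral_le_chain[OF f zero_less_one g] by blast
    have w: "fm \<le> window_inf f 1 (u k - v k)" if "k < K" for k
    proof (rule window_inf_ge)
      fix z assume "\<bar>z - (u k - v k)\<bar> \<le> 1"
      moreover have "0 \<le> u k" "u k \<le> x + y" "0 \<le> v k" "v k \<le> y"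
        using sum_gm_le[of 0 k u v] sum_gm_le[of k K u v] mono that uv by auto
      ultimately show "fm \<le> f z" using fm(2)[of z] by linarith
    qed simp
    have "(\<Sum>k<K. gm (u (Suc k) - u k) (v (Suc k) - v k) / window_inf f 1 (u k - v k))
      \<le> (\<Sum>k<K. gm (u (Suc k) - u k) (v (Suc k) - v k) / fm)"
      using w fm(1) by (intro sum_mono divide_left_mono mult_pos_pos) (auto intro: less_le_trans)
    also have "\<dots> = (\<Sum>k=0..<K. gm (u (Suc k) - u k) (v (Suc k) - v k)) / fm"
      by (simp add: sum_divide_distrib lessThan_atLeast0)
    also have "\<dots> \<le> gm (u K - u 0) (v K - v 0) / fm"
      using sum_gm_le[of 0 K u v] mono fm(1) by (intro divide_right_mono) auto
    finally show "integral {0..1} (\<lambda>s. gamma (vector_derivative g (at s)) / f (fst (g s))) \<le> gm (x + y) y / fm"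
      using le uv by simp
  qed
qed

theorem Gamma_ge_attained:
  assumes f: "regular_speed (\<lambda>x. c (x - q))" and xy: "0 < x + y" "0 < y"
    and a: "attains (\<lambda>x. c (x - q)) (0, 0) (x + y, y) r"
  shows "r \<le> Gamma c q (x, y)"
proof -
  obtain g where g: "g \<in> admissible_paths (x, y)" "r \<le> integral {0..1} (\<lambda>s. gamma (vector_derivative g (at s)) / c (fst (g s) - q))"
    using path_attains_admissible[OF attains_imp_path[OF f a]] by blast
  have "integral {0..1} (\<lambda>s. gamma (vector_derivative g (at s)) / c (fst (g s) - q)) \<le> Gamma c q (x, y)"
    unfolding Gamma_def
  proof (rule cSup_upper)
    show "bdd_above ((\<lambda>g. integral {0..1} (\<lambda>s. gamma (vector_derivative g (at s)) / c (fst (g s) - q))) ` admissible_paths (x, y))"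
      using path_integral_bounded[OF f xy] by (auto simp: bdd_above_def)
  qed (use g in auto)
  then show ?thesis using g by linarith
qed

text \<open>The attained value is a witness that an admissible path exists, so that the supremum is
  over a nonempty set.\<close>

theorem Gamma_le:
  assumes ne: "attains (\<lambda>x. c (x - q)) (0, 0) (x + y, y) r" and f: "regular_speed (\<lambda>x. c (x - q))"
    and B: "\<And>g. g \<in> admissible_paths (x, y) \<Longrightarrow> integral {0..1} (\<lambda>s. gamma (vector_derivative g (at s)) / c (fst (g s) - q)) \<le> B"
  shows "Gamma c q (x, y) \<le> B"
  unfolding Gamma_def
proof (rule cSup_least)
  show "(\<lambda>g. integral {0..1} (\<lambda>s. gamma (vector_derivative g (at s)) / c (fst (g s) - q))) ` admissible_paths (x, y) \<noteq> {}"
    using path_attains_admissible[OF attains_imp_path[OF f ne]] by blast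
qed (use B in auto)

section \<open>Chains and lattice paths\<close>

text \<open>The lattice steps \<open>(1, 0)\<close>, \<open>(-1, 1)\<close> and
  \<open>(0, 1)\<close>, in this order, in the coordinates of \<open>cell\<close>.\<close>

definition lstep :: "nat \<times> nat \<Rightarrow> nat \<times> nat \<Rightarrow> bool" where
  "lstep p q \<longleftrightarrow> q = (fst p + 1, snd p) \<or> q = (fst p, snd p + 1) \<or> q = (fst p + 1, snd p + 1)"

definition cell_path :: "nat \<times> nat \<Rightarrow> nat \<times> nat \<Rightarrow> (nat \<times> nat) list \<Rightarrow> bool" where
  "cell_path p q \<sigma> \<longleftrightarrow> successively lstep \<sigma> \<and> \<sigma> \<noteq> [] \<and> hd \<sigma> = p \<and> last \<sigma> = q"

definition path_weight :: "(nat \<Rightarrow> nat \<Rightarrow> real) \<Rightarrow> (nat \<times> nat) list \<Rightarrow> real" where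
  "path_weight w \<sigma> = sum_list (map (\<lambda>(a, b). w a b) \<sigma>)"

lemma path_weight_append: "path_weight w (\<sigma> @ \<sigma>') = path_weight w \<sigma> + path_weight w \<sigma>'"
  by (simp add: path_weight_def)

lemma cell_path_append:
  "cell_path p q \<sigma> \<Longrightarrow> cell_path p' q' \<sigma>' \<Longrightarrow> lstep q p' \<Longrightarrow> cell_path p q' (\<sigma> @ \<sigma>')"
  by (auto simp: cell_path_def successively_append_iff)

lemma cell_path_bounds:
  assumes "cell_path p q \<sigma>"
  shows "(\<forall>x\<in>set \<sigma>. fst p \<le> fst x \<and> fst x \<le> fst q \<and> snd p \<le> snd x \<and> snd x \<le> snd q) \<and>
    length \<sigma> + fst p + snd p \<le> fst q + snd q + 1"
  using assms
proof (induction \<sigma> arbitrary: p)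
  case Nil
  then show ?case by (simp add: cell_path_def)
next
  case (Cons x \<sigma>)
  show ?case
  proof (cases \<sigma>)
    case Nil
    then show ?thesis using Cons.prems by (auto simp: cell_path_def)
  next
    case (Cons y \<sigma>')
    then have "cell_path y q \<sigma>" "lstep x y" "x = p" using Cons.prems by (auto simp: cell_path_def)
    note IH = Cons.IH[OF this(1)] and st = this(2) and xp = this(3)
    have "y \<in> set \<sigma>" using Cons by simp
    then have yq: "fst y \<le> fst q" "snd y \<le> snd q" using IH by auto
    have py: "fst p \<le> fst y" "snd p \<le> snd y" "fst p + snd p + 1 \<le> fst y + snd y"
      using st xp by (auto simp: lstep_def)
    show ?thesis using IH xp yq py by (fastforce intro: order_trans)
  qed
qed

lemma cell_path_weight_le_lp:
  assumes "cell_path (a, b) (a', b') \<sigma>" and w: "\<And>i j. 0 \<le> w i j"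
  shows "path_weight w \<sigma> \<le> lp (\<lambda>i j. w (a + i) (b + j)) (a' - a + 1) (b' - b + 1)"
  using assms(1)
proof (induction \<sigma> arbitrary: a' b' rule: rev_induct)
  case Nil
  then show ?case by (simp add: cell_path_def)
next
  case (snoc x \<sigma>)
  let ?l = "lp (\<lambda>i j. w (a + i) (b + j))"
  have x: "x = (a', b')" using snoc.prems by (simp add: cell_path_def)
  show ?case
  proof (cases "\<sigma> = []")
    case True
    then have "a' = a" "b' = b" using snoc.prems by (auto simp: cell_path_def)
    then show ?thesis using True x by (simp add: path_weight_def)
  next
    case False
    obtain a'' b'' where l: "last \<sigma> = (a'', b'')" by fastforce
    have p: "cell_path (a, b) (a'', b'') \<sigma>" and s: "lstep (a'', b'') (a', b')"
      using snoc.prems False l x by (auto simp: cell_path_def successively_append_iff)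
    have ge: "a \<le> a''" "b \<le> b''"
      using cell_path_bounds[OF p] False l last_in_set[OF False] by auto
    have IH: "path_weight w \<sigma> \<le> ?l (a'' - a + 1) (b'' - b + 1)" by (rule snoc.IH[OF p])
    define m k where "m = a' - a" and "k = b' - b"
    have "?l (a'' - a + 1) (b'' - b + 1) \<le> max (?l m (Suc k)) (?l (Suc m) k)"
      using s unfolding lstep_def
    proof (elim disjE)
      assume "(a', b') = (fst (a'', b'') + 1, snd (a'', b''))"
      then have "a'' - a + 1 = m" "b'' - b + 1 = Suc k" using ge by (auto simp: m_def k_def)
      then show ?thesis by simp
    next
      assume "(a', b') = (fst (a'', b''), snd (a'', b'') + 1)"
      then have "a'' - a + 1 = Suc m" "b'' - b + 1 = k" using ge by (auto simp: m_def k_def)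
      then show ?thesis by simp
    next
      assume "(a', b') = (fst (a'', b'') + 1, snd (a'', b'') + 1)"
      then have e: "a'' - a + 1 = m" "b'' - b + 1 = k" using ge by (auto simp: m_def k_def)
      \<comment> \<open>A diagonal step passes by a cell of nonnegative weight, so it is dominated
        by a detour through that cell.\<close>
      have "?l m k \<le> ?l m (Suc k)"
        by (rule lp_step_le[of m "Suc k"]) (use w in auto)
      then show ?thesis unfolding e by simp
    qed
    moreover have "a' = a + m" "b' = b + k" using ge s by (auto simp: m_def k_def lstep_def)
    ultimately show ?thesis using IH x by (simp add: path_weight_def)
  qed
qed

lemma lp_attained_by_path:
  assumes w: "\<And>i j. 0 \<le> w i j"
  shows "\<exists>\<sigma>. cell_path (a, b) (a + m, b + k) \<sigma> \<and> lp (\<lambda>i j. w (a + i) (b + j)) (Suc m) (Suc k) \<le> path_weight w \<sigma>"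
proof (induction "m + k" arbitrary: m k rule: less_induct)
  case less
  let ?l = "lp (\<lambda>i j. w (a + i) (b + j))"
  have step: ?case if "cell_path (a, b) p \<sigma>" "lstep p (a + m, b + k)" "max (?l m (Suc k)) (?l (Suc m) k) \<le> path_weight w \<sigma>" for p \<sigma>
  proof (intro exI conjI)
    have "cell_path (a + m, b + k) (a + m, b + k) [(a + m, b + k)]" by (simp add: cell_path_def)
    then show "cell_path (a, b) (a + m, b + k) (\<sigma> @ [(a + m, b + k)])"
      by (rule cell_path_append[OF that(1) _ that(2)])
    show "?l (Suc m) (Suc k) \<le> path_weight w (\<sigma> @ [(a + m, b + k)])"
      using that(3) by (simp add: path_weight_append) (simp add: path_weight_def)
  qed
  have nn: "0 \<le> ?l m' k'" for m' k' by (rule lp_nonneg) (rule w)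
  show ?case
  proof (cases "m = 0 \<and> k = 0")
    case True
    then show ?thesis by (intro exI[of _ "[(a, b)]"]) (simp add: cell_path_def path_weight_def)
  next
    case False
    show ?thesis
    \<comment> \<open>The path comes from the predecessor with the larger value. On a side of the
      rectangle only one predecessor is a cell, and the other value is 0.\<close>
    proof (cases "k = 0 \<or> m \<noteq> 0 \<and> ?l (Suc m) k \<le> ?l m (Suc k)")
      case True
      then obtain m' where m': "m = Suc m'" using False by (cases m) auto
      obtain \<sigma> where s: "cell_path (a, b) (a + m', b + k) \<sigma>" "?l (Suc m') (Suc k) \<le> path_weight w \<sigma>"
        using less[of m' k] m' by auto
      have "?l (Suc m) k \<le> ?l m (Suc k)" using True nn[of m "Suc k"] by auto
      then show ?thesis using s m' by (intro step[OF s(1)]) (auto simp: lstep_def simp del: lp.simps)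
    next
      case F: False
      then obtain k' where k': "k = Suc k'" by (cases k) auto
      obtain \<sigma> where s: "cell_path (a, b) (a + m, b + k') \<sigma>" "?l (Suc m) (Suc k') \<le> path_weight w \<sigma>"
        using less[of m k'] k' by auto
      have "?l m (Suc k) \<le> ?l (Suc m) k" using F nn[of "Suc m" k] by (cases "m = 0") auto
      then show ?thesis using s k' by (intro step[OF s(1)]) (auto simp: lstep_def simp del: lp.simps)
    qed
  qed
qed

lemma lattice_path_is_cell_path:
  assumes "successively (\<lambda>p q. (fst q - fst p, snd q - snd p) \<in> lattice_steps) \<pi>" "\<pi> \<noteq> []" "hd \<pi> = cell a b"
  shows "\<exists>\<sigma>. successively lstep \<sigma> \<and> \<sigma> \<noteq> [] \<and> hd \<sigma> = (a, b) \<and> \<pi> = map (\<lambda>(a, b). cell a b) \<sigma>"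
  using assms
proof (induction \<pi> arbitrary: a b)
  case (Cons x \<pi>)
  show ?case
  proof (cases \<pi>)
    case Nil
    then show ?thesis using Cons.prems by (intro exI[of _ "[(a, b)]"]) simp
  next
    case (Cons y \<pi>')
    have x: "x = cell a b" and st: "(fst y - fst x, snd y - snd x) \<in> lattice_steps"
      and s: "successively (\<lambda>p q. (fst q - fst p, snd q - snd p) \<in> lattice_steps) \<pi>"
      using Cons.prems \<open>\<pi> = y # \<pi>'\<close> by auto
    from st have "y = cell (a + 1) b \<or> y = cell (a + 1) (b + 1) \<or> y = cell a (b + 1)"
      unfolding x lattice_steps_def by (cases y) (auto simp: cell_def)
    then obtain a' b' where ab: "y = cell a' b'" "lstep (a, b) (a', b')"
      by (auto simp: lstep_def)
    obtain \<sigma> where \<sigma>: "successively lstep \<sigma>" "\<sigma> \<noteq> []" "hd \<sigma> = (a', b')" "\<pi> = map (\<lambda>(a, b). cell a b) \<sigma>"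
      using Cons.IH[OF s, of a' b'] ab \<open>\<pi> = y # \<pi>'\<close> by auto
    show ?thesis
      using \<sigma> ab x by (intro exI[of _ "(a, b) # \<sigma>"]) (auto simp: successively_Cons)
  qed
qed simp

lemma lattice_paths_cell:
  "lattice_paths (cell a b) = (\<lambda>\<sigma>. map (\<lambda>(a, b). cell a b) \<sigma>) ` {\<sigma>. cell_path (0, 0) (a, b) \<sigma>}"
proof (intro equalityI subsetI)
  fix \<pi> assume "\<pi> \<in> lattice_paths (cell a b)"
  then have "successively (\<lambda>p q. (fst q - fst p, snd q - snd p) \<in> lattice_steps) \<pi>" "\<pi> \<noteq> []" "hd \<pi> = cell 0 0"
    and l: "last \<pi> = cell a b"
    unfolding lattice_paths_def successively_conv_nth by (auto simp: cell_def)
  then obtain \<sigma> where \<sigma>: "successively lstep \<sigma>" "\<sigma> \<noteq> []" "hd \<sigma> = (0, 0)" "\<pi> = map (\<lambda>(a, b). cell a b) \<sigma>"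
    using lattice_path_is_cell_path by blast
  then have "last \<sigma> = (a, b)" using l by (cases "last \<sigma>") (auto simp: last_map)
  then show "\<pi> \<in> (\<lambda>\<sigma>. map (\<lambda>(a, b). cell a b) \<sigma>) ` {\<sigma>. cell_path (0, 0) (a, b) \<sigma>}"
    using \<sigma> by (auto simp: cell_path_def)
next
  fix \<pi> assume "\<pi> \<in> (\<lambda>\<sigma>. map (\<lambda>(a, b). cell a b) \<sigma>) ` {\<sigma>. cell_path (0, 0) (a, b) \<sigma>}"
  then obtain \<sigma> where \<sigma>: "successively lstep \<sigma>" "\<sigma> \<noteq> []" "hd \<sigma> = (0, 0)" "last \<sigma> = (a, b)"
    and \<pi>: "\<pi> = map (\<lambda>(a, b). cell a b) \<sigma>"
    by (auto simp: cell_path_def)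
  have st: "(fst (cell a' b') - fst (cell a b), snd (cell a' b') - snd (cell a b)) \<in> lattice_steps" if "lstep (a, b) (a', b')" for a b a' b'
    using that by (auto simp: lstep_def cell_def lattice_steps_def)
  show "\<pi> \<in> lattice_paths (cell a b)"
    unfolding lattice_paths_def
  proof (intro CollectI conjI allI impI)
    show "\<pi> \<noteq> []" "hd \<pi> = (0, 1)" "last \<pi> = cell a b"
      using \<sigma> \<pi> by (auto simp: hd_map last_map cell_def)
    fix k assume k: "Suc k < length \<pi>"
    then have "lstep (\<sigma> ! k) (\<sigma> ! Suc k)" using \<sigma>(1) \<pi> by (auto simp: successively_conv_nth)
    then show "(fst (\<pi> ! Suc k) - fst (\<pi> ! k), snd (\<pi> ! Suc k) - snd (\<pi> ! k)) \<in> lattice_steps"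
      using st[of "fst (\<sigma> ! k)" "snd (\<sigma> ! k)" "fst (\<sigma> ! Suc k)" "snd (\<sigma> ! Suc k)"] k \<pi>
      by (simp add: case_prod_beta)
  qed
qed

definition cell_weight :: "(real \<Rightarrow> real) \<Rightarrow> nat \<Rightarrow> int \<Rightarrow> (nat \<Rightarrow> nat \<Rightarrow> real) \<Rightarrow> nat \<Rightarrow> nat \<Rightarrow> real" where
  "cell_weight c n l t a b = t a b / c (real_of_int (int a - int b - l) / real n)"

text \<open>Turns the maximum into two inequalities over paths in the quadrant. Steps increase both
  coordinates weakly and one strictly, so the paths have bounded length and \<open>Max\<close>
  ranges over a finite set; it is nonempty because every cell can be reached.\<close>

lemma lpp_cell:
  fixes c n l tau
  defines "w \<equiv> cell_weight c n l (\<lambda>a b. tau (cell a b))"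
  shows "cell_path (0, 0) (a, b) \<sigma> \<Longrightarrow> path_weight w \<sigma> \<le> lpp c n l tau (cell a b)"
    and "(\<And>\<sigma>. cell_path (0, 0) (a, b) \<sigma> \<Longrightarrow> path_weight w \<sigma> \<le> B) \<Longrightarrow> lpp c n l tau (cell a b) \<le> B"
proof -
  let ?P = "{\<sigma>. cell_path (0, 0) (a, b) \<sigma>}"
  have "?P \<subseteq> {\<sigma>. set \<sigma> \<subseteq> {..a} \<times> {..b} \<and> length \<sigma> \<le> a + b + 1}"
    using cell_path_bounds[of "(0, 0)" "(a, b)"] by fastforce
  moreover have "finite {\<sigma>. set \<sigma> \<subseteq> {..a} \<times> {..b} \<and> length \<sigma> \<le> a + b + 1}"
    by (rule finite_lists_length_le) simp
  ultimately have fin: "finite ?P" by (rule finite_subset)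
  have ne: "?P \<noteq> {}" using lp_attained_by_path[of "\<lambda>_ _. 0" 0 0 a b] by auto
  have "sum_list (map (\<lambda>(i, j). tau (i, j) / c (real_of_int (i - l) / real n)) (map (\<lambda>(a, b). cell a b) \<sigma>)) = path_weight w \<sigma>" for \<sigma>
    unfolding path_weight_def w_def cell_weight_def map_map
    by (rule arg_cong[where f = sum_list], rule map_cong) (auto simp: cell_def)
  then have eq: "lpp c n l tau (cell a b) = Max (path_weight w ` ?P)"
    unfolding lpp_def lattice_paths_cell by (simp add: image_image)
  show "cell_path (0, 0) (a, b) \<sigma> \<Longrightarrow> path_weight w \<sigma> \<le> lpp c n l tau (cell a b)"
    unfolding eq using fin by (intro Max_ge) auto
  show "lpp c n l tau (cell a b) \<le> B" if "\<And>\<sigma>. cell_path (0, 0) (a, b) \<sigma> \<Longrightarrow> path_weight w \<sigma> \<le> B"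
    unfolding eq using fin ne that by (subst Max_le_iff) auto
qed

text \<open>The rounding of \<open>n * q\<close> shifts the argument of the speed by the same
  \<open>\<theta>\<close> at all cells; windows and slacks are large enough to absorb it.\<close>

lemma cell_speed_offset:
  assumes "n \<ge> 1"
  obtains \<theta> where "0 \<le> \<theta>" "\<theta> \<le> 1 / real n"
    "\<And>i j. real_of_int (int i - int j - \<lfloor>real n * q\<rfloor>) / real n = (real i - real j) / real n + \<theta> - q"
proof
  let ?\<theta> = "(real n * q - real_of_int \<lfloor>real n * q\<rfloor>) / real n"
  show "0 \<le> ?\<theta>" by (intro divide_nonneg_nonneg) linarith+
  show "?\<theta> \<le> 1 / real n" by (intro divide_right_mono) linarith+
  show "real_of_int (int i - int j - \<lfloor>real n * q\<rfloor>) / real n = (real i - real j) / real n + ?\<theta> - q" for i j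
    using assms by (simp add: field_simps)
qed

lemma path_weight_mono:
  "(\<And>i j. (i, j) \<in> set \<sigma> \<Longrightarrow> w i j \<le> w' i j) \<Longrightarrow> path_weight w \<sigma> \<le> path_weight w' \<sigma>"
  unfolding path_weight_def by (rule sum_list_mono) auto

lemma hydro_bounds_upper:
  "hydro_bounds w n K \<epsilon> \<Longrightarrow> a \<le> K * n \<Longrightarrow> b \<le> K * n \<Longrightarrow> m \<le> K * n \<Longrightarrow> k \<le> K * n \<Longrightarrow>
    lp (\<lambda>i j. w (a + i) (b + j)) m k \<le> gm m k + \<epsilon> * n"
  unfolding hydro_bounds_def by blast

lemma hydro_bounds_lower:
  "hydro_bounds w n K \<epsilon> \<Longrightarrow> a \<le> K * n \<Longrightarrow> b \<le> K * n \<Longrightarrow> m \<le> K * n \<Longrightarrow> k \<le> K * n \<Longrightarrow>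
    \<epsilon> * n \<le> m \<Longrightarrow> \<epsilon> * n \<le> k \<Longrightarrow> gm m k - \<epsilon> * n \<le> lp (\<lambda>i j. w (a + i) (b + j)) m k"
  unfolding hydro_bounds_def by blast

text \<open>All cells of a piece of length below \<open>\<delta> * n\<close> see at least the window
  infimum at its first cell, so the weights can be replaced by homogeneous ones. The
  \<open>+ 1\<close> in \<open>small\<close> pays for the offset \<open>\<theta>\<close>.\<close>

lemma piece_le:
  fixes c :: "real \<Rightarrow> real" and \<delta> \<epsilon> :: real
  assumes n: "n \<ge> 1" and f: "regular_speed (\<lambda>x. c (x - q))" and \<delta>: "0 < \<delta>"
    and t: "\<And>i j. 0 \<le> t i j" and hyd: "hydro_bounds t n K \<epsilon>"
    and p: "cell_path (a, b) (a1, b1) \<sigma>"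
    and small: "real (a1 - a) + real (b1 - b) + 1 \<le> \<delta> * n" and K: "a1 < K * n" "b1 < K * n"
  shows "path_weight (cell_weight c n \<lfloor>real n * q\<rfloor> t) \<sigma>
    \<le> (gm (a1 - a + 1) (b1 - b + 1) + \<epsilon> * n) / window_inf (\<lambda>x. c (x - q)) \<delta> (real a / n - real b / n)"
proof -
  let ?f = "\<lambda>x. c (x - q)"
  let ?x = "real a / n - real b / n"
  define m where "m = window_inf ?f \<delta> ?x"
  have m: "0 < m" unfolding m_def by (rule window_inf_pos[OF f]) (use \<delta> in simp)
  obtain \<theta> where \<theta>: "0 \<le> \<theta>" "\<theta> \<le> 1 / real n"
    "\<And>i j. real_of_int (int i - int j - \<lfloor>real n * q\<rfloor>) / real n = (real i - real j) / real n + \<theta> - q"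
    using cell_speed_offset[OF n] by metis
  note bd = cell_path_bounds[OF p]
  have n0: "0 < real n" using n by simp
  have "path_weight (cell_weight c n \<lfloor>real n * q\<rfloor> t) \<sigma> \<le> path_weight (\<lambda>i j. (1 / m) * t i j) \<sigma>"
  proof (rule path_weight_mono)
    fix i j assume "(i, j) \<in> set \<sigma>"
    then have ij: "a \<le> i" "i \<le> a1" "b \<le> j" "j \<le> b1" using bd by fastforce+
    have "\<bar>(real i - real j) - (real a - real b)\<bar> \<le> real (a1 - a) + real (b1 - b)"
      using ij by (simp add: of_nat_diff)
    then have "\<bar>(real i - real j) / n - (real a - real b) / n\<bar> \<le> (real (a1 - a) + real (b1 - b)) / n"
      using n0 by (simp add: diff_divide_distrib[symmetric] divide_right_mono abs_divide)
    moreover have "(real (a1 - a) + real (b1 - b)) / n + 1 / n \<le> \<delta>"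
      using small n0 by (simp add: add_divide_distrib[symmetric] pos_divide_le_eq)
    moreover have "?x = (real a - real b) / n" by (simp add: diff_divide_distrib)
    ultimately have "\<bar>(real i - real j) / n + \<theta> - ?x\<bar> \<le> \<delta>" using \<theta>(1,2) by linarith
    from window_inf_le[OF f this] have "m \<le> c ((real i - real j) / n + \<theta> - q)" by (simp add: m_def)
    then show "cell_weight c n \<lfloor>real n * q\<rfloor> t i j \<le> (1 / m) * t i j"
      using m t[of i j] unfolding cell_weight_def \<theta>(3) by (simp add: frac_le)
  qed
  also have "\<dots> \<le> lp (\<lambda>i j. (1 / m) * t (a + i) (b + j)) (a1 - a + 1) (b1 - b + 1)"
    by (rule cell_path_weight_le_lp[OF p]) (use m t in simp)
  also have "\<dots> = (1 / m) * lp (\<lambda>i j. t (a + i) (b + j)) (a1 - a + 1) (b1 - b + 1)"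
    by (rule lp_scale) (use m in simp)
  also have "\<dots> \<le> (1 / m) * (gm (a1 - a + 1) (b1 - b + 1) + \<epsilon> * n)"
  proof (rule mult_left_mono)
    have "\<sigma> \<noteq> []" "last \<sigma> = (a1, b1)" using p by (auto simp: cell_path_def)
    then have "(a1, b1) \<in> set \<sigma>" by (metis last_in_set)
    then have "a \<le> a1" "b \<le> b1" using bd by auto
    then have "a \<le> K * n \<and> b \<le> K * n \<and> a1 - a + 1 \<le> K * n \<and> b1 - b + 1 \<le> K * n"
      using K by auto
    then show "lp (\<lambda>i j. t (a + i) (b + j)) (a1 - a + 1) (b1 - b + 1) \<le> gm (a1 - a + 1) (b1 - b + 1) + \<epsilon> * n"
      by (intro hydro_bounds_upper[OF hyd]) auto
  qed (use m in simp)
  finally show ?thesis by (simp add: m_def)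
qed

text \<open>The path is cut whenever \<open>a + b\<close> has grown by \<open>h\<close> since the
  last cut. The rescaled first cells of the pieces form the chain, and the corner
  \<open>(A + 1, B + 1)\<close> closes it. With \<open>h\<close> proportional to \<open>n\<close>
  the bound \<open>M\<close> on the number of pieces does not grow, so a small error per piece
  remains a small error in total.\<close>

lemma path_chain:
  fixes c :: "real \<Rightarrow> real" and \<delta> \<epsilon>1 \<epsilon>2 fm :: real
  assumes n: "n \<ge> 1" and f: "regular_speed (\<lambda>x. c (x - q))" and \<delta>: "0 < \<delta>"
    and t: "\<And>i j. 0 \<le> t i j" and hyd: "hydro_bounds t n K \<epsilon>1" and \<epsilon>: "0 \<le> \<epsilon>1" "0 \<le> \<epsilon>2"
    and slack: "\<And>x y. 0 \<le> x \<Longrightarrow> x \<le> real K * n \<Longrightarrow> 0 \<le> y \<Longrightarrow> y \<le> real K * n \<Longrightarrow> gm (x + 1) (y + 1) \<le> gm x y + \<epsilon>2 * n"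
    and h: "1 \<le> h" "real h + 1 \<le> \<delta> * n"
    and fm: "0 < fm" "\<And>a b. a \<le> A \<Longrightarrow> b \<le> B \<Longrightarrow> fm \<le> window_inf (\<lambda>x. c (x - q)) \<delta> (real a / n - real b / n)"
    and AB: "A < K * n" "B < K * n"
  shows "\<lbrakk>cell_path (a, b) (A, B) \<sigma>; A + B < a + b + M * h\<rbrakk> \<Longrightarrow>
    \<exists>u v k. k \<le> M \<and> u 0 = real a / n \<and> v 0 = real b / n \<and> u k = (real A + 1) / n \<and> v k = (real B + 1) / n \<and>
     (\<forall>i<k. u i \<le> u (Suc i) \<and> v i \<le> v (Suc i) \<and> u (Suc i) - u i + (v (Suc i) - v i) \<le> \<delta>) \<and>
     path_weight (cell_weight c n \<lfloor>real n * q\<rfloor> t) \<sigma>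
       \<le> n * (\<Sum>i<k. gm (u (Suc i) - u i) (v (Suc i) - v i) / window_inf (\<lambda>x. c (x - q)) \<delta> (u i - v i)) + k * ((\<epsilon>1 + \<epsilon>2) * n / fm)"
proof (induction M arbitrary: a b \<sigma>)
  case 0
  have "\<sigma> \<noteq> []" "last \<sigma> = (A, B)" using 0(1) by (auto simp: cell_path_def)
  then have "(A, B) \<in> set \<sigma>" by (metis last_in_set)
  then have "a \<le> A" "b \<le> B" using cell_path_bounds[OF 0(1)] by auto
  then show ?case using 0(2) by simp
next
  case (Suc M)
  let ?f = "\<lambda>x. c (x - q)"
  let ?w = "cell_weight c n \<lfloor>real n * q\<rfloor> t"
  have n0: "0 < real n" using n by simp
  have ne: "\<sigma> \<noteq> []" "hd \<sigma> = (a, b)" "last \<sigma> = (A, B)" "successively lstep \<sigma>"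
    using Suc.prems(1) by (auto simp: cell_path_def)
  have "(A, B) \<in> set \<sigma>" using ne by (metis last_in_set)
  then have ab: "a \<le> A" "b \<le> B" using cell_path_bounds[OF Suc.prems(1)] by auto
  have piece: "(gm (real x) (real y) + (\<epsilon>1 + \<epsilon>2) * n) / window_inf ?f \<delta> (real a / n - real b / n)
    \<le> n * (gm (real x / n) (real y / n) / window_inf ?f \<delta> (real a / n - real b / n)) + (\<epsilon>1 + \<epsilon>2) * n / fm" for x y
  proof -
    have w: "fm \<le> window_inf ?f \<delta> (real a / n - real b / n)" by (rule fm(2)[OF ab])
    have "gm (real x) (real y) = n * gm (real x / n) (real y / n)"
      using gm_scale[of "real n" "real x / n" "real y / n"] n0 by simp
    moreover have "(\<epsilon>1 + \<epsilon>2) * n / window_inf ?f \<delta> (real a / n - real b / n) \<le> (\<epsilon>1 + \<epsilon>2) * n / fm"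
      using w fm(1) \<epsilon> by (intro divide_left_mono mult_pos_pos) auto
    ultimately show ?thesis by (simp add: add_divide_distrib)
  qed
  define P where "P = (\<lambda>p :: nat \<times> nat. fst p + snd p < a + b + h)"
  show ?case
  proof (cases "A + B < a + b + h")
    case True
    define u where "u = case_nat (real a / n) (\<lambda>_. (real A + 1) / n)"
    define v where "v = case_nat (real b / n) (\<lambda>_. (real B + 1) / n)"
    have du: "u (Suc 0) - u 0 = real (A - a + 1) / n" "v (Suc 0) - v 0 = real (B - b + 1) / n"
      using ab by (auto simp: u_def v_def diff_divide_distrib[symmetric] of_nat_diff)
    have sz: "real (A - a) + real (B - b) + 1 \<le> real h" using True ab by linarith
    have "path_weight ?w \<sigma> \<le> (gm (A - a + 1) (B - b + 1) + \<epsilon>1 * n) / window_inf ?f \<delta> (real a / n - real b / n)"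
      by (rule piece_le[OF n f \<delta> t hyd Suc.prems(1) _ AB]) (use sz h in linarith)
    also have "\<dots> \<le> (gm (real (A - a + 1)) (real (B - b + 1)) + (\<epsilon>1 + \<epsilon>2) * n) / window_inf ?f \<delta> (real a / n - real b / n)"
      using fm(1) fm(2)[OF ab] \<epsilon> n0 by (intro divide_right_mono) (auto simp: distrib_right)
    also have "\<dots> \<le> n * (gm (u (Suc 0) - u 0) (v (Suc 0) - v 0) / window_inf ?f \<delta> (u 0 - v 0)) + (\<epsilon>1 + \<epsilon>2) * n / fm"
      unfolding du using piece[of "A - a + 1" "B - b + 1"] by (simp add: u_def v_def)
    finally have W: "path_weight ?w \<sigma> \<le> n * (gm (u (Suc 0) - u 0) (v (Suc 0) - v 0) / window_inf ?f \<delta> (u 0 - v 0)) + (\<epsilon>1 + \<epsilon>2) * n / fm" .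
    have mesh: "u (Suc 0) - u 0 + (v (Suc 0) - v 0) \<le> \<delta>"
    proof -
      have "real (A - a + 1) + real (B - b + 1) \<le> \<delta> * n" using sz h by simp
      then have "(real (A - a + 1) + real (B - b + 1)) / n \<le> \<delta>" using n0 by (simp add: pos_divide_le_eq)
      then show ?thesis unfolding du by (simp only: add_divide_distrib)
    qed
    have "0 \<le> u (Suc 0) - u 0" "0 \<le> v (Suc 0) - v 0" unfolding du by simp_all
    then show ?thesis using W mesh
      by (intro exI[of _ u] exI[of _ v] exI[of _ "Suc 0"]) (simp add: u_def v_def)
  next
    case False
    define \<sigma>1 where "\<sigma>1 = takeWhile P \<sigma>"
    define \<sigma>2 where "\<sigma>2 = dropWhile P \<sigma>"
    have split: "\<sigma> = \<sigma>1 @ \<sigma>2" by (simp add: \<sigma>1_def \<sigma>2_def)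
    have ne1: "\<sigma>1 \<noteq> []" using ne h unfolding \<sigma>1_def P_def by (cases \<sigma>) auto
    have ne2: "\<sigma>2 \<noteq> []"
    proof
      assume "\<sigma>2 = []"
      then have "\<forall>x\<in>set \<sigma>. P x" by (simp add: \<sigma>2_def dropWhile_eq_Nil_conv)
      then show False using \<open>(A, B) \<in> set \<sigma>\<close> False by (auto simp: P_def)
    qed
    obtain a1 b1 where l1: "last \<sigma>1 = (a1, b1)" by fastforce
    obtain a2 b2 where h2: "hd \<sigma>2 = (a2, b2)" by fastforce
    have s: "successively lstep \<sigma>1" "successively lstep \<sigma>2" "lstep (a1, b1) (a2, b2)"
      using ne(4) ne1 ne2 l1 h2 unfolding split by (auto simp: successively_append_iff)
    have p1: "cell_path (a, b) (a1, b1) \<sigma>1" using s ne ne1 l1 unfolding split by (auto simp: cell_path_def)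
    have p2: "cell_path (a2, b2) (A, B) \<sigma>2" using s ne ne2 h2 unfolding split by (auto simp: cell_path_def)
    have "(a1, b1) \<in> set \<sigma>1" using ne1 l1 by (metis last_in_set)
    then have "P (a1, b1)" unfolding \<sigma>1_def by (auto dest: set_takeWhileD)
    then have lt1: "a1 + b1 < a + b + h" by (simp add: P_def)
    have "\<not> P (hd \<sigma>2)" using ne2 unfolding \<sigma>2_def by (rule hd_dropWhile)
    then have ge2: "a + b + h \<le> a2 + b2" by (simp add: P_def h2)
    have le1: "a \<le> a1" "b \<le> b1" using cell_path_bounds[OF p1] \<open>(a1, b1) \<in> set \<sigma>1\<close> by auto
    have "(a2, b2) \<in> set \<sigma>2" using ne2 h2 by (metis hd_in_set)
    then have le2: "a2 \<le> A" "b2 \<le> B" using cell_path_bounds[OF p2] by auto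
    have le12: "a1 \<le> a2" "b1 \<le> b2" "a2 \<le> a1 + 1" "b2 \<le> b1 + 1" using s(3) by (auto simp: lstep_def)
    obtain u v k where IH: "k \<le> M" "u 0 = real a2 / n" "v 0 = real b2 / n" "u k = (real A + 1) / n" "v k = (real B + 1) / n"
      "\<forall>i<k. u i \<le> u (Suc i) \<and> v i \<le> v (Suc i) \<and> u (Suc i) - u i + (v (Suc i) - v i) \<le> \<delta>"
      "path_weight ?w \<sigma>2 \<le> n * (\<Sum>i<k. gm (u (Suc i) - u i) (v (Suc i) - v i) / window_inf ?f \<delta> (u i - v i)) + k * ((\<epsilon>1 + \<epsilon>2) * n / fm)"
    proof -
      have "A + B < a2 + b2 + M * h" using Suc.prems(2) ge2 by simp
      from Suc.IH[OF p2 this] that show ?thesis by blast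
    qed
    define u' where "u' = case_nat (real a / n) u"
    define v' where "v' = case_nat (real b / n) v"
    have du: "u' (Suc 0) - u' 0 = real (a2 - a) / n" "v' (Suc 0) - v' 0 = real (b2 - b) / n"
      using le1 le12 by (auto simp: u'_def v'_def IH diff_divide_distrib[symmetric] of_nat_diff)
    have sz: "real (a1 - a) + real (b1 - b) + 1 \<le> real h" using lt1 le1 by linarith
    have "path_weight ?w \<sigma>1 \<le> (gm (a1 - a + 1) (b1 - b + 1) + \<epsilon>1 * n) / window_inf ?f \<delta> (real a / n - real b / n)"
    proof (rule piece_le[OF n f \<delta> t hyd p1])
      show "real (a1 - a) + real (b1 - b) + 1 \<le> \<delta> * n" using sz h by linarith
      show "a1 < K * n" "b1 < K * n" using le2 le12 AB by linarith+
    qed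
    \<comment> \<open>The cells of the piece fill a rectangle with sides \<open>a1 - a + 1\<close>
      and \<open>b1 - b + 1\<close>, while the chain moves on to the first cell
      \<open>(a2, b2)\<close> of the next piece. Each side changes by at most one, which
      \<open>slack\<close> covers with \<open>\<epsilon>2 * n\<close>.\<close>
    also have "\<dots> \<le> (gm (real (a2 - a)) (real (b2 - b)) + (\<epsilon>1 + \<epsilon>2) * n) / window_inf ?f \<delta> (real a / n - real b / n)"
    proof (rule divide_right_mono)
      have "gm (a1 - a + 1) (b1 - b + 1) \<le> gm (real (a2 - a) + 1) (real (b2 - b) + 1)"
        using le12 by (intro gm_mono) auto
      also have "\<dots> \<le> gm (real (a2 - a)) (real (b2 - b)) + \<epsilon>2 * n"
      proof (rule slack)
        have "a2 - a \<le> K * n" "b2 - b \<le> K * n" using le2 AB by linarith+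
        then show "real (a2 - a) \<le> real K * n" "real (b2 - b) \<le> real K * n"
          by (simp_all only: of_nat_mult[symmetric] of_nat_le_iff)
      qed auto
      finally show "gm (a1 - a + 1) (b1 - b + 1) + \<epsilon>1 * n \<le> gm (real (a2 - a)) (real (b2 - b)) + (\<epsilon>1 + \<epsilon>2) * n"
        using n0 by (simp add: distrib_right)
      show "0 \<le> window_inf ?f \<delta> (real a / n - real b / n)" using fm(1) fm(2)[OF ab] by linarith
    qed
    also have "\<dots> \<le> n * (gm (u' (Suc 0) - u' 0) (v' (Suc 0) - v' 0) / window_inf ?f \<delta> (u' 0 - v' 0)) + (\<epsilon>1 + \<epsilon>2) * n / fm"
      unfolding du using piece[of "a2 - a" "b2 - b"] by (simp add: u'_def v'_def)
    finally have W1: "path_weight ?w \<sigma>1 \<le> n * (gm (u' (Suc 0) - u' 0) (v' (Suc 0) - v' 0) / window_inf ?f \<delta> (u' 0 - v' 0)) + (\<epsilon>1 + \<epsilon>2) * n / fm" .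
    have mesh: "u' (Suc 0) - u' 0 + (v' (Suc 0) - v' 0) \<le> \<delta>"
    proof -
      have "real (a2 - a) + real (b2 - b) \<le> \<delta> * n" using sz h le12 le1 by linarith
      then have "(real (a2 - a) + real (b2 - b)) / n \<le> \<delta>" using n0 by (simp add: pos_divide_le_eq)
      then show ?thesis unfolding du by (simp only: add_divide_distrib)
    qed
    let ?T = "\<lambda>u v i. gm (u (Suc i) - u i) (v (Suc i) - v i) / window_inf ?f \<delta> (u i - v i)"
    have sumS: "(\<Sum>i<Suc k. ?T u' v' i) = ?T u' v' 0 + (\<Sum>i<k. ?T u v i)"
      unfolding sum.lessThan_Suc_shift by (simp add: u'_def v'_def)
    show ?thesis
    proof (rule exI[of _ u'], rule exI[of _ v'], rule exI[of _ "Suc k"], intro conjI allI impI)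
      show "Suc k \<le> Suc M" using IH(1) by simp
      show "u' 0 = real a / n" "v' 0 = real b / n" "u' (Suc k) = (real A + 1) / n" "v' (Suc k) = (real B + 1) / n"
        using IH by (simp_all add: u'_def v'_def)
      have d0: "0 \<le> u' (Suc 0) - u' 0" "0 \<le> v' (Suc 0) - v' 0" unfolding du by simp_all
      fix i assume i: "i < Suc k"
      show "u' i \<le> u' (Suc i)" "v' i \<le> v' (Suc i)" "u' (Suc i) - u' i + (v' (Suc i) - v' i) \<le> \<delta>"
        using i d0 mesh IH(6) by (cases i; auto simp: u'_def v'_def)+
    next
      have "path_weight ?w \<sigma> = path_weight ?w \<sigma>1 + path_weight ?w \<sigma>2"
        unfolding split by (rule path_weight_append)
      also have "\<dots> \<le> n * ?T u' v' 0 + (\<epsilon>1 + \<epsilon>2) * n / fm + (n * (\<Sum>i<k. ?T u v i) + k * ((\<epsilon>1 + \<epsilon>2) * n / fm))"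
        using W1 IH(7) by (rule add_mono)
      also have "\<dots> = n * (\<Sum>i<Suc k. ?T u' v' i) + Suc k * ((\<epsilon>1 + \<epsilon>2) * n / fm)"
      proof -
        have "real n * x + E + (real n * s + real k * E) = real n * (x + s) + real (Suc k) * E" for x s E :: real
          by (simp add: algebra_simps)
        then show ?thesis unfolding sumS .
      qed
      finally show "path_weight ?w \<sigma> \<le> n * (\<Sum>i<Suc k. ?T u' v' i) + Suc k * ((\<epsilon>1 + \<epsilon>2) * n / fm)" .
    qed
  qed
qed

lemma attains_strict: "attains f p p' r \<Longrightarrow> fst p < fst p' \<and> snd p < snd p'"
  by (induction rule: attains.induct) auto

definition near_pt :: "nat \<Rightarrow> real \<times> real \<Rightarrow> nat \<times> nat \<Rightarrow> bool" where
  "near_pt n p a \<longleftrightarrow> \<bar>real (fst a) - n * fst p\<bar> \<le> 2 \<and> \<bar>real (snd a) - n * snd p\<bar> \<le> 2"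

text \<open>The path stops at \<open>(a' - 1, b' - 1)\<close>, so the next stretch, starting at
  \<open>(a', b')\<close>, attaches by a diagonal step and no cell is counted twice. Quantifying
  over all lattice points near the ends lets stretches meet at any rounding of the common point; the
  tolerance 2 also admits the corner of the final rectangle.\<close>

definition eventually_attained :: "(nat \<Rightarrow> nat \<Rightarrow> nat \<Rightarrow> real) \<Rightarrow> real \<times> real \<Rightarrow> real \<times> real \<Rightarrow> real \<Rightarrow> bool" where
  "eventually_attained w p p' r \<longleftrightarrow> (\<forall>e>0. \<forall>\<^sub>F n in sequentially. \<forall>a b a' b'. near_pt n p (a, b) \<and> near_pt n p' (a', b') \<longrightarrow>
     0 < a' \<and> 0 < b' \<and> (\<exists>\<sigma>. cell_path (a, b) (a' - 1, b' - 1) \<sigma> \<and> real n * (r - e) \<le> path_weight (w n) \<sigma>))"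

lemma eventually_attained_join:
  assumes 1: "eventually_attained w p p' r" and 2: "eventually_attained w p' p'' r'"
    and p': "0 \<le> fst p'" "0 \<le> snd p'"
  shows "eventually_attained w p p'' (r + r')"
  unfolding eventually_attained_def
proof (intro allI impI)
  fix e :: real assume "0 < e"
  then have e: "0 < e / 2" by simp
  have "\<forall>\<^sub>F n in sequentially. \<forall>a b a' b'. near_pt n p (a, b) \<and> near_pt n p' (a', b') \<longrightarrow>
     0 < a' \<and> 0 < b' \<and> (\<exists>\<sigma>. cell_path (a, b) (a' - 1, b' - 1) \<sigma> \<and> real n * (r - e / 2) \<le> path_weight (w n) \<sigma>)"
    using 1 e unfolding eventually_attained_def by blast
  moreover have "\<forall>\<^sub>F n in sequentially. \<forall>a b a' b'. near_pt n p' (a, b) \<and> near_pt n p'' (a', b') \<longrightarrow>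
     0 < a' \<and> 0 < b' \<and> (\<exists>\<sigma>. cell_path (a, b) (a' - 1, b' - 1) \<sigma> \<and> real n * (r' - e / 2) \<le> path_weight (w n) \<sigma>)"
    using 2 e unfolding eventually_attained_def by blast
  ultimately show "\<forall>\<^sub>F n in sequentially. \<forall>a b a' b'. near_pt n p (a, b) \<and> near_pt n p'' (a', b') \<longrightarrow>
     0 < a' \<and> 0 < b' \<and> (\<exists>\<sigma>. cell_path (a, b) (a' - 1, b' - 1) \<sigma> \<and> real n * (r + r' - e) \<le> path_weight (w n) \<sigma>)"
  proof eventually_elim
    case (elim n)
    show ?case
    proof (intro allI impI)
      fix a b a' b' assume ab: "near_pt n p (a, b) \<and> near_pt n p'' (a', b')"
      define x where "x = nat \<lfloor>n * fst p'\<rfloor>"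
      define y where "y = nat \<lfloor>n * snd p'\<rfloor>"
      have "0 \<le> real n * fst p'" "0 \<le> real n * snd p'" using p' by simp_all
      then have xy: "near_pt n p' (x, y)" unfolding near_pt_def x_def y_def by simp linarith
      have h1: "0 < x" "0 < y" using elim(1) ab xy by blast+
      obtain \<sigma>1 where s1: "cell_path (a, b) (x - 1, y - 1) \<sigma>1" "real n * (r - e / 2) \<le> path_weight (w n) \<sigma>1"
        using elim(1) ab xy by blast
      have h2: "0 < a'" "0 < b'" using elim(2) ab xy by blast+
      obtain \<sigma>2 where s2: "cell_path (x, y) (a' - 1, b' - 1) \<sigma>2" "real n * (r' - e / 2) \<le> path_weight (w n) \<sigma>2"
        using elim(2) ab xy by blast
      have "cell_path (a, b) (a' - 1, b' - 1) (\<sigma>1 @ \<sigma>2)"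
        by (rule cell_path_append[OF s1(1) s2(1)]) (use h1 in \<open>auto simp: lstep_def\<close>)
      moreover have "real n * (r + r' - e) \<le> path_weight (w n) (\<sigma>1 @ \<sigma>2)"
      proof -
        have "real n * (r + r' - e) = real n * (r - e / 2) + real n * (r' - e / 2)" by (simp add: algebra_simps)
        then show ?thesis using s1(2) s2(2) by (simp add: path_weight_append)
      qed
      ultimately show "0 < a' \<and> 0 < b' \<and> (\<exists>\<sigma>. cell_path (a, b) (a' - 1, b' - 1) \<sigma> \<and> real n * (r + r' - e) \<le> path_weight (w n) \<sigma>)"
        using h2 by blast
    qed
  qed
qed

text \<open>A path that is optimal for the homogeneous weights divided by \<open>C\<close> is used;
  replacing \<open>C\<close> by the true speed only increases its weight. The slack
  \<open>\<eta>\<close> absorbs the rounding of the corners and the offset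
  \<open>\<theta>\<close>.\<close>

lemma eventually_attained_step:
  fixes c :: "real \<Rightarrow> real" and t :: "nat \<Rightarrow> nat \<Rightarrow> nat \<Rightarrow> real"
  assumes cpos: "\<And>x. 0 < c x" and t: "\<And>n i j. 0 \<le> t n i j"
    and hyd: "\<And>K e. 0 < e \<Longrightarrow> \<forall>\<^sub>F n in sequentially. hydro_bounds (t n) n K e"
    and uv: "u < u'" "v < v'" "0 \<le> u" "0 \<le> v" and \<eta>: "0 < \<eta>" and C: "0 < C"
    and fC: "\<And>x. u - v' - \<eta> \<le> x \<Longrightarrow> x \<le> u' - v + \<eta> \<Longrightarrow> c (x - q) \<le> C"
  shows "eventually_attained (\<lambda>n. cell_weight c n \<lfloor>real n * q\<rfloor> (t n)) (u, v) (u', v') (gm (u' - u) (v' - v) / C)"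
  unfolding eventually_attained_def
proof (intro allI impI)
  fix e :: real assume e: "0 < e"
  define D1 D2 where "D1 = u' - u" and "D2 = v' - v"
  have D: "0 < D1" "0 < D2" using uv by (auto simp: D1_def D2_def)
  \<comment> \<open>There are two losses of \<open>\<epsilon>1 * n\<close>, one from
    \<open>hydro_bounds\<close> and one from the rounded sides; divided by \<open>C\<close> they
    amount to at most \<open>e * n\<close>. The other terms make the sides at least
    \<open>\<epsilon>1 * n\<close>, as the lower bound requires.\<close>
  define \<epsilon>1 where "\<epsilon>1 = min (e * C / 2) (min (D1 / 2) (D2 / 2))"
  have \<epsilon>1: "0 < \<epsilon>1" "2 * \<epsilon>1 \<le> e * C" "\<epsilon>1 \<le> D1 / 2" "\<epsilon>1 \<le> D2 / 2"
    using e C D unfolding \<epsilon>1_def by (auto simp: min_def)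
  define K where "K = nat \<lceil>u' + v'\<rceil> + 3"
  have K: "u' + v' + 3 \<le> real K" unfolding K_def by linarith
  obtain \<eta>1 where \<eta>1: "\<eta>1 > 0" "\<And>a b n h. \<lbrakk>0 \<le> n; 0 \<le> a; a \<le> (D1 + D2) * n; 0 \<le> b; b \<le> (D1 + D2) * n; 0 \<le> h; h \<le> \<eta>1 * n\<rbrakk> \<Longrightarrow> gm (a + h) (b + h) \<le> gm a b + \<epsilon>1 * n"
    using gm_small_enlargement[of "D1 + D2" \<epsilon>1] D \<epsilon>1(1) by (metis add_pos_pos)
  have "\<forall>\<^sub>F n in sequentially. real n \<ge> max (max 1 (4 / \<eta>1)) (max (8 / D1 + 8 / D2) (6 / \<eta>))"
    by (rule eventually_sequentiallyI[of "nat \<lceil>max (max 1 (4 / \<eta>1)) (max (8 / D1 + 8 / D2) (6 / \<eta>))\<rceil>"]) linarith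
  then show "\<forall>\<^sub>F n in sequentially. \<forall>a b a' b'. near_pt n (u, v) (a, b) \<and> near_pt n (u', v') (a', b') \<longrightarrow>
     0 < a' \<and> 0 < b' \<and> (\<exists>\<sigma>. cell_path (a, b) (a' - 1, b' - 1) \<sigma> \<and>
       real n * (gm (u' - u) (v' - v) / C - e) \<le> path_weight (cell_weight c n \<lfloor>real n * q\<rfloor> (t n)) \<sigma>)"
    using hyd[OF \<epsilon>1(1), of K]
  proof eventually_elim
    case (elim n)
    have n: "1 \<le> real n" "4 / \<eta>1 \<le> real n" "8 / D1 + 8 / D2 \<le> real n" "6 / \<eta> \<le> real n" using elim(1) by auto
    have n1: "n \<ge> 1" using n(1) by simp
    have n0: "0 < real n" using n(1) by simp
    have pos8: "0 < 8 / D1" "0 < 8 / D2" using D by auto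
    have "8 / D1 \<le> real n" "8 / D2 \<le> real n" using n(3) pos8 by linarith+
    then have nD: "8 \<le> real n * D1" "8 \<le> real n * D2" using D by (simp_all add: pos_divide_le_eq)
    have n\<eta>: "6 \<le> real n * \<eta>" using n(4) \<eta> by (simp add: pos_divide_le_eq)
    have n\<eta>1: "4 \<le> \<eta>1 * real n" using n(2) \<eta>1(1) by (simp add: pos_divide_le_eq mult.commute)
    show ?case
    proof (intro allI impI)
      fix a b a' b' assume "near_pt n (u, v) (a, b) \<and> near_pt n (u', v') (a', b')"
      then have np: "\<bar>real a - n * u\<bar> \<le> 2" "\<bar>real b - n * v\<bar> \<le> 2" "\<bar>real a' - n * u'\<bar> \<le> 2" "\<bar>real b' - n * v'\<bar> \<le> 2"
        by (auto simp: near_pt_def)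
      have nDe: "real n * D1 = n * u' - n * u" "real n * D2 = n * v' - n * v"
        by (simp_all add: D1_def D2_def right_diff_distrib)
      have lt: "real a + (real n * D1 - 4) \<le> real a'" "real b + (real n * D2 - 4) \<le> real b'"
        using np nDe by linarith+
      then have "real a < real a'" "real b < real b'" using nD by linarith+
      then have ab: "a < a'" "b < b'" by simp_all
      obtain m k where mk: "a' = a + Suc m" "b' = b + Suc k"
        using less_imp_Suc_add[OF ab(1)] less_imp_Suc_add[OF ab(2)] by auto
      have big: "real n * D1 - 4 \<le> real (Suc m)" "real n * D2 - 4 \<le> real (Suc k)" using lt mk by simp_all
      have "n * \<epsilon>1 \<le> n * (D1 / 2)" "n * \<epsilon>1 \<le> n * (D2 / 2)" using \<epsilon>1 n0 by (intro mult_left_mono; simp)+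
      then have e1: "\<epsilon>1 * n \<le> real (Suc m)" "\<epsilon>1 * n \<le> real (Suc k)"
        using big nD by (simp_all add: mult.commute)
      have "real a' \<le> real (K * n)" "real b' \<le> real (K * n)"
      proof -
        have "n * (u' + v' + 3) \<le> n * real K" using K by (intro mult_left_mono) auto
        moreover have "n * (u' + v' + 3) = n * u' + n * v' + 3 * n" by (simp add: algebra_simps)
        moreover have "0 \<le> n * u'" "0 \<le> n * v'" using uv by auto
        ultimately show "real a' \<le> real (K * n)" "real b' \<le> real (K * n)"
          using np(3,4) n(1) by (simp_all add: mult.commute)
      qed
      then have aK: "a' \<le> K * n" "b' \<le> K * n" by (simp_all only: of_nat_le_iff)
      then have "a \<le> K * n \<and> b \<le> K * n \<and> Suc m \<le> K * n \<and> Suc k \<le> K * n" using mk by simp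
      then have low: "gm (Suc m) (Suc k) - \<epsilon>1 * n \<le> lp (\<lambda>i j. t n (a + i) (b + j)) (Suc m) (Suc k)"
        using e1 by (intro hydro_bounds_lower[OF elim(2)]) auto
      have "n * gm D1 D2 = gm (n * D1) (n * D2)" using gm_scale[of "real n" D1 D2] by simp
      also have "\<dots> = gm ((n * D1 - 4) + 4) ((n * D2 - 4) + 4)" by simp
      also have "\<dots> \<le> gm (n * D1 - 4) (n * D2 - 4) + \<epsilon>1 * n"
      proof (rule \<eta>1(2))
        have "real n * D1 \<le> (D1 + D2) * n" "real n * D2 \<le> (D1 + D2) * n"
          using D n0 by (simp_all add: algebra_simps)
        then show "real n * D1 - 4 \<le> (D1 + D2) * n" "real n * D2 - 4 \<le> (D1 + D2) * n" by linarith+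
      qed (use nD n\<eta>1 in auto)
      also have "gm (n * D1 - 4) (n * D2 - 4) \<le> gm (Suc m) (Suc k)"
        using nD big by (intro gm_mono) auto
      finally have L: "n * gm D1 D2 - 2 * (\<epsilon>1 * n) \<le> lp (\<lambda>i j. t n (a + i) (b + j)) (Suc m) (Suc k)"
        using low by simp
      obtain \<sigma> where \<sigma>: "cell_path (a, b) (a + m, b + k) \<sigma>"
        "lp (\<lambda>i j. (1 / C) * t n (a + i) (b + j)) (Suc m) (Suc k) \<le> path_weight (\<lambda>i j. (1 / C) * t n i j) \<sigma>"
        using lp_attained_by_path[of "\<lambda>i j. (1 / C) * t n i j" a b m k] t C by auto
      obtain \<theta> where \<theta>: "0 \<le> \<theta>" "\<theta> \<le> 1 / real n"
        "\<And>i j. real_of_int (int i - int j - \<lfloor>real n * q\<rfloor>) / real n = (real i - real j) / real n + \<theta> - q"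
        using cell_speed_offset[OF n1] by metis
      have w: "path_weight (\<lambda>i j. (1 / C) * t n i j) \<sigma> \<le> path_weight (cell_weight c n \<lfloor>real n * q\<rfloor> (t n)) \<sigma>"
      proof (rule path_weight_mono)
        fix i j assume "(i, j) \<in> set \<sigma>"
        then have ij: "a \<le> i" "i \<le> a + m" "b \<le> j" "j \<le> b + k" using cell_path_bounds[OF \<sigma>(1)] by fastforce+
        have "real n * (u - v' - \<eta>) \<le> real i - real j"
        proof -
          have "real n * (u - v' - \<eta>) = n * u - n * v' - n * \<eta>" by (simp add: algebra_simps)
          moreover have "real j + 1 \<le> real b'" "real a \<le> real i" using ij mk by simp_all
          ultimately show ?thesis using np(1,4) n\<eta> by linarith
        qed
        then have l: "u - v' - \<eta> \<le> (real i - real j) / n" using n0 by (simp add: pos_le_divide_eq mult.commute)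
        have "real i - real j + 1 \<le> real n * (u' - v + \<eta>)"
        proof -
          have "real n * (u' - v + \<eta>) = n * u' - n * v + n * \<eta>" by (simp add: algebra_simps)
          moreover have "real i + 1 \<le> real a'" "real b \<le> real j" using ij mk by simp_all
          ultimately show ?thesis using np(2,3) n\<eta> by linarith
        qed
        then have "(real i - real j + 1) / n \<le> u' - v + \<eta>" using n0 by (simp add: pos_divide_le_eq mult.commute)
        then have r: "(real i - real j) / n + 1 / n \<le> u' - v + \<eta>" by (simp only: add_divide_distrib)
        have "c ((real i - real j) / n + \<theta> - q) \<le> C" using l r \<theta>(1,2) by (intro fC) linarith+
        then show "(1 / C) * t n i j \<le> cell_weight c n \<lfloor>real n * q\<rfloor> (t n) i j"
          using cpos t[of n i j] unfolding cell_weight_def \<theta>(3) by (simp add: frac_le)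
      qed
      have "real n * (gm (u' - u) (v' - v) / C - e) \<le> (1 / C) * (n * gm D1 D2 - 2 * (\<epsilon>1 * n))"
      proof -
        have "2 * \<epsilon>1 / C \<le> e" using \<epsilon>1(2) C by (simp add: pos_divide_le_eq)
        then have "n * (gm D1 D2 / C - e) \<le> n * (gm D1 D2 / C - 2 * \<epsilon>1 / C)" using n0 by (intro mult_left_mono) auto
        also have "\<dots> = (1 / C) * (n * gm D1 D2 - 2 * (\<epsilon>1 * n))" by (simp add: algebra_simps diff_divide_distrib)
        finally show ?thesis by (simp add: D1_def D2_def)
      qed
      also have "\<dots> \<le> (1 / C) * lp (\<lambda>i j. t n (a + i) (b + j)) (Suc m) (Suc k)"
        using L C by (intro mult_left_mono) auto
      also have "\<dots> = lp (\<lambda>i j. (1 / C) * t n (a + i) (b + j)) (Suc m) (Suc k)"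
        using C by (simp only: lp_scale[where c = "1 / C"] divide_nonneg_pos zero_le_one)
      also note \<sigma>(2)
      also note w
      finally have "real n * (gm (u' - u) (v' - v) / C - e) \<le> path_weight (cell_weight c n \<lfloor>real n * q\<rfloor> (t n)) \<sigma>" .
      moreover have "cell_path (a, b) (a' - 1, b' - 1) \<sigma>" using \<sigma>(1) mk by simp
      ultimately show "0 < a' \<and> 0 < b' \<and> (\<exists>\<sigma>. cell_path (a, b) (a' - 1, b' - 1) \<sigma> \<and>
       real n * (gm (u' - u) (v' - v) / C - e) \<le> path_weight (cell_weight c n \<lfloor>real n * q\<rfloor> (t n)) \<sigma>)"
        using ab by auto
    qed
  qed
qed

lemma attains_imp_eventually_attained:
  fixes c :: "real \<Rightarrow> real" and t :: "nat \<Rightarrow> nat \<Rightarrow> nat \<Rightarrow> real"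
  assumes cpos: "\<And>x. 0 < c x" and t: "\<And>n i j. 0 \<le> t n i j"
    and hyd: "\<And>K e. 0 < e \<Longrightarrow> \<forall>\<^sub>F n in sequentially. hydro_bounds (t n) n K e"
  shows "attains (\<lambda>x. c (x - q)) p p' r \<Longrightarrow> 0 \<le> fst p \<Longrightarrow> 0 \<le> snd p \<Longrightarrow>
    eventually_attained (\<lambda>n. cell_weight c n \<lfloor>real n * q\<rfloor> (t n)) p p' r"
proof (induction rule: attains.induct)
  case (step u u' v v' \<eta> C)
  then show ?case by (intro eventually_attained_step[OF cpos t hyd]) auto
next
  case (join p p' r p'' r')
  have "fst p < fst p'" "snd p < snd p'" using attains_strict[OF join(1)] by auto
  then have "0 \<le> fst p'" "0 \<le> snd p'" using join.prems by linarith+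
  then show ?case using eventually_attained_join join by blast
qed

section \<open>Comparison of the rescaled passage time with Gamma\<close>

lemma Gamma_approx:
  assumes f: "regular_speed (\<lambda>x. c (x - q))" and xy: "0 < x + y" "0 < y" and e: "0 < e"
  obtains R where "attains (\<lambda>x. c (x - q)) (0, 0) (x + y, y) R" "Gamma c q (x, y) - 2 * e \<le> R"
proof -
  let ?f = "\<lambda>x. c (x - q)"
  obtain \<delta>0 where \<delta>0: "0 < \<delta>0"
    "\<And>\<delta> u v K. \<lbrakk>0 < \<delta>; \<delta> \<le> \<delta>0; u 0 = 0; v 0 = 0; u K = x + y; v K = y;
        \<And>k. k < K \<Longrightarrow> u k \<le> u (Suc k); \<And>k. k < K \<Longrightarrow> v k \<le> v (Suc k);
        \<And>k. k < K \<Longrightarrow> u (Suc k) - u k + (v (Suc k) - v k) \<le> \<delta>\<rbrakk> \<Longrightarrow>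
      \<exists>R. attains ?f (0, 0) (x + y, y) R \<and>
        (\<Sum>k<K. gm (u (Suc k) - u k) (v (Suc k) - v k) / window_inf ?f \<delta> (u k - v k)) \<le> R + e"
    by (rule chain_value_attained[OF f xy e]) blast
  obtain fm fM where fm: "0 < fm" "\<And>z. - y - 1 \<le> z \<Longrightarrow> z \<le> x + y + 1 \<Longrightarrow> fm \<le> ?f z \<and> ?f z \<le> fM"
    using regular_speed_bounds[OF f, of "- y - 1" "x + y + 1"] by metis
  have fM: "0 < fM" using fm(1) fm(2)[of 0] xy by simp
  \<comment> \<open>One rectangle at the maximal speed yields a crude attained value, which shows
    that admissible paths exist.\<close>
  have ne: "attains ?f (0, 0) (x + y, y) (gm (x + y - 0) (y - 0) / fM)"
    by (rule attains.step[where \<eta> = 1]) (use xy fM fm(2) in auto)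
  have "\<exists>g\<in>admissible_paths (x, y). Gamma c q (x, y) - e < integral {0..1} (\<lambda>s. gamma (vector_derivative g (at s)) / c (fst (g s) - q))"
  proof (rule ccontr)
    assume "\<not> ?thesis"
    then have "Gamma c q (x, y) \<le> Gamma c q (x, y) - e"
      by (intro Gamma_le[OF ne f]) (auto simp: not_less)
    then show False using e by simp
  qed
  then obtain g where g: "g \<in> admissible_paths (x, y)"
    "Gamma c q (x, y) - e < integral {0..1} (\<lambda>s. gamma (vector_derivative g (at s)) / c (fst (g s) - q))" by blast
  obtain u v K where uv: "u 0 = 0" "v 0 = 0" "u K = x + y" "v K = y"
    "\<forall>k<K. u k \<le> u (Suc k) \<and> v k \<le> v (Suc k) \<and> u (Suc k) - u k + (v (Suc k) - v k) \<le> \<delta>0"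
    "integral {0..1} (\<lambda>s. gamma (vector_derivative g (at s)) / c (fst (g s) - q))
      \<le> (\<Sum>k<K. gm (u (Suc k) - u k) (v (Suc k) - v k) / window_inf ?f \<delta>0 (u k - v k))"
    using path_integral_le_chain[OF f \<delta>0(1) g(1)] by blast
  obtain R where "attains ?f (0, 0) (x + y, y) R"
    "(\<Sum>k<K. gm (u (Suc k) - u k) (v (Suc k) - v k) / window_inf ?f \<delta>0 (u k - v k)) \<le> R + e"
    using \<delta>0(2)[OF \<delta>0(1) order_refl uv(1-4)] uv(5) by blast
  then show ?thesis using that[of R] uv(6) g(2) by linarith
qed

text \<open>Inverting \<open>cell\<close> gives the indices minus one, so it is \<open>A + 1\<close>
  and \<open>B + 1\<close> that approximate \<open>n * (x + y)\<close> and \<open>n * y\<close>. The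
  former is a sum of two floors and can fall short by 2, the latter by 1.\<close>

lemma corner_cell:
  fixes x y :: real
  assumes "1 \<le> real n * y - 1" "2 \<le> real n * (x + y) - 1"
  obtains A B where "(\<lfloor>real n * x\<rfloor>, \<lfloor>real n * y\<rfloor>) = cell A B"
    "real n * (x + y) - 2 \<le> real A + 1" "real A + 1 \<le> real n * (x + y)"
    "real n * y - 1 \<le> real B + 1" "real B + 1 \<le> real n * y"
proof
  let ?i = "\<lfloor>real n * x\<rfloor>" and ?j = "\<lfloor>real n * y\<rfloor>"
  have "real n * (x + y) = real n * x + real n * y" by (simp add: distrib_left)
  then have ij: "1 \<le> ?j" "1 \<le> ?i + ?j" "real n * (x + y) - 2 \<le> real_of_int (?i + ?j)"
    "real_of_int (?i + ?j) \<le> real n * (x + y)"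
    using assms by linarith+
  define A where "A = nat (?i + ?j - 1)"
  define B where "B = nat (?j - 1)"
  have AB: "int A = ?i + ?j - 1" "int B = ?j - 1" using ij by (auto simp: A_def B_def)
  have r: "real A + 1 = real_of_int (?i + ?j)" "real B + 1 = real_of_int ?j"
    using AB by (metis add.commute diff_add_cancel of_int_1 of_int_add of_int_of_nat_eq)+
  show "(?i, ?j) = cell A B" using AB by (simp add: cell_def)
  show "real n * (x + y) - 2 \<le> real A + 1" "real A + 1 \<le> real n * (x + y)" using ij r by simp_all
  show "real n * y - 1 \<le> real B + 1" "real B + 1 \<le> real n * y" unfolding r by linarith+
qed

lemma eventually_ge_real: "\<forall>\<^sub>F n in sequentially. r \<le> real n"
  using filterlim_real_sequentially unfolding filterlim_at_top by blast

text \<open>The order of the constants matters: the mesh \<open>\<delta>\<close> comes from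
  \<open>chain_value_attained\<close>, it fixes the number \<open>M\<close> of pieces independently
  of \<open>n\<close>, and only then is the tolerance of \<open>hydro_bounds\<close> chosen, small
  compared with \<open>1 / M\<close>.\<close>

lemma lpp_upper:
  fixes c :: "real \<Rightarrow> real" and tau :: "nat \<Rightarrow> int \<times> int \<Rightarrow> real"
  assumes f: "regular_speed (\<lambda>x. c (x - q))" and xy: "0 < x + y" "0 < y" and e: "0 < e"
    and t: "\<And>n i j. 0 \<le> tau n (cell i j)"
    and hyd: "\<And>K e. 0 < e \<Longrightarrow> \<forall>\<^sub>F n in sequentially. hydro_bounds (\<lambda>i j. tau n (cell i j)) n K e"
  shows "\<forall>\<^sub>F n in sequentially. lpp c n \<lfloor>real n * q\<rfloor> (tau n) (\<lfloor>real n * x\<rfloor>, \<lfloor>real n * y\<rfloor>)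
    \<le> real n * (Gamma c q (x, y) + 2 * e)"
proof -
  let ?f = "\<lambda>x. c (x - q)"
  define U V where "U = x + y" and "V = y"
  have UV: "0 < U" "0 < V" using xy by (simp_all add: U_def V_def)
  obtain \<delta>0 where \<delta>0: "0 < \<delta>0"
    "\<And>\<delta> u v K. \<lbrakk>0 < \<delta>; \<delta> \<le> \<delta>0; u 0 = 0; v 0 = 0; u K = U; v K = V;
        \<And>k. k < K \<Longrightarrow> u k \<le> u (Suc k); \<And>k. k < K \<Longrightarrow> v k \<le> v (Suc k);
        \<And>k. k < K \<Longrightarrow> u (Suc k) - u k + (v (Suc k) - v k) \<le> \<delta>\<rbrakk> \<Longrightarrow>
      \<exists>R. attains ?f (0, 0) (U, V) R \<and>
        (\<Sum>k<K. gm (u (Suc k) - u k) (v (Suc k) - v k) / window_inf ?f \<delta> (u k - v k)) \<le> R + e"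
    by (rule chain_value_attained[OF f UV e]) blast
  define \<delta> where "\<delta> = min \<delta>0 1"
  have \<delta>: "0 < \<delta>" "\<delta> \<le> \<delta>0" "\<delta> \<le> 1" using \<delta>0(1) by (auto simp: \<delta>_def)
  obtain fm fM where fm: "0 < fm" "\<And>z. - V - 1 \<le> z \<Longrightarrow> z \<le> U + 1 \<Longrightarrow> fm \<le> ?f z \<and> ?f z \<le> fM"
    using regular_speed_bounds[OF f, of "- V - 1" "U + 1"] by metis
  \<comment> \<open>Pieces of length \<open>h \<ge> \<delta> * n / 2\<close> cover the total length
    \<open>n * (U + V)\<close> if there are at least \<open>2 * (U + V) / \<delta>\<close> of
    them.\<close>
  define M where "M = nat \<lceil>2 * (U + V) / \<delta>\<rceil> + 1"
  have M: "2 * (U + V) / \<delta> \<le> real M" "0 < real M" unfolding M_def by linarith+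
  \<comment> \<open>Each piece costs \<open>2 * \<epsilon> * n / fm\<close>, so that
    \<open>M\<close> of them cost \<open>e * n\<close>.\<close>
  define \<epsilon> where "\<epsilon> = e * fm / (2 * M)"
  have \<epsilon>: "0 < \<epsilon>" using e fm(1) M(2) by (simp add: \<epsilon>_def)
  define K where "K = nat \<lceil>U + V\<rceil> + 1"
  have K: "U + V \<le> real K" "0 < real K" unfolding K_def by linarith+
  obtain \<eta> where \<eta>: "\<eta> > 0" "\<eta> \<le> 1"
    "\<And>a b n h. \<lbrakk>0 \<le> n; 0 \<le> a; a \<le> real K * n; 0 \<le> b; b \<le> real K * n; 0 \<le> h; h \<le> \<eta> * n\<rbrakk> \<Longrightarrow> gm (a + h) (b + h) \<le> gm a b + \<epsilon> * n"
  proof (rule gm_small_enlargement[OF K(2) \<epsilon>], goal_cases)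
    case (1 \<eta>)
    show ?case by (rule 1(1)[OF 1(2-4)])
  qed
  show ?thesis
    using hyd[OF \<epsilon>, of K] eventually_ge_real[of 1] eventually_ge_real[of "1 / \<eta>"] eventually_ge_real[of "4 / \<delta>"]
      eventually_ge_real[of "3 / U"] eventually_ge_real[of "3 / V"]
  proof eventually_elim
    case (elim n)
    have n1: "n \<ge> 1" and n0: "0 < real n" using elim(2) by auto
    have n\<eta>: "1 \<le> \<eta> * n" using elim(3) \<eta>(1) by (simp add: pos_divide_le_eq mult.commute)
    have n\<delta>: "4 \<le> \<delta> * n" using elim(4) \<delta>(1) by (simp add: pos_divide_le_eq mult.commute)
    have nU: "3 \<le> real n * U" using elim(5) UV by (simp add: pos_divide_le_eq)
    have nV: "3 \<le> real n * V" using elim(6) UV by (simp add: pos_divide_le_eq)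
    obtain A B where AB: "(\<lfloor>real n * x\<rfloor>, \<lfloor>real n * y\<rfloor>) = cell A B"
      "real n * U - 2 \<le> real A + 1" "real A + 1 \<le> real n * U"
      "real n * V - 1 \<le> real B + 1" "real B + 1 \<le> real n * V"
      using corner_cell[of n y x] nU nV unfolding U_def V_def by auto
    define h where "h = nat \<lfloor>\<delta> * n\<rfloor> - 1"
    have h: "1 \<le> h" "real h + 1 \<le> \<delta> * n" "\<delta> * n / 2 \<le> real h" using n\<delta> unfolding h_def by linarith+
    have UVn: "real n * U + real n * V \<le> real M * real h"
    proof -
      have "real n * s = (2 * s / \<delta>) * (\<delta> * n / 2)" for s :: real using \<delta>(1) by simp
      from this[of "U + V"] have "real n * U + real n * V = (2 * (U + V) / \<delta>) * (\<delta> * n / 2)"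
        by (simp only: distrib_left[of "real n"])
      also have "\<dots> \<le> real M * real h" using M h n\<delta> by (intro mult_mono) auto
      finally show ?thesis .
    qed
    then have "real (A + B) < real (0 + 0 + M * h)" using AB by simp
    then have MH: "A + B < 0 + 0 + M * h" by (simp only: of_nat_less_iff)
    have "real n * U \<le> real n * K" "real n * V \<le> real n * K" using K UV by (intro mult_left_mono; simp)+
    then have "real A < real (K * n)" "real B < real (K * n)" using AB by (simp_all add: mult.commute)
    then have ABK: "A < K * n" "B < K * n" by (simp_all only: of_nat_less_iff)
    have wfm: "fm \<le> window_inf ?f \<delta> (real a / n - real b / n)" if "a \<le> A" "b \<le> B" for a b
    proof (rule window_inf_ge)
      have "real a \<le> n * U" "real b \<le> n * V" using that AB by linarith+
      then have "real a / n \<le> U" "real b / n \<le> V" using n0 by (simp_all add: pos_divide_le_eq mult.commute)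
      moreover have "0 \<le> real a / n" "0 \<le> real b / n" by simp_all
      ultimately show "fm \<le> ?f z" if "\<bar>z - (real a / n - real b / n)\<bar> \<le> \<delta>" for z
        using fm(2)[of z] that \<delta>(3) by linarith
    qed (use \<delta> in simp)
    have slack: "gm (a + 1) (b + 1) \<le> gm a b + \<epsilon> * n" if "0 \<le> a" "a \<le> real K * n" "0 \<le> b" "b \<le> real K * n" for a b
      by (rule \<eta>(3)) (use that n\<eta> in auto)
    have main: "path_weight (cell_weight c n \<lfloor>real n * q\<rfloor> (\<lambda>i j. tau n (cell i j))) \<sigma> \<le> real n * (Gamma c q (x, y) + 2 * e)"
      if \<sigma>: "cell_path (0, 0) (A, B) \<sigma>" for \<sigma>
    proof -
      let ?T = "\<lambda>u v i. gm (u (Suc i) - u i) (v (Suc i) - v i) / window_inf ?f \<delta> (u i - v i)"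
      obtain u v k where P: "k \<le> M" "u 0 = 0" "v 0 = 0" "u k = (real A + 1) / n" "v k = (real B + 1) / n"
        "\<forall>i<k. u i \<le> u (Suc i) \<and> v i \<le> v (Suc i) \<and> u (Suc i) - u i + (v (Suc i) - v i) \<le> \<delta>"
        "path_weight (cell_weight c n \<lfloor>real n * q\<rfloor> (\<lambda>i j. tau n (cell i j))) \<sigma>
           \<le> n * (\<Sum>i<k. ?T u v i) + k * ((\<epsilon> + \<epsilon>) * n / fm)"
        using path_chain[OF n1 f \<delta>(1) t elim(1) less_imp_le[OF \<epsilon>] less_imp_le[OF \<epsilon>] slack h(1,2) fm(1) wfm ABK \<sigma> MH] by auto
      \<comment> \<open>Because of the floors the chain may end short of \<open>(U, V)\<close>, by
        \<open>3 / n\<close> in total at most. One more step closes it, and this step respects the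
        mesh since \<open>3 / n \<le> \<delta>\<close>.\<close>
      define u' where "u' i = (if i \<le> k then u i else U)" for i
      define v' where "v' i = (if i \<le> k then v i else V)" for i
      have last: "u k \<le> U" "v k \<le> V" "U - u k \<le> 2 / n" "V - v k \<le> 1 / n"
      proof -
        show "u k \<le> U" "v k \<le> V" unfolding P(4,5) using AB n0 by (simp_all add: pos_divide_le_eq mult.commute)
        have "U = (n * U) / n" "V = (n * V) / n" using n0 by simp_all
        then have "U - u k = (n * U - (real A + 1)) / n" "V - v k = (n * V - (real B + 1)) / n"
          unfolding P(4,5) by (metis diff_divide_distrib)+
        moreover have "(n * U - (real A + 1)) / n \<le> 2 / n" "(n * V - (real B + 1)) / n \<le> 1 / n"
          using AB by (intro divide_right_mono; simp)+
        ultimately show "U - u k \<le> 2 / n" "V - v k \<le> 1 / n" by simp_all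
      qed
      have "3 / n \<le> \<delta>" using n\<delta> n0 by (simp add: pos_divide_le_eq)
      moreover have "2 / real n + 1 / real n = 3 / n" by (simp add: add_divide_distrib[symmetric])
      ultimately have lastm: "U - u k + (V - v k) \<le> \<delta>" using last by linarith
      have st: "u' i \<le> u' (Suc i)" "v' i \<le> v' (Suc i)" "u' (Suc i) - u' i + (v' (Suc i) - v' i) \<le> \<delta>" if "i < Suc k" for i
        using that P(6) last lastm by (cases "i = k"; auto simp: u'_def v'_def)+
      obtain R where R: "attains ?f (0, 0) (U, V) R" "(\<Sum>i<Suc k. ?T u' v' i) \<le> R + e"
        using \<delta>0(2)[of \<delta> u' v' "Suc k"] \<delta> st P(2,3) by (auto simp: u'_def v'_def simp del: sum.lessThan_Suc)
      have RG: "R \<le> Gamma c q (x, y)" using Gamma_ge_attained[OF f xy] R(1) by (simp add: U_def V_def)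
      have "(\<Sum>i<k. ?T u v i) = (\<Sum>i<k. ?T u' v' i)"
        by (intro sum.cong) (auto simp: u'_def v'_def)
      also have "\<dots> \<le> (\<Sum>i<Suc k. ?T u' v' i)"
        using divide_nonneg_pos[OF gm_nonneg window_inf_pos[OF f less_imp_le[OF \<delta>(1)]]] by simp
      finally have S: "(\<Sum>i<k. ?T u v i) \<le> Gamma c q (x, y) + e" using R(2) RG by linarith
      have "k * ((\<epsilon> + \<epsilon>) * n / fm) \<le> M * ((\<epsilon> + \<epsilon>) * n / fm)"
        using P(1) \<epsilon> fm(1) by (intro mult_right_mono) auto
      also have "\<dots> = n * e" using fm(1) M(2) by (simp add: \<epsilon>_def)
      finally have "k * ((\<epsilon> + \<epsilon>) * n / fm) \<le> n * e" .
      moreover have "n * (\<Sum>i<k. ?T u v i) \<le> n * (Gamma c q (x, y) + e)"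
        using S by (rule mult_left_mono) simp
      ultimately have "path_weight (cell_weight c n \<lfloor>real n * q\<rfloor> (\<lambda>i j. tau n (cell i j))) \<sigma> \<le> n * (Gamma c q (x, y) + e) + n * e"
        using P(7) by linarith
      then show ?thesis by (simp add: algebra_simps)
    qed
    show ?case unfolding AB(1) by (rule lpp_cell(2)[OF main])
  qed
qed

lemma lpp_lower:
  fixes c :: "real \<Rightarrow> real" and tau :: "nat \<Rightarrow> int \<times> int \<Rightarrow> real"
  assumes cpos: "\<And>x. 0 < c x" and f: "regular_speed (\<lambda>x. c (x - q))" and xy: "0 < x + y" "0 < y" and e: "0 < e"
    and t: "\<And>n i j. 0 \<le> tau n (cell i j)"
    and hyd: "\<And>K e. 0 < e \<Longrightarrow> \<forall>\<^sub>F n in sequentially. hydro_bounds (\<lambda>i j. tau n (cell i j)) n K e"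
  shows "\<forall>\<^sub>F n in sequentially. real n * (Gamma c q (x, y) - 3 * e)
    \<le> lpp c n \<lfloor>real n * q\<rfloor> (tau n) (\<lfloor>real n * x\<rfloor>, \<lfloor>real n * y\<rfloor>)"
proof -
  obtain R where R: "attains (\<lambda>x. c (x - q)) (0, 0) (x + y, y) R" "Gamma c q (x, y) - 2 * e \<le> R"
    using Gamma_approx[OF f xy e] by blast
  have "eventually_attained (\<lambda>n. cell_weight c n \<lfloor>real n * q\<rfloor> (\<lambda>i j. tau n (cell i j))) (0, 0) (x + y, y) R"
    by (rule attains_imp_eventually_attained[OF cpos t hyd R(1)]) auto
  then have "\<forall>\<^sub>F n in sequentially. \<forall>a b a' b'. near_pt n (0, 0) (a, b) \<and> near_pt n (x + y, y) (a', b') \<longrightarrow>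
     0 < a' \<and> 0 < b' \<and> (\<exists>\<sigma>. cell_path (a, b) (a' - 1, b' - 1) \<sigma> \<and>
       real n * (R - e) \<le> path_weight (cell_weight c n \<lfloor>real n * q\<rfloor> (\<lambda>i j. tau n (cell i j))) \<sigma>)"
    using e unfolding eventually_attained_def by blast
  then show ?thesis
    using eventually_ge_real[of "3 / (x + y)"] eventually_ge_real[of "3 / y"]
  proof eventually_elim
    case (elim n)
    have nU: "3 \<le> real n * (x + y)" using elim(2) xy by (simp add: pos_divide_le_eq)
    have nV: "3 \<le> real n * y" using elim(3) xy by (simp add: pos_divide_le_eq)
    obtain A B where AB: "(\<lfloor>real n * x\<rfloor>, \<lfloor>real n * y\<rfloor>) = cell A B"
      "real n * (x + y) - 2 \<le> real A + 1" "real A + 1 \<le> real n * (x + y)"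
      "real n * y - 1 \<le> real B + 1" "real B + 1 \<le> real n * y"
      using corner_cell[of n y x] nU nV by auto
    have "near_pt n (0, 0) (0, 0)" by (simp add: near_pt_def)
    moreover have "near_pt n (x + y, y) (A + 1, B + 1)"
      unfolding near_pt_def fst_conv snd_conv of_nat_add of_nat_1 using AB by linarith
    ultimately obtain \<sigma> where \<sigma>: "cell_path (0, 0) (A + 1 - 1, B + 1 - 1) \<sigma>"
      "real n * (R - e) \<le> path_weight (cell_weight c n \<lfloor>real n * q\<rfloor> (\<lambda>i j. tau n (cell i j))) \<sigma>"
      using elim(1) by blast
    have "real n * (Gamma c q (x, y) - 3 * e) \<le> real n * (R - e)"
      using R(2) by (intro mult_left_mono) auto
    also note \<sigma>(2)
    also have "path_weight (cell_weight c n \<lfloor>real n * q\<rfloor> (\<lambda>i j. tau n (cell i j))) \<sigma> \<le> lpp c n \<lfloor>real n * q\<rfloor> (tau n) (cell A B)"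
      by (rule lpp_cell(1)) (use \<sigma>(1) in simp)
    finally show ?case unfolding AB(1) .
  qed
qed

lemma lpp_tendsto_Gamma:
  fixes c :: "real \<Rightarrow> real" and tau :: "nat \<Rightarrow> int \<times> int \<Rightarrow> real"
  assumes cpos: "\<And>x. 0 < c x" and f: "regular_speed (\<lambda>x. c (x - q))" and xy: "0 < x + y" "0 < y"
    and t: "\<And>n i j. 0 \<le> tau n (cell i j)"
    and hyd: "\<And>K e. 0 < e \<Longrightarrow> \<forall>\<^sub>F n in sequentially. hydro_bounds (\<lambda>i j. tau n (cell i j)) n K e"
  shows "(\<lambda>n. lpp c n \<lfloor>real n * q\<rfloor> (tau n) (\<lfloor>real n * x\<rfloor>, \<lfloor>real n * y\<rfloor>) / real n) \<longlonglongrightarrow> Gamma c q (x, y)"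
proof (rule tendstoI)
  fix e :: real assume "0 < e"
  then have e: "0 < e / 4" by simp
  have up: "\<forall>\<^sub>F n in sequentially. lpp c n \<lfloor>real n * q\<rfloor> (tau n) (\<lfloor>real n * x\<rfloor>, \<lfloor>real n * y\<rfloor>)
    \<le> real n * (Gamma c q (x, y) + 2 * (e / 4))"
    by (rule lpp_upper[where tau = tau, OF f xy e t hyd])
  have lo: "\<forall>\<^sub>F n in sequentially. real n * (Gamma c q (x, y) - 3 * (e / 4))
    \<le> lpp c n \<lfloor>real n * q\<rfloor> (tau n) (\<lfloor>real n * x\<rfloor>, \<lfloor>real n * y\<rfloor>)"
    by (rule lpp_lower[where tau = tau, OF cpos f xy e t hyd])
  show "\<forall>\<^sub>F n in sequentially. dist (lpp c n \<lfloor>real n * q\<rfloor> (tau n) (\<lfloor>real n * x\<rfloor>, \<lfloor>real n * y\<rfloor>) / real n) (Gamma c q (x, y)) < e"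
    using up lo eventually_ge_real[of 1]
  proof eventually_elim
    case (elim n)
    have n: "0 < real n" using elim(3) by simp
    let ?L = "lpp c n \<lfloor>real n * q\<rfloor> (tau n) (\<lfloor>real n * x\<rfloor>, \<lfloor>real n * y\<rfloor>)"
    have "?L / n \<le> Gamma c q (x, y) + 2 * (e / 4)"
      using elim(1) n by (simp only: pos_divide_le_eq mult.commute)
    moreover have "Gamma c q (x, y) - 3 * (e / 4) \<le> ?L / n"
      using elim(2) n by (simp only: pos_le_divide_eq mult.commute)
    ultimately show ?case using \<open>0 < e\<close> unfolding dist_real_def by linarith
  qed
qed

lemma interior_wedge:
  assumes "(x, y) \<in> interior wedge"
  shows "0 < x + y" "0 < y"
proof -
  obtain e where e: "0 < e" "ball (x, y) e \<subseteq> wedge" using assms by (auto simp: mem_interior)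
  have "(x, y - e / 2) \<in> ball (x, y) e" "(x - e / 2, y) \<in> ball (x, y) e"
    using e(1) by (auto simp: dist_Pair_Pair dist_real_def)
  then have "(x, y - e / 2) \<in> wedge" "(x - e / 2, y) \<in> wedge" using e(2) by blast+
  then show "0 < x + y" "0 < y" using e(1) by (auto simp: wedge_def)
qed

theorem mainTheorem5:
  fixes M :: "'a measure" and c :: "real \<Rightarrow> real"
    and tau :: "nat \<Rightarrow> int \<times> int \<Rightarrow> 'a \<Rightarrow> real"
  assumes "prob_space M"
    and "speed_function c"
    and "\<And>n. prob_space.indep_vars M (\<lambda>_. borel) (tau n) lattice_wedge"
    and "\<And>n p. p \<in> lattice_wedge \<Longrightarrow> distributed M lborel (tau n p) (exponential_density 1)"
  shows "\<forall>q x y. (x, y) \<in> interior wedge \<longrightarrow>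
    (AE \<omega> in M. (\<lambda>n. lpp c n \<lfloor>real n * q\<rfloor> (\<lambda>p. tau n p \<omega>) (\<lfloor>real n * x\<rfloor>, \<lfloor>real n * y\<rfloor>) / real n)
        \<longlonglongrightarrow> Gamma c q (x, y))"
proof (intro allI impI)
  fix q x y :: real assume "(x, y) \<in> interior wedge"
  note xy = interior_wedge[OF this]
  have rc: "regular_speed c" by (rule regular_speed_of_speed_function[OF assms(2)])
  \<comment> \<open>The null set left out here depends on the weights alone and is the same for all
    \<open>c\<close>, \<open>q\<close>, \<open>x\<close> and \<open>y\<close>.\<close>
  have "AE \<omega> in M. (\<forall>n a b. 0 \<le> tau n (cell a b) \<omega>) \<and>
    (\<forall>K \<epsilon>. \<epsilon> > 0 \<longrightarrow> (\<forall>\<^sub>F n in sequentially. hydro_bounds (\<lambda>a b. tau n (cell a b) \<omega>) n K \<epsilon>))"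
    by (rule uniform_hydrodynamics[OF assms(1)]) (fact assms(3), rule assms(4))
  then show "AE \<omega> in M. (\<lambda>n. lpp c n \<lfloor>real n * q\<rfloor> (\<lambda>p. tau n p \<omega>) (\<lfloor>real n * x\<rfloor>, \<lfloor>real n * y\<rfloor>) / real n)
        \<longlonglongrightarrow> Gamma c q (x, y)"
  proof eventually_elim
    case (elim \<omega>)
    show ?case
      by (rule lpp_tendsto_Gamma[OF regular_speed_pos[OF rc] regular_speed_shift[OF rc] xy]) (use elim in auto)
  qed
qed

end
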